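(* Let $T>0$. Let $(q,p,\gamma,\alpha,B)$ be the exact solution of the GWPT parameter ODE system and $w$ the exact solution of the $w$ equation (both given in the context). Let $\psi$ be the solution of the semi-classical Schrödinger equation with the normalized Gaussian initial datum, so that $\psi(x,t)=w(\eta(x),t)\exp\{(\mathrm{i}/\varepsilon)\theta(x,t)\}$. Suppose $w$ and the GWPT parameters are approximated by $\tilde w$ and $(\tilde q,\tilde p,\tilde\gamma,\tilde\alpha,\tilde B)$ with $$\max_{t\in[0,T]}\|w-\tilde w\|_{\mathbb{L}^2_\eta}\le E_1\varepsilon^{-d/4},$$ $$\max_{t\in[0,T]}\max\big(\|q-\tilde q\|_\infty,\|p-\tilde p\|_\infty,|\gamma-\tilde\gamma|,\|\alpha-\tilde\alpha\|_\infty,\|B-\tilde B\|_\infty\big)\le E_2,$$ and let $\tilde\psi(x,t)=\tilde w(\tilde\eta(x),t)\exp\{(\mathrm{i}/\varepsilon)\tilde\theta(x,t)\}$ be the reconstructed approximation. Assume that the fourth moment $$M_4=\max_{t\in[0,T]}\langle\psi(t),|x-q(t)|^4\psi(t)\rangle$$ is finite, and that for all $t\in[0,T]$ (i) $\|\nabla w\|_{\mathbb{L}^2_\eta}\le C_1(T,d)\,\varepsilon^{-d/4}$; (ii) $\|\eta\nabla w\|_{\mathbb{L}^2_\eta}:=\big(\int_{\mathbb{R}^d}|\nabla w|^2|\eta|^2\,d\eta\big)^{1/2}\le C_5(T,d)\,\varepsilon^{-d/4}$; (iii) $|\exp(-(\gamma_I-\tilde\gamma_I)/\varepsilon)-1|\le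 D_1E_2/\varepsilon$; (iv) $\exp(-(\tilde\gamma_I-\gamma_I)/\varepsilon)\le D_2$, where $C_1(T,d),C_5(T,d)$ are constants depending on $T$ and $d$, and $D_1,D_2$ are constants independent of $\varepsilon$ which may depend on $T$. Suppose further that $E_2\sim\mathcal{O}(\varepsilon)$. Then the following estimate holds for $t\in[0,T]$: $$\|\psi-\tilde\psi\|_{\mathbb{L}^2_x}\le A_1E_1+A_2E_2(1+\varepsilon^{-1/2})+A_3(\alpha_R,q,p)\,\frac{E_2}{\varepsilon}\,(\sqrt{M_4}+1),$$ where $A_3(\alpha_R,q,p)$ is a function of $\alpha_R,q,p$ (and therefore depends on time), and $A_1,A_2$ are positive constants which depend only on $T$ and the dimension $d$.
   Context: Setting. $\varepsilon>0$ is the semi-classical parameter (rescaled Planck constant); the setting of interest is $\varepsilon\ll1$, but the theorem imposes no smallness threshold on $\varepsilon$. $V:\mathbb{R}^d\to\mathbb{R}$ is a potential (smooth enough for the expressions below to make sense), and $\psi$ solves $\mathrm{i}\varepsilon\partial_t\psi=-\frac{\varepsilon^2}{2}\Delta_x\psi+V(x)\psi$ on $\mathbb{R}^d$ with $$\psi(x,0)=2^{d/4}(\pi\varepsilon)^{-d/4}\exp\{(\mathrm{i}/\varepsilon)[(x-q_0)^T\alpha_0(x-q_0)+p_0^T(x-q_0)+\gamma_0]\},$$ where $q_0,p_0\in\mathbb{R}^d$, $\gamma_0\in\mathbb{C}$, $\alpha_0$ is a complex $d\times d$ matrix whose imaginary part is positive-definite, and $\gamma_0$ is chosen so that $\|\psi(\cdot,0)\|_{\mathbb{L}^2_x}=1$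 (so the imaginary part of $\gamma_0$ depends on $\varepsilon$, while that of $\alpha_0$ does not). Subscripts $R,I$ denote real and imaginary parts. GWPT (Gaussian wave-packet transform) parameter ODE system: $$\dot q=p,\quad \dot p=-(\nabla V(q))^T,\quad \dot\gamma=\tfrac12p^Tp-V(q)+\mathrm{i}\varepsilon\operatorname{tr}(\alpha_R),\quad \dot\alpha=-2\alpha\alpha-\tfrac12\nabla\nabla V(q),\quad \dot B=-2B\alpha_R,$$ with initial values $q_0,p_0,\gamma_0,\alpha_0$ and $B(0)=\sqrt{\alpha_{0,I}}$. One has $\alpha_I=B^TB$ for all $t>0$, so $B$ is invertible. $w$ equation, for $w(\eta,t)$, $\eta\in\mathbb{R}^d$: $$\mathrm{i}\partial_tw=-\tfrac12\operatorname{tr}(B^T\nabla_\eta\nabla_\eta w\,B)+2\eta^TBB^T\eta\,w+\sqrt\varepsilon\,U(\eta;q)w,\qquad w(\eta,0)=\frac{2^{d/4}}{(\pi\varepsilon)^{d/4}}\exp(-\eta^T\eta),$$ $$U(\eta;q)=\varepsilon^{-3/2}\big[V(q+\sqrt\varepsilon B^{-1}\eta)-V(q)-\sqrt\varepsilon\,\nabla V(q)(B^{-1}\eta)-\tfrac{\varepsilon}{2}(B^{-1}\eta)^T\nabla\nabla V(q)B^{-1}\eta\big].$$ Reconstruction: $\eta(x)=\varepsilon^{-1/2}B(x-q)$, $\theta(x,t)=(x-q)^T\alpha_R(x-q)+p^T(x-q)+\gamma$; and $\tilde\eta(x)=\varepsilon^{-1/2}\tilde B(x-\tilde q)$, $\tilde\theta(x,t)=(x-\tilde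 q)^T\tilde\alpha_R(x-\tilde q)+\tilde p^T(x-\tilde q)+\tilde\gamma$. Here $\tilde q,\tilde p$ are real vectors, $\tilde\gamma$ a complex scalar, $\tilde\alpha$ a complex matrix, $\tilde B$ a real matrix, all functions of $t$. For a $d\times d$ matrix $A$, $\|A\|_\infty=\max_{\|v\|=1}\|Av\|_\infty$ over $v\in\mathbb{C}^d$. Convention: $V$, the initial parameters $q_0,p_0,\alpha_0$, and the constants in the hypotheses (including the one implicit in $E_2\sim\mathcal{O}(\varepsilon)$, i.e. $E_2$ is at most a constant times $\varepsilon$) are regarded as fixed.
   Formalization: Adds the assumption that either E_2 is below a threshold ρ>0 (automatic for small ε, as E_2=O(ε)) or |det B̃(t)| ≥ κ on [0,T] for a fixed κ>0, on which the constants may depend; otherwise, for large ε, B̃ may be nearly singular and the bound fails. *)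

theory Defs
  imports "HOL-Analysis.Analysis"
begin

subsection \<open>Differential operators on \<open>\<real>\<^sup>d\<close>\<close>

definition grad :: "(real^'n \<Rightarrow> 'a::real_normed_vector) \<Rightarrow> real^'n \<Rightarrow> 'a^'n" where
  "grad f x = (\<chi> j. frechet_derivative f (at x) (axis j 1))"

definition hess :: "(real^'n \<Rightarrow> 'a::real_normed_vector) \<Rightarrow> real^'n \<Rightarrow> 'a^'n^'n" where
  "hess f = grad (grad f)"

definition laplacian :: "(real^'n \<Rightarrow> complex) \<Rightarrow> real^'n \<Rightarrow> complex" where
  "laplacian f x = trace (hess f x)"

text \<open>Twice continuously differentiable on the whole space.  The differentiability clauses matter:
  \<^const>\<open>frechet_derivative\<close> is an arbitrary function where no derivative exists.\<close>

definition C2 :: "(real^'n \<Rightarrow> 'a::real_normed_vector) \<Rightarrow> bool" where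
  "C2 f \<longleftrightarrow> (\<forall>x. f differentiable (at x)) \<and> (\<forall>x. grad f differentiable (at x))
            \<and> continuous_on UNIV (hess f)"


subsection \<open>Matrices\<close>

definition Re_mat :: "complex^'n^'n \<Rightarrow> real^'n^'n" where
  "Re_mat A = (\<chi> i j. Re (A $ i $ j))"

definition Im_mat :: "complex^'n^'n \<Rightarrow> real^'n^'n" where
  "Im_mat A = (\<chi> i j. Im (A $ i $ j))"

definition cplx_mat :: "real^'n^'n \<Rightarrow> complex^'n^'n" where
  "cplx_mat A = (\<chi> i j. complex_of_real (A $ i $ j))"

definition quad_form :: "complex^'n^'n \<Rightarrow> real^'n \<Rightarrow> complex" where
  "quad_form A y = (\<Sum>i\<in>UNIV. \<Sum>j\<in>UNIV. A $ i $ j * complex_of_real (y $ i * y $ j))"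

definition pos_def :: "real^'n^'n \<Rightarrow> bool" where
  "pos_def A \<longleftrightarrow> transpose A = A \<and> (\<forall>x. x \<noteq> 0 \<longrightarrow> x \<bullet> (A *v x) > 0)"

text \<open>\<open>R\<close> is the positive-definite square root of \<open>A\<close>.\<close>

definition is_pd_sqrt :: "real^'n^'n \<Rightarrow> real^'n^'n \<Rightarrow> bool" where
  "is_pd_sqrt R A \<longleftrightarrow> pos_def R \<and> R ** R = A"

text \<open>The maximum norm of a complex vector.  The library's \<^const>\<open>infnorm\<close> on \<^typ>\<open>complex^'n\<close> is a
  different norm: it treats real and imaginary parts as separate coordinates.  In the matrix norm
  the vectors \<open>v\<close> range over the Euclidean unit sphere; the supremum is attained by compactness.\<close>

definition cvec_infnorm :: "complex^'n \<Rightarrow> real" where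
  "cvec_infnorm v = Max (range (\<lambda>i. cmod (v $ i)))"

definition mat_infnorm :: "complex^'n^'n \<Rightarrow> real" where
  "mat_infnorm A = (SUP v\<in>{v. norm v = 1}. cvec_infnorm (A *v v))"


subsection \<open>\<open>L\<^sup>2\<close> with respect to Lebesgue measure\<close>

definition in_L2 :: "(real^'n \<Rightarrow> 'a::real_normed_vector) \<Rightarrow> bool" where
  "in_L2 f \<longleftrightarrow> f \<in> borel_measurable lebesgue \<and> integrable lebesgue (\<lambda>x. (norm (f x))\<^sup>2)"

text \<open>Meaningful only together with \<^const>\<open>in_L2\<close>: the Bochner integral is \<open>0\<close> for non-integrable
  functions.\<close>

definition L2norm :: "(real^'n \<Rightarrow> 'a::real_normed_vector) \<Rightarrow> real" where
  "L2norm f = sqrt (LINT x|lebesgue. (norm (f x))\<^sup>2)"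


subsection \<open>The semi-classical Schroedinger equation\<close>

definition psi_init ::
  "real \<Rightarrow> real^'n \<Rightarrow> real^'n \<Rightarrow> complex \<Rightarrow> complex^'n^'n \<Rightarrow> real^'n \<Rightarrow> complex" where
  "psi_init \<epsilon> q0 p0 \<gamma>0 \<alpha>0 x =
     complex_of_real (2 powr (real CARD('n) / 4) * (pi * \<epsilon>) powr (- real CARD('n) / 4))
     * exp (\<i> / complex_of_real \<epsilon> *
            (quad_form \<alpha>0 (x - q0) + complex_of_real (p0 \<bullet> (x - q0)) + \<gamma>0))"

text \<open>Classical solutions on \<open>[0, T]\<close>; wave functions are written \<open>\<psi> x t\<close>, and time derivatives at
  \<open>0\<close> and \<open>T\<close> are one-sided.\<close>

definition schrodinger_solution ::
  "real \<Rightarrow> (real^'n \<Rightarrow> real) \<Rightarrow> real \<Rightarrow> (real^'n \<Rightarrow> complex) \<Rightarrow> (real^'n \<Rightarrow> real \<Rightarrow> complex) \<Rightarrow> bool"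
where
  "schrodinger_solution \<epsilon> V T \<psi>0 \<psi> \<longleftrightarrow>
     (\<forall>x. \<psi> x 0 = \<psi>0 x) \<and>
     (\<forall>t\<in>{0..T}. C2 (\<lambda>x. \<psi> x t)) \<and>
     (\<forall>t\<in>{0..T}. \<forall>x. \<exists>\<psi>_t.
        ((\<lambda>s. \<psi> x s) has_vector_derivative \<psi>_t) (at t within {0..T}) \<and>
        \<i> * complex_of_real \<epsilon> * \<psi>_t =
          - complex_of_real (\<epsilon>\<^sup>2 / 2) * laplacian (\<lambda>y. \<psi> y t) x + complex_of_real (V x) * \<psi> x t)"

definition fourth_moment ::
  "real \<Rightarrow> (real \<Rightarrow> real^'n) \<Rightarrow> (real^'n \<Rightarrow> real \<Rightarrow> complex) \<Rightarrow> real" where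
  "fourth_moment T q \<psi> = (SUP t\<in>{0..T}. LINT x|lebesgue. norm (x - q t) ^ 4 * (cmod (\<psi> x t))\<^sup>2)"

definition fourth_moment_finite ::
  "real \<Rightarrow> (real \<Rightarrow> real^'n) \<Rightarrow> (real^'n \<Rightarrow> real \<Rightarrow> complex) \<Rightarrow> bool" where
  "fourth_moment_finite T q \<psi> \<longleftrightarrow>
     (\<forall>t\<in>{0..T}. integrable lebesgue (\<lambda>x. norm (x - q t) ^ 4 * (cmod (\<psi> x t))\<^sup>2)) \<and>
     bdd_above ((\<lambda>t. LINT x|lebesgue. norm (x - q t) ^ 4 * (cmod (\<psi> x t))\<^sup>2) ` {0..T})"


subsection \<open>The Gaussian wave-packet transform\<close>

definition gwpt_solution ::
  "real \<Rightarrow> (real^'n \<Rightarrow> real) \<Rightarrow> real \<Rightarrow>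
   real^'n \<Rightarrow> real^'n \<Rightarrow> complex \<Rightarrow> complex^'n^'n \<Rightarrow>
   (real \<Rightarrow> real^'n) \<Rightarrow> (real \<Rightarrow> real^'n) \<Rightarrow> (real \<Rightarrow> complex) \<Rightarrow>
   (real \<Rightarrow> complex^'n^'n) \<Rightarrow> (real \<Rightarrow> real^'n^'n) \<Rightarrow> bool" where
  "gwpt_solution \<epsilon> V T q0 p0 \<gamma>0 \<alpha>0 q p \<gamma> \<alpha> B \<longleftrightarrow>
     q 0 = q0 \<and> p 0 = p0 \<and> \<gamma> 0 = \<gamma>0 \<and> \<alpha> 0 = \<alpha>0 \<and> is_pd_sqrt (B 0) (Im_mat \<alpha>0) \<and>
     (\<forall>t\<in>{0..T}.
        (q has_vector_derivative p t) (at t within {0..T}) \<and>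
        (p has_vector_derivative - grad V (q t)) (at t within {0..T}) \<and>
        (\<gamma> has_vector_derivative
           (complex_of_real ((1/2) * (p t \<bullet> p t) - V (q t))
            + \<i> * complex_of_real (\<epsilon> * trace (Re_mat (\<alpha> t))))) (at t within {0..T}) \<and>
        (\<alpha> has_vector_derivative
           (- (2 *\<^sub>R (\<alpha> t ** \<alpha> t)) - (1/2) *\<^sub>R cplx_mat (hess V (q t)))) (at t within {0..T}) \<and>
        (B has_vector_derivative - (2 *\<^sub>R (B t ** Re_mat (\<alpha> t)))) (at t within {0..T}))"

definition U_pot ::
  "real \<Rightarrow> (real^'n \<Rightarrow> real) \<Rightarrow> real^'n \<Rightarrow> real^'n^'n \<Rightarrow> real^'n \<Rightarrow> real" where
  "U_pot \<epsilon> V q B \<eta> =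
     (let y = matrix_inv B *v \<eta> in
      \<epsilon> powr (- 3 / 2) *
        (V (q + sqrt \<epsilon> *\<^sub>R y) - V q - sqrt \<epsilon> * (grad V q \<bullet> y) - \<epsilon> / 2 * (y \<bullet> (hess V q *v y))))"

definition w_solution ::
  "real \<Rightarrow> (real^'n \<Rightarrow> real) \<Rightarrow> real \<Rightarrow> (real \<Rightarrow> real^'n) \<Rightarrow> (real \<Rightarrow> real^'n^'n) \<Rightarrow>
   (real^'n \<Rightarrow> real \<Rightarrow> complex) \<Rightarrow> bool" where
  "w_solution \<epsilon> V T q B w \<longleftrightarrow>
     (\<forall>\<eta>. w \<eta> 0 = complex_of_real
        (2 powr (real CARD('n) / 4) / (pi * \<epsilon>) powr (real CARD('n) / 4) * exp (- (\<eta> \<bullet> \<eta>)))) \<and>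
     (\<forall>t\<in>{0..T}. C2 (\<lambda>\<eta>. w \<eta> t)) \<and>
     (\<forall>t\<in>{0..T}. \<forall>\<eta>. \<exists>w_t.
        ((\<lambda>s. w \<eta> s) has_vector_derivative w_t) (at t within {0..T}) \<and>
        \<i> * w_t =
          - (1/2) * trace (transpose (cplx_mat (B t)) ** hess (\<lambda>\<xi>. w \<xi> t) \<eta> ** cplx_mat (B t))
          + complex_of_real (2 * (\<eta> \<bullet> ((B t ** transpose (B t)) *v \<eta>))) * w \<eta> t
          + complex_of_real (sqrt \<epsilon> * U_pot \<epsilon> V (q t) (B t) \<eta>) * w \<eta> t)"

definition eta :: "real \<Rightarrow> real^'n^'n \<Rightarrow> real^'n \<Rightarrow> real^'n \<Rightarrow> real^'n" where
  "eta \<epsilon> B q x = \<epsilon> powr (- 1 / 2) *\<^sub>R (B *v (x - q))"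

definition theta ::
  "real^'n \<Rightarrow> real^'n \<Rightarrow> complex \<Rightarrow> complex^'n^'n \<Rightarrow> real^'n \<Rightarrow> complex" where
  "theta q p \<gamma> \<alpha> x = complex_of_real ((x - q) \<bullet> (Re_mat \<alpha> *v (x - q)) + p \<bullet> (x - q)) + \<gamma>"

definition reconstruct ::
  "real \<Rightarrow> (real \<Rightarrow> real^'n) \<Rightarrow> (real \<Rightarrow> real^'n) \<Rightarrow> (real \<Rightarrow> complex) \<Rightarrow>
   (real \<Rightarrow> complex^'n^'n) \<Rightarrow> (real \<Rightarrow> real^'n^'n) \<Rightarrow> (real^'n \<Rightarrow> real \<Rightarrow> complex) \<Rightarrow>
   real^'n \<Rightarrow> real \<Rightarrow> complex" where
  "reconstruct \<epsilon> q p \<gamma> \<alpha> B w x t =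
     w (eta \<epsilon> (B t) (q t) x) t
     * exp (\<i> / complex_of_real \<epsilon> * theta (q t) (p t) (\<gamma> t) (\<alpha> t) x)"

end

theory Submission
  imports Defs
begin

text \<open>The error splits into the phase error \<open>w(\<eta>)(e\<^sup>i\<^sup>\<theta> - e\<^sup>i\<^sup>\<theta>\<^sup>')\<close>, the transport error
  \<open>(w(\<eta>) - w(\<eta>'))e\<^sup>i\<^sup>\<theta>\<^sup>'\<close> (phases scaled by \<open>1/\<epsilon>\<close>) and the reconstruction of \<open>w - w'\<close>, which is an
  exact rescaling.  The phase error is pointwise at most a multiple of \<open>(E2/\<epsilon>)(1 + \<bar>x - q\<bar>\<^sup>2)\<bar>\<psi>\<bar>\<close>,
  hence the fourth moment.  The transport error is an integral of \<open>\<nabla>w\<close> along the segment between the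
  affine maps \<open>\<eta>\<close> and \<open>\<eta>'\<close>, on which the change of variables is uniformly nondegenerate.  Both need a
  bound on \<open>\<parallel>w\<parallel>\<close>; in place of conservation of mass, whose proof would need more decay and
  regularity in time, a Hardy inequality \<open>\<parallel>w\<parallel> \<le> C \<parallel>\<bar>\<eta>\<bar>\<nabla>w\<parallel>\<close> supplies it.  If \<open>E2\<close> is bounded below, the term
  \<open>A2 * E2\<close> absorbs the trivial bound by the triangle inequality.\<close>

subsection \<open>Affine changes of variables\<close>

text \<open>The difficulty is uniformity: the constants must be fixed before
  \<open>\<epsilon>\<close>, although \<open>\<gamma>0\<close> and \<open>w\<close> depend on it.
  Powers of \<open>\<epsilon>\<close> disappear because the Jacobian of \<open>eta\<close>
  compensates the factor \<epsilon>^(-d/4) of the hypotheses, and because normalisation makes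
  exp(-Im \<gamma>0 / \<epsilon>) a number determined by \<open>\<alpha>0\<close> alone. No
  regularity is assumed of \<open>w'\<close>, so only \<open>w\<close> is ever differentiated, and
  \<open>w - w'\<close> is only evaluated at the perturbed coordinates. The two gradient hypotheses
  have separate jobs: replacing \<open>B\<close> moves a point by an amount proportional to its
  distance from the centre, which costs the weighted gradient; replacing \<open>q\<close> moves
  every point by order E2 / sqrt \<epsilon>, which costs the plain gradient and produces the factor
  \<epsilon>^(-1/2). The dilation argument for the norm of \<open>w\<close> absorbs a multiple of
  its square into the left side, so finiteness must be known in advance; this too is extracted from
  the fourth moment. Since the trajectories stay in a bounded set, \<open>A3\<close> is taken
  constant.\<close>

lemma nn_integral_linear_unimodular:
  fixes f g :: "real^'n \<Rightarrow> real^'n"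
  assumes f: "linear f" and g: "linear g" and fg: "\<And>x. f (g x) = x" and gf: "\<And>x. g (f x) = x"
    and m: "\<And>a b. measure lebesgue (f ` cbox a b) = measure lebesgue (cbox a b)"
    and h: "h \<in> borel_measurable borel"
  shows "(\<integral>\<^sup>+x. h (f x) \<partial>lborel) = (\<integral>\<^sup>+x. h x \<partial>lborel)"
proof -
  have bf[measurable]: "f \<in> borel_measurable borel" and bg[measurable]: "g \<in> borel_measurable borel"
    using f g by (auto intro!: borel_measurable_continuous_onI linear_continuous_on simp: linear_conv_bounded_linear)
  have vim: "g -` A = f ` A" for A
    using fg gf by (auto simp: image_iff) metis
  \<comment> \<open>Lebesgue measure is determined by its values on boxes. The push-forward is taken
    along the inverse \<open>g\<close>, because preimages under \<open>g\<close> are images under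
    \<open>f\<close>, to which \<open>measure_linear_sufficient\<close> extends hypothesis
    \<open>m\<close>.\<close>
  have eq: "lborel = distr lborel borel g"
  proof (rule lborel_eqI)
    fix l u :: "real^'n"
    assume lu: "\<And>b. b \<in> Basis \<Longrightarrow> l \<bullet> b \<le> u \<bullet> b"
    have *: "f ` box l u \<in> lmeasurable \<and> 1 * measure lebesgue (box l u) = measure lebesgue (f ` box l u)"
      by (rule measure_linear_sufficient[OF f]) (simp_all add: m)
    have "emeasure (distr lborel borel g) (box l u) = emeasure lebesgue (f ` box l u)"
      using measurable_sets_borel[OF bg, of "box l u"] by (simp add: emeasure_distr vim)
    also have "\<dots> = ennreal (measure lebesgue (box l u))"
      using * by (simp add: emeasure_eq_measure2)
    finally show "emeasure (distr lborel borel g) (box l u) = (\<Prod>b\<in>Basis. (u - l) \<bullet> b)"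
      using lu by (simp add: measure_lborel_box_eq inner_diff_left)
  qed auto
  have "(\<integral>\<^sup>+x. h (f x) \<partial>lborel) = (\<integral>\<^sup>+x. h (f x) \<partial>distr lborel borel g)"
    using eq by simp
  also have "\<dots> = (\<integral>\<^sup>+x. h x \<partial>lborel)"
    using h by (subst nn_integral_distr) (auto simp: fg)
  finally show ?thesis .
qed

lemma det_matrix_shear:
  fixes m n :: "'n::finite"
  assumes "m \<noteq> n"
  shows "det (matrix (\<lambda>x::real^'n. \<chi> i. if i = m then x$m + x$n else x$i)) = 1"
proof -
  have "matrix (\<lambda>x::real^'n. \<chi> i. if i = m then x$m + x$n else x$i)
     = (\<chi> k. if k = m then row m (mat 1) + 1 *s row n (mat 1) else row k (mat 1 :: real^'n^'n))"
    by (auto simp: vec_eq_iff matrix_def row_def mat_def axis_def)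
  then show ?thesis using det_row_operation[OF assms, of "mat 1 :: real^'n^'n" 1] by (simp only: det_I)
qed

text \<open>\<open>measure_shear_interval\<close> treats boxes whose lower corner has a nonnegative
  n-th coordinate. A translation along axis n reaches this case, and its image under the shear is
  again a translation.\<close>

lemma measure_shear_cbox:
  fixes m n :: "'n::finite" and a b :: "real^'n"
  assumes mn: "m \<noteq> n"
  defines "f \<equiv> (\<lambda>x::real^'n. \<chi> i. if i = m then x$m + x$n else x$i)"
  shows "measure lebesgue (f ` cbox a b) = measure lebesgue (cbox a b)"
proof (cases "cbox a b = {}")
  case False
  have lin: "linear f"
    unfolding f_def by (rule linearI) (auto simp: plus_vec_def scaleR_vec_def algebra_simps)
  define k :: "real^'n" where "k = axis n \<bar>a $ n\<bar>"
  have cb: "cbox (k + a) (k + b) = (+) k ` cbox a b"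
    by (rule cbox_translation)
  have 1: "measure lebesgue (f ` cbox (k + a) (k + b)) = measure lebesgue (cbox (k + a) (k + b))"
    unfolding f_def 
  proof (rule measure_shear_interval[OF mn])
    show "cbox (k + a) (k + b) \<noteq> {}" unfolding cb using False by blast
    show "0 \<le> (k + a) $ n" by (simp add: k_def)
  qed
  have 2: "f ` cbox (k + a) (k + b) = (+) (f k) ` (f ` cbox a b)"
    unfolding cb image_image by (simp add: linear_add[OF lin])
  have "measure lebesgue (f ` cbox a b) = measure lebesgue (f ` cbox (k + a) (k + b))"
    unfolding 2 by (rule measure_translation[symmetric])
  also have "\<dots> = measure lebesgue (cbox a b)"
    unfolding 1 unfolding cb by (rule measure_translation)
  finally show ?thesis .
qed simp

text \<open>The library's change of variables by linear maps assumes a well-ordered index type.\<close>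

lemma nn_integral_linear_lborel:
  fixes f :: "real^'n \<Rightarrow> real^'n"
  assumes "linear f"
  shows "det (matrix f) \<noteq> 0 \<longrightarrow> (\<forall>h\<in>borel_measurable borel.
    ennreal \<bar>det (matrix f)\<bar> * (\<integral>\<^sup>+x. h (f x) \<partial>lborel) = (\<integral>\<^sup>+x. h x \<partial>lborel))"
  using assms
\<comment> \<open>The induction also passes through singular maps. The guard on the determinant
  makes the claim vacuous for those with a zero row, and multiplicativity hands it down to both
  factors of a composition.\<close>
proof (rule induct_linear_elementary)
  fix f g :: "real^'n \<Rightarrow> real^'n"
  assume lf: "linear f" and lg: "linear g"
    and f: "det (matrix f) \<noteq> 0 \<longrightarrow> (\<forall>h\<in>borel_measurable borel.
      ennreal \<bar>det (matrix f)\<bar> * (\<integral>\<^sup>+x. h (f x) \<partial>lborel) = (\<integral>\<^sup>+x. h x \<partial>lborel))"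
    and g: "det (matrix g) \<noteq> 0 \<longrightarrow> (\<forall>h\<in>borel_measurable borel.
      ennreal \<bar>det (matrix g)\<bar> * (\<integral>\<^sup>+x. h (g x) \<partial>lborel) = (\<integral>\<^sup>+x. h x \<partial>lborel))"
  have [measurable]: "f \<in> borel_measurable borel"
    using lf by (auto intro!: borel_measurable_continuous_onI linear_continuous_on simp: linear_conv_bounded_linear)
  show "det (matrix (f \<circ> g)) \<noteq> 0 \<longrightarrow> (\<forall>h\<in>borel_measurable borel.
      ennreal \<bar>det (matrix (f \<circ> g))\<bar> * (\<integral>\<^sup>+x. h ((f \<circ> g) x) \<partial>lborel) = (\<integral>\<^sup>+x. h x \<partial>lborel))"
  proof (intro impI ballI)
    fix h :: "real^'n \<Rightarrow> ennreal" assume [measurable]: "h \<in> borel_measurable borel" and "det (matrix (f \<circ> g)) \<noteq> 0"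
    then have nz: "det (matrix f) \<noteq> 0" "det (matrix g) \<noteq> 0"
      by (auto simp: matrix_compose[OF lg lf] det_mul)
    have "(\<lambda>x. h (f x)) \<in> borel_measurable borel" by measurable
    then have "ennreal \<bar>det (matrix g)\<bar> * (\<integral>\<^sup>+x. h (f (g x)) \<partial>lborel) = (\<integral>\<^sup>+x. h (f x) \<partial>lborel)"
      using bspec[OF mp[OF g nz(2)]] by blast
    moreover have "ennreal \<bar>det (matrix f)\<bar> * (\<integral>\<^sup>+x. h (f x) \<partial>lborel) = (\<integral>\<^sup>+x. h x \<partial>lborel)"
      using f nz by simp
    ultimately show "ennreal \<bar>det (matrix (f \<circ> g))\<bar> * (\<integral>\<^sup>+x. h ((f \<circ> g) x) \<partial>lborel) = (\<integral>\<^sup>+x. h x \<partial>lborel)"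
      by (simp add: matrix_compose[OF lg lf] det_mul abs_mult ennreal_mult mult.assoc)
  qed
next
  fix f :: "real^'n \<Rightarrow> real^'n" and i
  assume "linear f" "\<And>x. f x $ i = 0"
  then have "row i (matrix f) = 0" by (simp add: row_def matrix_def vec_eq_iff)
  then have "det (matrix f) = 0" by (rule det_zero_row)
  then show "det (matrix f) \<noteq> 0 \<longrightarrow> (\<forall>h\<in>borel_measurable borel.
    ennreal \<bar>det (matrix f)\<bar> * (\<integral>\<^sup>+x. h (f x) \<partial>lborel) = (\<integral>\<^sup>+x. h x \<partial>lborel))" by simp
next
  fix c :: "'n \<Rightarrow> real"
  let ?f = "\<lambda>x::real^'n. \<chi> i. c i * x$i"
  have mat: "matrix ?f = (\<chi> i j. if i = j then c i else 0)"
    by (auto simp: matrix_def vec_eq_iff axis_def)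
  have det: "det (matrix ?f) = (\<Prod>i\<in>UNIV. c i)"
    unfolding mat by (subst det_diagonal) auto
  show "det (matrix ?f) \<noteq> 0 \<longrightarrow> (\<forall>h\<in>borel_measurable borel.
    ennreal \<bar>det (matrix ?f)\<bar> * (\<integral>\<^sup>+x. h (?f x) \<partial>lborel) = (\<integral>\<^sup>+x. h x \<partial>lborel))"
  proof (intro impI ballI)
    fix h :: "real^'n \<Rightarrow> ennreal" assume [measurable]: "h \<in> borel_measurable borel" and "det (matrix ?f) \<noteq> 0"
    then have c: "c i \<noteq> 0" for i by (auto simp: det)
    \<comment> \<open>\<open>lborel_affine_euclidean\<close> indexes the scaling factors by basis
      vectors; \<open>c'\<close> is \<open>c\<close> transported to that index set.\<close>
    define c' where "c' b = b \<bullet> (\<chi> i. c i)" for b :: "real^'n"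
    have c'ax: "c' (axis i 1) = c i" for i by (simp add: c'_def inner_axis' )
    have c': "\<And>b. b \<in> Basis \<Longrightarrow> c' b \<noteq> 0"
      using c by (auto simp: Basis_vec_def c'ax)
    have sumB: "(\<Sum>b\<in>Basis. F b) = (\<Sum>i\<in>UNIV. F (axis i 1))" for F :: "real^'n \<Rightarrow> real^'n"
    proof -
      have "(Basis :: (real^'n) set) = range (\<lambda>i. axis i 1)" by (auto simp: Basis_vec_def)
      moreover have "inj (\<lambda>i::'n. axis i (1::real))" by (simp add: inj_on_def axis_eq_axis)
      ultimately show ?thesis by (metis (no_types, lifting) comp_apply sum.cong sum.reindex)
    qed
    have prodB: "(\<Prod>b\<in>Basis. \<bar>c' b\<bar>) = (\<Prod>i\<in>UNIV. \<bar>c i\<bar>)"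
    proof -
      have "(Basis :: (real^'n) set) = range (\<lambda>i. axis i 1)" by (auto simp: Basis_vec_def)
      moreover have "inj (\<lambda>i::'n. axis i (1::real))" by (simp add: inj_on_def axis_eq_axis)
      ultimately have "(\<Prod>b\<in>Basis. \<bar>c' b\<bar>) = (\<Prod>i\<in>UNIV. \<bar>c' (axis i 1)\<bar>)"
        by (metis (no_types, lifting) comp_apply prod.cong prod.reindex)
      then show ?thesis by (simp add: c'ax)
    qed
    have fe: "0 + (\<Sum>b\<in>Basis. (c' b * (x \<bullet> b)) *\<^sub>R b) = ?f x" for x
      unfolding sumB c'ax inner_axis by (simp add: vec_eq_iff axis_def if_distrib cong: if_cong)
    have [measurable]: "?f \<in> borel_measurable borel"
      by (intro borel_measurable_continuous_onI continuous_intros)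
    have "lborel = density (distr lborel borel ?f) (\<lambda>_. ennreal (\<Prod>b\<in>Basis. \<bar>c' b\<bar>))"
      using lborel_affine_euclidean[where c=c' and t=0, OF c'] unfolding fe by simp
    then have "(\<integral>\<^sup>+x. h x \<partial>lborel) = (\<integral>\<^sup>+x. h x \<partial>density (distr lborel borel ?f) (\<lambda>_. ennreal \<bar>det (matrix ?f)\<bar>))"
      by (simp add: prodB det abs_prod)
    then show "ennreal \<bar>det (matrix ?f)\<bar> * (\<integral>\<^sup>+x. h (?f x) \<partial>lborel) = (\<integral>\<^sup>+x. h x \<partial>lborel)"
      by (simp add: nn_integral_density nn_integral_cmult nn_integral_distr)
  qed
next
  fix m n :: 'n
  assume "m \<noteq> n"
  let ?p = "Transposition.transpose m n"
  let ?f = "\<lambda>x::real^'n. \<chi> i. x $ ?p i"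
  have p: "?p permutes UNIV" by (rule permutes_swap_id) auto
  have lin: "linear ?f"
    by (rule linearI) (auto simp: vec_eq_iff)
  have "matrix ?f = (\<chi> i. mat 1 $ ?p i)"
    by (auto simp: matrix_def vec_eq_iff axis_def mat_def)
  then have det: "\<bar>det (matrix ?f)\<bar> = 1"
    using det_permute_rows[OF p, of "mat 1 :: real^'n^'n"] by (simp add: sign_def)
  have inv: "?f (?f x) = x" for x by (simp add: vec_eq_iff)
  have img: "?f ` cbox a b = cbox (?f a) (?f b)" for a b
  proof (intro set_eqI iffI)
    fix x assume "x \<in> ?f ` cbox a b" then show "x \<in> cbox (?f a) (?f b)" by (auto simp: mem_box_cart)
  next
    fix x assume x: "x \<in> cbox (?f a) (?f b)"
    then have "(?f a) $ ?p i \<le> x $ ?p i \<and> x $ ?p i \<le> (?f b) $ ?p i" for i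
      unfolding mem_box_cart by blast
    then have "?f x \<in> cbox a b" by (simp add: mem_box_cart)
    then have "?f (?f x) \<in> ?f ` cbox a b" by (rule imageI)
    then show "x \<in> ?f ` cbox a b" by (simp only: inv)
  qed
  have m: "measure lebesgue (?f ` cbox a b) = measure lebesgue (cbox a b)" for a b
  proof (cases "cbox a b = {}")
    case False
    then have "cbox (?f a) (?f b) \<noteq> {}" unfolding img[symmetric] by simp
    moreover have "(\<Prod>i\<in>UNIV. b $ ?p i - a $ ?p i) = (\<Prod>i\<in>UNIV. b $ i - a $ i)"
      using prod.permute[OF p, of "\<lambda>i. b $ i - a $ i"] by (simp add: o_def)
    ultimately show ?thesis unfolding img using False by (simp add: content_cbox_cart)
  qed simp
  show "det (matrix ?f) \<noteq> 0 \<longrightarrow> (\<forall>h\<in>borel_measurable borel.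
    ennreal \<bar>det (matrix ?f)\<bar> * (\<integral>\<^sup>+x. h (?f x) \<partial>lborel) = (\<integral>\<^sup>+x. h x \<partial>lborel))"
    unfolding det using nn_integral_linear_unimodular[OF lin lin inv inv m] by simp
next
  fix m n :: 'n
  assume mn: "m \<noteq> n"
  let ?f = "\<lambda>x::real^'n. \<chi> i. if i = m then x$m + x$n else x$i"
  let ?g = "\<lambda>x::real^'n. \<chi> i. if i = m then x$m - x$n else x$i"
  have lf: "linear ?f" and lg: "linear ?g"
    by (rule linearI; auto simp: plus_vec_def scaleR_vec_def algebra_simps)+
  have "?f (?g x) = x" "?g (?f x) = x" for x using mn by (auto simp: vec_eq_iff)
  from nn_integral_linear_unimodular[OF lf lg this measure_shear_cbox[OF mn]]
  show "det (matrix ?f) \<noteq> 0 \<longrightarrow> (\<forall>h\<in>borel_measurable borel.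
    ennreal \<bar>det (matrix ?f)\<bar> * (\<integral>\<^sup>+x. h (?f x) \<partial>lborel) = (\<integral>\<^sup>+x. h x \<partial>lborel))"
    unfolding det_matrix_shear[OF mn] by simp
qed

text \<open>Stated as an equality of measures and not of integrals, because this form can be passed
  through \<open>completion\<close> to reach \<open>lebesgue\<close>.\<close>

lemma lborel_matrix_affine:
  fixes M :: "real^'n^'n"
  assumes c: "det M \<noteq> 0"
  shows "lborel = density (distr lborel borel (\<lambda>x. M *v x + c)) (\<lambda>_. ennreal \<bar>det M\<bar>)"
proof (rule measure_eqI)
  fix A :: "(real^'n) set" assume "A \<in> sets lborel"
  then have A[measurable]: "A \<in> sets borel" by simp
  have [measurable]: "(\<lambda>x. M *v x + c) \<in> borel_measurable borel"
    by (intro borel_measurable_continuous_onI continuous_intros linear_continuous_on matrix_vector_mul_bounded_linear)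
  have eqc: "lborel = distr lborel borel (\<lambda>x. c + x)"
    using lborel_affine[of 1 c] by (simp add: density_1)
  have "emeasure lborel A = (\<integral>\<^sup>+x. indicator A x \<partial>distr lborel borel (\<lambda>x. c + x))"
    unfolding eqc[symmetric] by simp
  also have "\<dots> = (\<integral>\<^sup>+x. indicator A (x + c) \<partial>lborel)"
    by (subst nn_integral_distr) (auto simp: add.commute)
  also have "\<dots> = ennreal \<bar>det M\<bar> * (\<integral>\<^sup>+x. indicator A (M *v x + c) \<partial>lborel)"
  proof -
    have "(\<lambda>x. indicator A (x + c) :: ennreal) \<in> borel_measurable borel" by measurable
    then show ?thesis
      using nn_integral_linear_lborel[OF matrix_vector_mul_linear, of M] c
      by (auto simp: matrix_of_matrix_vector_mul dest!: bspec[where x="\<lambda>x. indicator A (x + c)"])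
  qed
  also have "(\<integral>\<^sup>+x. indicator A (M *v x + c) \<partial>lborel) = (\<integral>\<^sup>+x. indicator A x \<partial>distr lborel borel (\<lambda>x. M *v x + c))"
    by (subst nn_integral_distr) auto
  also have "ennreal \<bar>det M\<bar> * \<dots> = emeasure (density (distr lborel borel (\<lambda>x. M *v x + c)) (\<lambda>_. ennreal \<bar>det M\<bar>)) A"
    by (simp add: emeasure_density nn_integral_cmult)
  finally show "emeasure lborel A = emeasure (density (distr lborel borel (\<lambda>x. M *v x + c)) (\<lambda>_. ennreal \<bar>det M\<bar>)) A" .
qed auto

text \<open>An affine bijection preserves null sets in both directions. That yields measurability
  between the completed sigma-algebras and lets completion commute with density and
  push-forward.\<close>

lemma
  fixes M :: "real^'n^'n"
  assumes c: "det M \<noteq> 0"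
  shows lebesgue_matrix_affine:
      "lebesgue = density (distr lebesgue lebesgue (\<lambda>x. M *v x + c)) (\<lambda>_. ennreal \<bar>det M\<bar>)"
    and measurable_matrix_affine: "(\<lambda>x. M *v x + c) \<in> lebesgue \<rightarrow>\<^sub>M lebesgue"
proof -
  let ?T = "\<lambda>x. M *v x + c"
  have T_borel[measurable]: "?T \<in> borel \<rightarrow>\<^sub>M borel"
    by (intro borel_measurable_continuous_onI continuous_intros linear_continuous_on matrix_vector_mul_bounded_linear)
  { fix A :: "(real^'n) set" assume A: "A \<in> sets borel"
    then have "emeasure lborel A = 0 \<longleftrightarrow> emeasure (density (distr lborel borel ?T) (\<lambda>_. ennreal \<bar>det M\<bar>)) A = 0"
      by (subst lborel_matrix_affine[OF c, symmetric]) auto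
    also have "\<dots> \<longleftrightarrow> emeasure (distr lebesgue lborel ?T) A = 0"
      using A c by (simp add: distr_completion emeasure_density nn_integral_cmult cong: distr_cong)
    finally have "emeasure lborel A = 0 \<longleftrightarrow> emeasure (distr lebesgue lborel ?T) A = 0" . }
  then have eq: "null_sets lborel = null_sets (distr lebesgue lborel ?T)"
    by (auto simp: null_sets_def)
  show "?T \<in> lebesgue \<rightarrow>\<^sub>M lebesgue"
    by (simp add: completion.measurable_completion2 eq measurable_completion)
  have "lebesgue = completion (density (distr lborel borel ?T) (\<lambda>_. ennreal \<bar>det M\<bar>))"
    using c by (subst lborel_matrix_affine[OF c]) simp_all
  also have "\<dots> = density (completion (distr lebesgue lborel ?T)) (\<lambda>_. ennreal \<bar>det M\<bar>)"
    using c by (auto intro!: always_eventually completion_density_eq simp: distr_completion cong: distr_cong)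
  also have "\<dots> = density (distr lebesgue lebesgue ?T) (\<lambda>_. ennreal \<bar>det M\<bar>)"
    by (subst completion.completion_distr_eq) (auto simp: eq measurable_completion)
  finally show "lebesgue = density (distr lebesgue lebesgue ?T) (\<lambda>_. ennreal \<bar>det M\<bar>)" .
qed

lemma nn_integral_matrix_affine:
  fixes M :: "real^'n^'n"
  assumes f[measurable]: "f \<in> borel_measurable lebesgue" and c: "det M \<noteq> 0"
  shows "(\<integral>\<^sup>+x. f (M *v x + c) \<partial>lebesgue) = ennreal (1 / \<bar>det M\<bar>) * (\<integral>\<^sup>+x. f x \<partial>lebesgue)"
proof -
  note [measurable] = measurable_matrix_affine[OF c]
  have "(\<integral>\<^sup>+x. f x \<partial>lebesgue)
      = (\<integral>\<^sup>+x. f x \<partial>density (distr lebesgue lebesgue (\<lambda>x. M *v x + c)) (\<lambda>_. ennreal \<bar>det M\<bar>))"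
    using lebesgue_matrix_affine[OF c] by simp
  also have "\<dots> = ennreal \<bar>det M\<bar> * (\<integral>\<^sup>+x. f (M *v x + c) \<partial>lebesgue)"
    by (simp add: nn_integral_density nn_integral_cmult nn_integral_distr)
  finally have "ennreal (1 / \<bar>det M\<bar>) * (\<integral>\<^sup>+x. f x \<partial>lebesgue)
      = (ennreal (1 / \<bar>det M\<bar>) * ennreal \<bar>det M\<bar>) * (\<integral>\<^sup>+x. f (M *v x + c) \<partial>lebesgue)"
    by (simp add: mult.assoc)
  also have "ennreal (1 / \<bar>det M\<bar>) * ennreal \<bar>det M\<bar> = 1"
    using c by (simp add: ennreal_mult[symmetric])
  finally show ?thesis by simp
qed

section \<open>Gradients and increments along segments\<close>

lemma norm_sum_scaleR_cart_le:
  fixes g :: "'a::real_normed_vector^'n" and v :: "real^'n"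
  shows "norm (\<Sum>j\<in>UNIV. v $ j *\<^sub>R g $ j) \<le> norm v * norm g"
proof -
  have "norm (\<Sum>j\<in>UNIV. v $ j *\<^sub>R g $ j) \<le> (\<Sum>j\<in>UNIV. \<bar>v $ j\<bar> * \<bar>norm (g $ j)\<bar>)"
    by (rule order_trans[OF norm_sum]) simp
  also have "\<dots> \<le> norm v * norm g"
    unfolding norm_vec_def using L2_set_mult_ineq[of "\<lambda>i. norm (v $ i)" "\<lambda>i. norm (g $ i)" UNIV] by simp
  finally show ?thesis .
qed

lemma frechet_derivative_eq_grad:
  fixes f :: "real^'n \<Rightarrow> 'a::real_normed_vector"
  assumes "f differentiable (at x)"
  shows "frechet_derivative f (at x) v = (\<Sum>j\<in>UNIV. v $ j *\<^sub>R grad f x $ j)"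
proof -
  have lin: "linear (frechet_derivative f (at x))"
    using assms by (rule linear_frechet_derivative)
  have "frechet_derivative f (at x) v = frechet_derivative f (at x) (\<Sum>j\<in>UNIV. v $ j *\<^sub>R axis j 1)"
    by (simp add: basis_expansion scalar_mult_eq_scaleR[symmetric])
  also have "\<dots> = (\<Sum>j\<in>UNIV. v $ j *\<^sub>R grad f x $ j)"
    by (simp add: linear_sum[OF lin] linear_scale[OF lin] grad_def)
  finally show ?thesis .
qed

lemma norm_frechet_derivative_le_grad:
  fixes f :: "real^'n \<Rightarrow> 'a::real_normed_vector"
  assumes "f differentiable (at x)"
  shows "norm (frechet_derivative f (at x) v) \<le> norm v * norm (grad f x)"
  unfolding frechet_derivative_eq_grad[OF assms] by (rule norm_sum_scaleR_cart_le)

lemma nn_integral_Icc_continuous: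
  fixes g :: "real \<Rightarrow> real"
  assumes "continuous_on {a..b} g" "\<And>s. s \<in> {a..b} \<Longrightarrow> 0 \<le> g s"
  shows "(\<integral>\<^sup>+s. ennreal (g s) * indicator {a..b} s \<partial>lborel) = ennreal (integral {a..b} g)"
proof -
  have i: "set_integrable lborel {a..b} g"
    using borel_integrable_compact[OF compact_Icc assms(1)]
    by (simp add: set_integrable_def indicator_scaleR_eq_if)
  then have "(\<integral>\<^sup>+s. ennreal (indicator {a..b} s *\<^sub>R g s) \<partial>lborel) = ennreal (LINT s:{a..b}|lborel. g s)"
    unfolding set_integrable_def set_lebesgue_integral_def using assms(2)
    by (intro nn_integral_eq_integral) (auto simp: indicator_def)
  also have "(LINT s:{a..b}|lborel. g s) = integral {a..b} g"
    using i by (rule set_borel_integral_eq_integral)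
  also have "(\<integral>\<^sup>+s. ennreal (indicator {a..b} s *\<^sub>R g s) \<partial>lborel) = (\<integral>\<^sup>+s. ennreal (g s) * indicator {a..b} s \<partial>lborel)"
    by (intro nn_integral_cong) (auto simp: indicator_def)
  finally show ?thesis .
qed

text \<open>Cauchy-Schwarz on the unit interval, in the form that the variance of the speed around
  its mean \<open>m\<close> is nonnegative.\<close>

lemma norm_increment_sq_le:
  fixes h h' :: "real \<Rightarrow> 'a::banach"
  assumes h: "\<And>s. s \<in> {0..1} \<Longrightarrow> (h has_vector_derivative h' s) (at s within {0..1})"
    and c: "continuous_on {0..1} h'"
  shows "(norm (h 1 - h 0))\<^sup>2 \<le> integral {0..1} (\<lambda>s. (norm (h' s))\<^sup>2)"
proof -
  have I: "(h' has_integral (h 1 - h 0)) {0..1}"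
    using h by (intro fundamental_theorem_of_calculus) auto
  define m where "m = integral {0..1} (\<lambda>s. norm (h' s))"
  have i1: "(\<lambda>s. norm (h' s)) integrable_on {0..1}"
    by (intro integrable_continuous_interval continuous_intros c)
  have i2: "(\<lambda>s. (norm (h' s))\<^sup>2) integrable_on {0..1}"
    by (intro integrable_continuous_interval continuous_intros c)
  have "norm (h 1 - h 0) \<le> m"
    unfolding m_def integral_unique[OF I, symmetric]
    using I i1 by (intro integral_norm_bound_integral) auto
  then have A: "(norm (h 1 - h 0))\<^sup>2 \<le> m\<^sup>2" by (intro power_mono) auto
  have "((\<lambda>s. (norm (h' s))\<^sup>2 - 2 * m * norm (h' s) + m\<^sup>2) has_integral
     (integral {0..1} (\<lambda>s. (norm (h' s))\<^sup>2) - 2 * m * m + m\<^sup>2)) {0..1}"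
    using has_integral_const_real[of "m\<^sup>2" 0 1] unfolding m_def
    by (intro has_integral_add has_integral_diff has_integral_mult_right integrable_integral i1 i2) auto
  moreover have "(norm (h' s))\<^sup>2 - 2 * m * norm (h' s) + m\<^sup>2 = (norm (h' s) - m)\<^sup>2" for s
    by (simp add: power2_eq_square algebra_simps)
  ultimately have "0 \<le> integral {0..1} (\<lambda>s. (norm (h' s))\<^sup>2) - 2 * m * m + m\<^sup>2"
    by (metis (no_types, lifting) has_integral_nonneg zero_le_power2)
  with A show ?thesis by (simp add: power2_eq_square)
qed

text \<open>The right side is an \<open>ennreal\<close> integral so that Tonelli can exchange it
  with the integral over space before any integrability is known.\<close>

lemma norm_increment_segment_sq_le:
  fixes w :: "real^'n \<Rightarrow> complex"
  assumes d: "\<And>x. w differentiable (at x)" and cg: "continuous_on UNIV (grad w)"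
  shows "ennreal ((norm (w b - w a))\<^sup>2)
    \<le> (\<integral>\<^sup>+s. ennreal ((norm (b - a) * norm (grad w (a + s *\<^sub>R (b - a))))\<^sup>2) * indicator {0..1} s \<partial>lborel)"
proof -
  define h where "h s = w (a + s *\<^sub>R (b - a))" for s
  define h' where "h' s = (\<Sum>j\<in>UNIV. (b - a) $ j *\<^sub>R grad w (a + s *\<^sub>R (b - a)) $ j)" for s :: real
  have cg': "continuous_on S (\<lambda>s. grad w (a + s *\<^sub>R (b - a)))" for S
    by (rule continuous_on_compose2[OF cg]) (auto intro!: continuous_intros)
  have ch: "continuous_on {0..1} h'"
    unfolding h'_def by (intro continuous_intros cg')
  have hd: "(h has_vector_derivative h' s) (at s within {0..1})" for s
  proof -
    have 1: "((\<lambda>s. a + s *\<^sub>R (b - a)) has_derivative (\<lambda>r. r *\<^sub>R (b - a))) (at s within {0..1})"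
      by (auto intro!: derivative_eq_intros)
    have "(w has_derivative frechet_derivative w (at (a + s *\<^sub>R (b - a)))) (at (a + s *\<^sub>R (b - a)))"
      using d by (simp add: frechet_derivative_works)
    from has_derivative_compose[OF 1 this]
    have "(h has_derivative (\<lambda>r. frechet_derivative w (at (a + s *\<^sub>R (b - a))) (r *\<^sub>R (b - a)))) (at s within {0..1})"
      by (simp add: h_def[abs_def])
    moreover have "frechet_derivative w (at (a + s *\<^sub>R (b - a))) (r *\<^sub>R (b - a)) = r *\<^sub>R h' s" for r
      by (simp only: frechet_derivative_eq_grad[OF d] h'_def scaleR_sum_right vector_scaleR_component
        real_scaleR_def scaleR_scaleR)
    ultimately show ?thesis by (simp add: has_vector_derivative_def)
  qed
  have "(norm (w b - w a))\<^sup>2 \<le> integral {0..1} (\<lambda>s. (norm (h' s))\<^sup>2)"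
    using norm_increment_sq_le[OF hd ch] by (simp add: h_def)
  also have "\<dots> \<le> integral {0..1} (\<lambda>s. (norm (b - a) * norm (grad w (a + s *\<^sub>R (b - a))))\<^sup>2)"
    by (intro integral_le integrable_continuous_interval continuous_intros ch cg' power_mono)
       (auto simp only: h'_def norm_sum_scaleR_cart_le norm_ge_zero)
  finally have "ennreal ((norm (w b - w a))\<^sup>2)
     \<le> ennreal (integral {0..1} (\<lambda>s. (norm (b - a) * norm (grad w (a + s *\<^sub>R (b - a))))\<^sup>2))"
    by (intro ennreal_leI) auto
  also have "\<dots> = (\<integral>\<^sup>+s. ennreal ((norm (b - a) * norm (grad w (a + s *\<^sub>R (b - a))))\<^sup>2) * indicator {0..1} s \<partial>lborel)"
    by (intro nn_integral_Icc_continuous[symmetric] continuous_intros cg') auto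
  finally show ?thesis .
qed

subsection \<open>Square integrals of increments\<close>

text \<open>Extended-valued, so that estimates can be chained while finiteness is still open;
  \<open>in_L2_L2norm_le\<close> converts the final bound into \<open>in_L2\<close> and
  \<open>L2norm\<close>.\<close>

definition L2sq :: "(real^'n \<Rightarrow> 'a::real_normed_vector) \<Rightarrow> ennreal" where
  "L2sq f = (\<integral>\<^sup>+x. ennreal ((norm (f x))\<^sup>2) \<partial>lebesgue)"

lemma in_L2_L2norm_le:
  assumes m[measurable]: "f \<in> borel_measurable lebesgue" and le: "L2sq f \<le> ennreal (c\<^sup>2)" and "0 \<le> c"
  shows "in_L2 f \<and> L2norm f \<le> c"
proof -
  have fin: "integrable lebesgue (\<lambda>x. (norm (f x))\<^sup>2)"
    using le unfolding L2sq_def by (intro integrableI_bounded) (auto simp: le_less_trans)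
  then have "ennreal (LINT x|lebesgue. (norm (f x))\<^sup>2) = L2sq f"
    unfolding L2sq_def by (intro nn_integral_eq_integral[symmetric]) auto
  then have "(LINT x|lebesgue. (norm (f x))\<^sup>2) \<le> c\<^sup>2"
    using le by (metis ennreal_le_iff zero_le_power2)
  then show ?thesis using fin m \<open>0 \<le> c\<close>
    unfolding in_L2_def L2norm_def by (auto intro: real_le_lsqrt)
qed

lemma L2sq_le:
  assumes "in_L2 f" "L2norm f \<le> c"
  shows "L2sq f \<le> ennreal (c\<^sup>2)"
proof -
  have "ennreal (LINT x|lebesgue. (norm (f x))\<^sup>2) = L2sq f"
    unfolding L2sq_def using assms(1) by (intro nn_integral_eq_integral[symmetric]) (auto simp: in_L2_def)
  moreover have "(LINT x|lebesgue. (norm (f x))\<^sup>2) \<le> c\<^sup>2"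
    using assms(2) unfolding L2norm_def by (rule sqrt_le_D)
  ultimately show ?thesis by (metis ennreal_leI)
qed

lemma L2sq_matrix_affine:
  fixes M :: "real^'n^'n"
  assumes [measurable]: "f \<in> borel_measurable lebesgue" and "det M \<noteq> 0"
  shows "L2sq (\<lambda>x. f (M *v x + c)) = ennreal (1 / \<bar>det M\<bar>) * L2sq f"
  unfolding L2sq_def
  by (rule nn_integral_matrix_affine[OF _ assms(2), of "\<lambda>x. ennreal ((norm (f x))\<^sup>2)"]) measurable

text \<open>Tonelli first, then the substitution z = M s x + c s at fixed \<open>s\<close>, whose
  Jacobian factor is at most 1/m. Hypothesis \<open>PQ\<close> measures the displacement by the
  position z itself, which is what the substitution leaves available. The dilation in the Hardy
  inequality and the change of wave-packet parameters are both instances.\<close>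

lemma L2sq_affine_path:
  fixes w :: "real^'n \<Rightarrow> complex" and M :: "real \<Rightarrow> real^'n^'n"
  assumes d: "\<And>x. w differentiable (at x)" and cg: "continuous_on UNIV (grad w)"
    and ca: "continuous_on UNIV a" and cb: "continuous_on UNIV b"
    and F: "\<And>s x. s \<in> {0..1} \<Longrightarrow> a x + s *\<^sub>R (b x - a x) = M s *v x + c s"
    and det: "\<And>s. s \<in> {0..1} \<Longrightarrow> m \<le> \<bar>det (M s)\<bar>" and m: "0 < m"
    and PQ: "\<And>s x. s \<in> {0..1} \<Longrightarrow> norm (b x - a x) \<le> P * norm (a x + s *\<^sub>R (b x - a x)) + Q"
  shows "L2sq (\<lambda>x. w (b x) - w (a x))
    \<le> ennreal (1 / m) * (\<integral>\<^sup>+z. ennreal (((P * norm z + Q) * norm (grad w z))\<^sup>2) \<partial>lebesgue)"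
proof -
  define G where "G z = ennreal (((P * norm z + Q) * norm (grad w z))\<^sup>2)" for z
  have [measurable]: "grad w \<in> borel_measurable borel" "a \<in> borel_measurable borel" "b \<in> borel_measurable borel"
    using cg ca cb by (auto intro: borel_measurable_continuous_onI)
  have [measurable]: "G \<in> borel_measurable borel" unfolding G_def by measurable
  define H where "H x s = ennreal ((norm (b x - a x) * norm (grad w (a x + s *\<^sub>R (b x - a x))))\<^sup>2) * indicator {0..1::real} s" for x s
  have [measurable]: "(\<lambda>(x, s). H x s) \<in> borel_measurable (lborel \<Otimes>\<^sub>M lborel)"
    unfolding H_def by measurable
  have inner: "(\<integral>\<^sup>+x. H x s \<partial>lborel) \<le> ennreal (1 / m) * (\<integral>\<^sup>+z. G z \<partial>lebesgue) * indicator {0..1} s" for s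
  proof (cases "s \<in> {0..1}")
    case True
    have dn: "det (M s) \<noteq> 0" using det[OF True] m by auto
    have "(\<integral>\<^sup>+x. H x s \<partial>lborel) \<le> (\<integral>\<^sup>+x. G (M s *v x + c s) \<partial>lborel)"
      using True PQ[OF True] unfolding H_def G_def F[OF True, symmetric]
      by (intro nn_integral_mono) (auto intro!: ennreal_leI power_mono mult_right_mono)
    also have "\<dots> = ennreal (1 / \<bar>det (M s)\<bar>) * (\<integral>\<^sup>+z. G z \<partial>lebesgue)"
      using nn_integral_matrix_affine[of G "M s" "c s", OF _ dn]
      by (simp add: nn_integral_completion measurable_completion)
    also have "\<dots> \<le> ennreal (1 / m) * (\<integral>\<^sup>+z. G z \<partial>lebesgue)"
      using det[OF True] m by (intro mult_right_mono ennreal_leI) (auto simp: frac_le)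
    finally show ?thesis using True by simp
  qed (simp add: H_def)
  have "L2sq (\<lambda>x. w (b x) - w (a x)) \<le> (\<integral>\<^sup>+x. (\<integral>\<^sup>+s. H x s \<partial>lborel) \<partial>lborel)"
    unfolding L2sq_def nn_integral_completion H_def
    by (intro nn_integral_mono norm_increment_segment_sq_le d cg)
  also have "\<dots> = (\<integral>\<^sup>+s. (\<integral>\<^sup>+x. H x s \<partial>lborel) \<partial>lborel)"
    by (rule lborel_pair.Fubini') measurable
  also have "\<dots> \<le> (\<integral>\<^sup>+s. ennreal (1 / m) * (\<integral>\<^sup>+z. G z \<partial>lebesgue) * indicator {0..1::real} s \<partial>lborel)"
    by (intro nn_integral_mono inner)
  also have "\<dots> = ennreal (1 / m) * (\<integral>\<^sup>+z. G z \<partial>lebesgue)"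
    by (simp add: nn_integral_cmult_indicator)
  finally show ?thesis unfolding G_def .
qed

lemma weighted_gradient_le:
  fixes w :: "real^'n \<Rightarrow> complex"
  assumes cg: "continuous_on UNIV (grad w)"
  shows "(\<integral>\<^sup>+z. ennreal (((P * norm z + Q) * norm (grad w z))\<^sup>2) \<partial>lebesgue)
    \<le> ennreal (2 * P\<^sup>2) * L2sq (\<lambda>z. norm z *\<^sub>R grad w z) + ennreal (2 * Q\<^sup>2) * L2sq (grad w)"
proof -
  have [measurable]: "grad w \<in> borel_measurable borel"
    using cg by (auto intro: borel_measurable_continuous_onI)
  have "((P * norm z + Q) * norm (grad w z))\<^sup>2
      \<le> 2 * P\<^sup>2 * (norm (norm z *\<^sub>R grad w z))\<^sup>2 + 2 * Q\<^sup>2 * (norm (grad w z))\<^sup>2" for z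
  proof -
    have "(P * norm z + Q)\<^sup>2 \<le> 2 * (P * norm z)\<^sup>2 + 2 * Q\<^sup>2"
      using zero_le_power2[of "P * norm z - Q"] by (simp add: power2_eq_square algebra_simps)
    then have "(P * norm z + Q)\<^sup>2 * (norm (grad w z))\<^sup>2 \<le> (2 * (P * norm z)\<^sup>2 + 2 * Q\<^sup>2) * (norm (grad w z))\<^sup>2"
      by (rule mult_right_mono) simp
    also have "\<dots> = 2 * P\<^sup>2 * (norm (norm z *\<^sub>R grad w z))\<^sup>2 + 2 * Q\<^sup>2 * (norm (grad w z))\<^sup>2"
      by (simp add: power_mult_distrib algebra_simps)
    finally show ?thesis by (simp only: power_mult_distrib)
  qed
  then have "(\<integral>\<^sup>+z. ennreal (((P * norm z + Q) * norm (grad w z))\<^sup>2) \<partial>lebesgue)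
      \<le> (\<integral>\<^sup>+z. ennreal (2 * P\<^sup>2) * ennreal ((norm (norm z *\<^sub>R grad w z))\<^sup>2)
         + ennreal (2 * Q\<^sup>2) * ennreal ((norm (grad w z))\<^sup>2) \<partial>lebesgue)"
    by (intro nn_integral_mono)
       (simp add: ennreal_mult[symmetric] ennreal_plus[symmetric] ennreal_leI del: ennreal_plus)
  also have "\<dots> = ennreal (2 * P\<^sup>2) * L2sq (\<lambda>z. norm z *\<^sub>R grad w z) + ennreal (2 * Q\<^sup>2) * L2sq (grad w)"
    unfolding L2sq_def nn_integral_completion by (simp add: nn_integral_add nn_integral_cmult)
  finally show ?thesis .
qed

text \<open>Young's inequality with a free weight \<open>t\<close>. The weight matters in the Hardy
  inequality: there t = 1 would give the unknown norm the coefficient 1 on the right, and nothing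
  could be absorbed.\<close>

lemma L2sq_add_le:
  assumes f[measurable]: "f \<in> borel_measurable lebesgue" and g[measurable]: "g \<in> borel_measurable lebesgue"
    and t: "0 < t"
  shows "L2sq (\<lambda>x. f x + g x) \<le> ennreal (1 + t) * L2sq f + ennreal (1 + 1 / t) * L2sq g"
proof -
  have "(norm (f x + g x))\<^sup>2 \<le> (1 + t) * (norm (f x))\<^sup>2 + (1 + 1 / t) * (norm (g x))\<^sup>2" for x
  proof -
    have "0 \<le> (t * norm (f x) - norm (g x))\<^sup>2 / t" using t by simp
    also have "\<dots> = t * (norm (f x))\<^sup>2 - 2 * norm (f x) * norm (g x) + 1 / t * (norm (g x))\<^sup>2"
      using t by (simp add: power2_eq_square field_simps)
    finally have "(norm (f x) + norm (g x))\<^sup>2 \<le> (1 + t) * (norm (f x))\<^sup>2 + (1 + 1 / t) * (norm (g x))\<^sup>2"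
      by (simp add: power2_eq_square algebra_simps)
    with power_mono[OF norm_triangle_ineq[of "f x" "g x"], of 2] show ?thesis
      by (meson norm_ge_zero order_trans)
  qed
  then have "L2sq (\<lambda>x. f x + g x) \<le> (\<integral>\<^sup>+x. ennreal (1 + t) * ennreal ((norm (f x))\<^sup>2)
       + ennreal (1 + 1 / t) * ennreal ((norm (g x))\<^sup>2) \<partial>lebesgue)"
    unfolding L2sq_def using t
    by (intro nn_integral_mono)
       (simp add: ennreal_mult[symmetric] ennreal_plus[symmetric] ennreal_leI del: ennreal_plus)
  also have "\<dots> = ennreal (1 + t) * L2sq f + ennreal (1 + 1 / t) * L2sq g"
    unfolding L2sq_def by (simp add: nn_integral_add nn_integral_cmult)
  finally show ?thesis .
qed

lemma matrix_scaleR_self: "matrix ((*\<^sub>R) r) *v x = r *\<^sub>R x" for x :: "real^'n"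
  by (metis linear_scale_self matrix_vector_mul(2))

text \<open>A Hardy inequality by dilation: since \<open>\<parallel>w(2\<cdot>)\<parallel>\<^sup>2 \<le> \<parallel>w\<parallel>\<^sup>2 / 2\<close>, the norm of \<open>w\<close> is controlled by
  that of \<open>w(2\<cdot>) - w\<close>, an increment in the radial direction.\<close>

lemma L2sq_le_radial_gradient:
  fixes w :: "real^'n \<Rightarrow> complex"
  assumes d: "\<And>x. w differentiable (at x)" and cg: "continuous_on UNIV (grad w)"
    and fin: "L2sq w < \<infinity>"
  shows "L2sq w \<le> 24 * L2sq (\<lambda>z. norm z *\<^sub>R grad w z)"
proof -
  have cw: "continuous_on UNIV w"
    using d by (simp add: continuous_at_imp_continuous_on differentiable_imp_continuous_within)
  define w2 where "w2 x = w (2 *\<^sub>R x)" for x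
  have cw2: "continuous_on UNIV w2" unfolding w2_def
    by (rule continuous_on_compose2[OF cw]) (auto intro!: continuous_intros)
  have wm[measurable]: "w \<in> borel_measurable lebesgue" and w2m[measurable]: "w2 \<in> borel_measurable lebesgue"
    using cw cw2 by (auto intro!: measurable_completion borel_measurable_continuous_onI)
  have mat: "x + s *\<^sub>R (2 *\<^sub>R x - x) = matrix ((*\<^sub>R) (1 + s)) *v x + 0" for x :: "real^'n" and s
    by (simp add: matrix_scaleR_self scaleR_2 scaleR_add_left)
  have det1: "1 \<le> \<bar>det (matrix ((*\<^sub>R) (1 + s)) :: real^'n^'n)\<bar>" if "s \<in> {0..1}" for s
    using that by (simp add: power_abs)
  have diff: "L2sq (\<lambda>x. w2 x - w x) \<le> 2 * L2sq (\<lambda>z. norm z *\<^sub>R grad w z)"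
  proof -
    have "L2sq (\<lambda>x. w (2 *\<^sub>R x) - w x)
      \<le> ennreal (1 / 1) * (\<integral>\<^sup>+z. ennreal (((1 * norm z + 0) * norm (grad w z))\<^sup>2) \<partial>lebesgue)"
    proof (rule L2sq_affine_path[OF d cg _ _ mat det1])
      fix s :: real and x :: "real^'n" assume "s \<in> {0..1}"
      have "norm x \<le> (1 + s) * norm x"
        using \<open>s \<in> {0..1}\<close> by (simp add: algebra_simps)
      also have "\<dots> = norm (x + s *\<^sub>R (2 *\<^sub>R x - x))"
      proof -
        have "x + s *\<^sub>R (2 *\<^sub>R x - x) = (1 + s) *\<^sub>R x" by (simp add: scaleR_2 scaleR_add_left)
        then show ?thesis using \<open>s \<in> {0..1}\<close> by simp
      qed
      finally show "norm (2 *\<^sub>R x - x) \<le> 1 * norm (x + s *\<^sub>R (2 *\<^sub>R x - x)) + 0"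
        by (simp add: scaleR_2)
    qed (auto intro!: continuous_intros)
    also have "\<dots> \<le> ennreal (2 * 1\<^sup>2) * L2sq (\<lambda>z. norm z *\<^sub>R grad w z) + ennreal (2 * 0\<^sup>2) * L2sq (grad w)"
      using weighted_gradient_le[OF cg, of 1 0] by simp
    finally show ?thesis by (simp add: w2_def)
  qed
  have "L2sq w2 = ennreal (1 / \<bar>det (matrix ((*\<^sub>R) 2) :: real^'n^'n)\<bar>) * L2sq w"
  proof -
    have "det (matrix ((*\<^sub>R) 2) :: real^'n^'n) \<noteq> 0" by simp
    from L2sq_matrix_affine[OF wm this, of 0] show ?thesis
      by (simp add: w2_def[abs_def] matrix_scaleR_self)
  qed
  also have "\<dots> \<le> ennreal (1/2) * L2sq w"
  proof (intro mult_right_mono ennreal_leI)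
    have "(2::real) ^ 1 \<le> 2 ^ CARD('n)" by (intro power_increasing) (auto simp: Suc_leI)
    then show "1 / \<bar>det (matrix ((*\<^sub>R) 2) :: real^'n^'n)\<bar> \<le> 1/2" by (simp add: field_simps)
  qed simp
  finally have half: "L2sq w2 \<le> ennreal (1/2) * L2sq w" .
  have sym: "L2sq (\<lambda>x. w x - w2 x) = L2sq (\<lambda>x. w2 x - w x)"
    unfolding L2sq_def by (simp add: norm_minus_commute)
  have "L2sq w = L2sq (\<lambda>x. w2 x + (w x - w2 x))" by simp
  \<comment> \<open>With t = 1/2 the halving by dilation leaves the coefficient 3/2 times 1/2, that
    is 3/4, in front of \<open>L2sq w\<close>.\<close>
  also have "\<dots> \<le> ennreal (1 + 1/2) * L2sq w2 + ennreal (1 + 1/(1/2)) * L2sq (\<lambda>x. w x - w2 x)"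
    by (rule L2sq_add_le) measurable
  also have "\<dots> \<le> ennreal (3/2) * (ennreal (1/2) * L2sq w) + ennreal 3 * (2 * L2sq (\<lambda>z. norm z *\<^sub>R grad w z))"
    unfolding sym using half diff by (intro add_mono mult_mono) auto
  finally have *: "L2sq w \<le> ennreal (3/2) * (ennreal (1/2) * L2sq w) + ennreal 3 * (2 * L2sq (\<lambda>z. norm z *\<^sub>R grad w z))" .
  \<comment> \<open>For finite values u \<le> 3/4 u + 6 r gives u \<le> 24 r; \<open>fin\<close> is
    what permits the subtraction. An infinite right side needs no argument.\<close>
  show ?thesis
  proof (cases "L2sq (\<lambda>z. norm z *\<^sub>R grad w z)")
    case (real r)
    obtain u where u: "L2sq w = ennreal u" "0 \<le> u" using fin by (cases "L2sq w") auto
    have c: "ennreal b * (ennreal a * ennreal u) + ennreal 3 * (ennreal 2 * ennreal r)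
        = ennreal (b * (a * u) + 3 * (2 * r))" if "0 \<le> a" "0 \<le> b" for a b
      using that real u by (simp add: ennreal_mult[symmetric] ennreal_plus[symmetric] del: ennreal_plus ennreal_numeral)
    have "ennreal u \<le> ennreal ((3/2) * ((1/2) * u) + 3 * (2 * r))"
      using * unfolding real u by (subst c[symmetric]) auto
    then have "u \<le> 24 * r" using real u by (subst (asm) ennreal_le_iff) auto
    then show ?thesis unfolding real u using real
      by (simp add: ennreal_mult[symmetric] ennreal_numeral[symmetric] ennreal_leI del: ennreal_numeral)
  next
    case top
    then show ?thesis by (simp add: ennreal_mult_top)
  qed
qed

subsection \<open>Uniqueness for the parameter equations\<close>

text \<open>Gronwall's argument: exp(-2 L t) times the square of the norm is nonincreasing and exp(2
  L t) times it is nondecreasing, so a zero spreads in both time directions. Forward propagation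
  serves uniqueness; backward propagation serves the invertibility of \<open>B\<close>.\<close>

lemma linear_growth_ode_zero:
  fixes u :: "real \<Rightarrow> 'a::real_inner"
  assumes der: "\<And>t. t \<in> {0..T} \<Longrightarrow> (u has_vector_derivative u' t) (at t within {0..T})"
    and bound: "\<And>t. t \<in> {0..T} \<Longrightarrow> norm (u' t) \<le> L * norm (u t)"
    and t0: "t0 \<in> {0..T}" "u t0 = 0" and t: "t \<in> {0..T}"
  shows "u t = 0"
proof -
  have ip: "\<bar>u s \<bullet> u' s\<bar> \<le> L * (u s \<bullet> u s)" if "s \<in> {0..T}" for s
  proof -
    have "\<bar>u s \<bullet> u' s\<bar> \<le> norm (u s) * norm (u' s)" by (rule Cauchy_Schwarz_ineq2)
    also have "\<dots> \<le> norm (u s) * (L * norm (u s))" by (intro mult_left_mono bound that) simp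
    finally show ?thesis by (simp add: power2_norm_eq_inner[symmetric] power2_eq_square mult_ac)
  qed
  have hd: "((\<lambda>t. exp (r * t) * (u t \<bullet> u t)) has_derivative
      (\<lambda>h. h * (exp (r * s) * (r * (u s \<bullet> u s) + 2 * (u s \<bullet> u' s))))) (at s within {0..T})"
    if "s \<in> {0..T}" for r s
  proof -
    have [derivative_intros]: "(u has_derivative (\<lambda>h. h *\<^sub>R u' s)) (at s within {0..T})"
      using der[OF that] by (simp add: has_vector_derivative_def)
    show ?thesis
      by (rule derivative_eq_intros refl | simp)+ (auto simp: fun_eq_iff algebra_simps inner_commute)
  qed
  have "u t \<bullet> u t \<le> 0"
  proof (cases rule: linorder_cases[of t0 t])
    case less
    let ?h = "\<lambda>t. exp (- (2 * L) * t) * (u t \<bullet> u t)"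
    have sub: "{t0..t} \<subseteq> {0..T}" using t0 t by auto
    obtain s where s: "s \<in> {t0<..<t}" and eq: "?h t - ?h t0
        = (t - t0) * (exp (- (2 * L) * s) * (- (2 * L) * (u s \<bullet> u s) + 2 * (u s \<bullet> u' s)))"
    proof -
      have "\<exists>s\<in>{t0<..<t}. ?h t - ?h t0
          = (\<lambda>s h. h * (exp (- (2 * L) * s) * (- (2 * L) * (u s \<bullet> u s) + 2 * (u s \<bullet> u' s)))) s (t - t0)"
        using sub by (intro mvt_simple[OF less] has_derivative_subset[OF hd sub]) auto
      then show ?thesis using that by blast
    qed
    have "s \<in> {0..T}" using s sub by auto
    from ip[OF this] have "- (2 * L) * (u s \<bullet> u s) + 2 * (u s \<bullet> u' s) \<le> 0" by auto
    then have "?h t - ?h t0 \<le> 0" unfolding eq using less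
      by (intro mult_nonneg_nonpos) auto
    then show ?thesis using t0 by (simp add: mult_le_0_iff)
  next
    case equal then show ?thesis using t0 by simp
  next
    case greater
    let ?h = "\<lambda>t. exp ((2 * L) * t) * (u t \<bullet> u t)"
    have sub: "{t..t0} \<subseteq> {0..T}" using t0 t by auto
    obtain s where s: "s \<in> {t<..<t0}" and eq: "?h t0 - ?h t
        = (t0 - t) * (exp ((2 * L) * s) * ((2 * L) * (u s \<bullet> u s) + 2 * (u s \<bullet> u' s)))"
    proof -
      have "\<exists>s\<in>{t<..<t0}. ?h t0 - ?h t
          = (\<lambda>s h. h * (exp ((2 * L) * s) * ((2 * L) * (u s \<bullet> u s) + 2 * (u s \<bullet> u' s)))) s (t0 - t)"
        using sub by (intro mvt_simple[OF greater] has_derivative_subset[OF hd sub]) auto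
      then show ?thesis using that by blast
    qed
    have "s \<in> {0..T}" using s sub by auto
    from ip[OF this] have "(2 * L) * (u s \<bullet> u s) + 2 * (u s \<bullet> u' s) \<ge> 0" by auto
    then have "?h t0 - ?h t \<ge> 0" unfolding eq using greater by auto
    then show ?thesis using t0 by (simp add: mult_le_0_iff)
  qed
  then show ?thesis by (metis antisym inner_eq_zero_iff inner_ge_zero)
qed

section \<open>Matrix products, positive-definite square roots and local Lipschitz bounds\<close>

lemma norm_matrix_vector_mult_le: "norm (M *v x) \<le> norm M * norm x" for M :: "real^'n^'m"
proof -
  have "norm (M *v x) \<le> L2_set (\<lambda>i. norm (M $ i) * norm x) UNIV"
    unfolding norm_vec_def[of "M *v x"]
    by (intro L2_set_mono) (auto simp: matrix_vector_mul_component Cauchy_Schwarz_ineq2)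
  also have "\<dots> = norm M * norm x"
    by (simp add: norm_vec_def[of M] L2_set_left_distrib)
  finally show ?thesis .
qed

lemma bounded_bilinear_matrix_mult:
  "bounded_bilinear ((**) :: 'a::{euclidean_space,real_algebra_1}^'n^'m \<Rightarrow> 'a^'p^'n \<Rightarrow> 'a^'p^'m)"
  unfolding bilinear_conv_bounded_bilinear[symmetric] bilinear_def linear_iff
  by (simp add: vec_eq_iff matrix_matrix_mult_def sum.distrib scaleR_sum_right algebra_simps)

text \<open>For D = R - S the products satisfy R D + D S = 0. Multiplying by \<open>D\<close> and
  taking traces gives tr(D R D) + tr(D S D) = 0; as \<open>D\<close> is symmetric, both traces are
  sums of nonnegative quadratic forms in the columns of \<open>D\<close>, and definiteness of
  \<open>R\<close> makes every column zero. This is why \<open>\<alpha>0\<close> determines B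
  0.\<close>

lemma pos_def_sqrt_unique:
  assumes "is_pd_sqrt R A" "is_pd_sqrt S A"
  shows "R = S"
proof -
  have R: "transpose R = R" "\<And>x. x \<noteq> 0 \<Longrightarrow> x \<bullet> (R *v x) > 0" "R ** R = A"
   and S: "transpose S = S" "\<And>x. x \<noteq> 0 \<Longrightarrow> x \<bullet> (S *v x) > 0" "S ** S = A"
    using assms by (auto simp: is_pd_sqrt_def pos_def_def)
  define D where "D = R - S"
  have D: "transpose D = D"
    using R(1) S(1) by (simp add: D_def transpose_def vec_eq_iff)
  have "R ** D + D ** S = 0"
    using R(3) S(3) by (simp add: D_def bounded_bilinear.diff_left[OF bounded_bilinear_matrix_mult]
        bounded_bilinear.diff_right[OF bounded_bilinear_matrix_mult])
  then have "D ** (R ** D) + D ** (D ** S) = 0"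
    by (metis bounded_bilinear.zero_right[OF bounded_bilinear_matrix_mult] matrix_add_ldistrib)
  then have "trace (D ** (R ** D)) + trace (D ** (D ** S)) = 0"
    by (simp add: trace_add[symmetric]) (simp add: trace_def)
  then have tr: "trace (D ** (R ** D)) + trace (D ** (S ** D)) = 0"
    by (metis matrix_mul_assoc trace_mul_sym)
  have tre: "trace (D ** (X ** D)) = (\<Sum>i\<in>UNIV. (D *v axis i 1) \<bullet> (X *v (D *v axis i 1)))" for X
  proof -
    have "(D ** (X ** D)) $ i $ i = (D *v axis i 1) \<bullet> (X *v (D *v axis i 1))" for i
    proof -
      have "(D ** (X ** D)) $ i $ i = axis i 1 \<bullet> ((D ** (X ** D)) *v axis i 1)"
        by (simp add: inner_axis' matrix_vector_mult_basis column_def)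
      also have "\<dots> = axis i 1 \<bullet> (transpose D *v (X *v (D *v axis i 1)))"
        by (simp add: D matrix_vector_mul_assoc matrix_mul_assoc)
      also have "\<dots> = (D *v axis i 1) \<bullet> (X *v (D *v axis i 1))"
        by (metis dot_lmul_matrix inner_commute transpose_matrix_vector)
      finally show ?thesis .
    qed
    then show ?thesis by (simp add: trace_def)
  qed
  have nn: "0 \<le> y \<bullet> (R *v y)" "0 \<le> y \<bullet> (S *v y)" for y
    using R(2)[of y] S(2)[of y] by (cases "y = 0"; simp)+
  have "(\<Sum>i\<in>UNIV. (D *v axis i 1) \<bullet> (R *v (D *v axis i 1))) = 0"
    using tr unfolding tre by (meson add_nonneg_eq_0_iff nn sum_nonneg)
  then have "(D *v axis i 1) \<bullet> (R *v (D *v axis i 1)) = 0" for i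
    by (subst (asm) sum_nonneg_eq_0_iff) (auto simp: nn)
  then have "D *v axis i 1 = 0" for i
    using R(2) by (metis less_irrefl)
  then have "D $ j $ i = 0" for i j
    by (metis column_def matrix_vector_mult_basis vec_lambda_beta zero_index)
  then have "D = 0" by (simp add: vec_eq_iff)
  then show ?thesis by (simp add: D_def)
qed

lemma det_zero_kernel:
  fixes A :: "real^'n^'n"
  assumes "det A = 0"
  obtains x where "x \<noteq> 0" "A *v x = 0"
  using assms invertible_det_nz[of A] invertible_left_inverse[of A] matrix_left_invertible_ker[of A] by metis

lemma pos_def_det_nonzero: "pos_def R \<Longrightarrow> det R \<noteq> 0"
  unfolding pos_def_def
  by (metis det_zero_kernel inner_zero_right less_irrefl)

text \<open>A bound on one ball is enough: trajectories over a compact time interval are bounded,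
  and on the ball the Hessian is bounded by compactness.\<close>

lemma C2_grad_lipschitz:
  fixes V :: "real^'n \<Rightarrow> real"
  assumes "C2 V"
  obtains L where "0 \<le> L" "\<And>x y. norm x \<le> R \<Longrightarrow> norm y \<le> R \<Longrightarrow> norm (grad V x - grad V y) \<le> L * norm (x - y)"
proof -
  have d: "\<And>x. grad V differentiable (at x)" and c: "continuous_on UNIV (grad (grad V))"
    using assms by (auto simp: C2_def hess_def)
  have "compact (grad (grad V) ` cball 0 R)"
    by (intro compact_continuous_image continuous_on_subset[OF c]) auto
  then obtain L where L: "\<And>x. x \<in> cball 0 R \<Longrightarrow> norm (grad (grad V) x) \<le> L" and "L > 0"
    using bounded_pos[of "grad (grad V) ` cball 0 R"] compact_imp_bounded by (metis imageI)
  show ?thesis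
  proof
    show "0 \<le> L" using \<open>L > 0\<close> by simp
    fix x y :: "real^'n" assume "norm x \<le> R" "norm y \<le> R"
    then show "norm (grad V x - grad V y) \<le> L * norm (x - y)"
    proof (intro differentiable_bound[where S="cball 0 R" and f'="\<lambda>x. frechet_derivative (grad V) (at x)"])
      fix z :: "real^'n" assume z: "z \<in> cball 0 R"
      show "(grad V has_derivative frechet_derivative (grad V) (at z)) (at z within cball 0 R)"
        using d frechet_derivative_works has_derivative_at_withinI by blast
      show "onorm (frechet_derivative (grad V) (at z)) \<le> L"
      proof (rule onorm_le)
        fix v
        show "norm (frechet_derivative (grad V) (at z) v) \<le> L * norm v"
          using norm_frechet_derivative_le_grad[OF d, of z v] mult_left_mono[OF L[OF z], of "norm v"]
          by (simp add: mult.commute)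
      qed
    qed auto
  qed
qed

lemma continuous_on_bound_Icc:
  fixes f :: "real \<Rightarrow> 'a::real_normed_vector"
  assumes "continuous_on {0..T} f"
  obtains R where "0 < R" "\<And>t. t \<in> {0..T} \<Longrightarrow> norm (f t) \<le> R"
  using compact_imp_bounded[OF compact_continuous_image[OF assms compact_Icc]]
  unfolding bounded_pos by (metis imageI)

lemma has_vector_derivative_imp_continuous_on:
  assumes "\<And>t. t \<in> S \<Longrightarrow> (f has_vector_derivative f' t) (at t within S)"
  shows "continuous_on S f"
  using assms by (meson continuous_on_eq_continuous_within has_vector_derivative_continuous)

lemma bounded_linear_Re_mat: "bounded_linear (Re_mat :: complex^'n^'n \<Rightarrow> real^'n^'n)"
  unfolding linear_conv_bounded_linear[symmetric]
  by (rule linearI) (simp_all add: Re_mat_def vec_eq_iff)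

lemma
  assumes "gwpt_solution \<epsilon> V T q0 p0 \<gamma>0 \<alpha>0 q p \<gamma> \<alpha> B"
  shows gwpt_continuous: "continuous_on {0..T} q" "continuous_on {0..T} p"
      "continuous_on {0..T} \<alpha>" "continuous_on {0..T} B" "continuous_on {0..T} (\<lambda>t. Re_mat (\<alpha> t))"
proof -
  show "continuous_on {0..T} q" "continuous_on {0..T} p" "continuous_on {0..T} B" and a: "continuous_on {0..T} \<alpha>"
    using assms unfolding gwpt_solution_def
    by (auto intro!: has_vector_derivative_imp_continuous_on)
  show "continuous_on {0..T} (\<lambda>t. Re_mat (\<alpha> t))"
    using bounded_linear.continuous_on[OF bounded_linear_Re_mat a] .
qed

lemma gwpt_linear_zero:
  fixes A u :: "real \<Rightarrow> real^'n^'n"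
  assumes "continuous_on {0..T} A"
    and u: "\<And>t. t \<in> {0..T} \<Longrightarrow> (u has_vector_derivative - (2 *\<^sub>R (u t ** A t))) (at t within {0..T})"
    and t0: "t0 \<in> {0..T}" "u t0 = 0" and t: "t \<in> {0..T}"
  shows "u t = 0"
proof -
  obtain K where K: "0 < K" "\<And>(X :: real^'n^'n) (Y :: real^'n^'n). norm (X ** Y) \<le> norm X * norm Y * K"
    using bounded_bilinear.pos_bounded[OF bounded_bilinear_matrix_mult] by blast
  obtain R where R: "0 < R" "\<And>t. t \<in> {0..T} \<Longrightarrow> norm (A t) \<le> R"
    using continuous_on_bound_Icc[OF assms(1)] by blast
  show ?thesis
  proof (rule linear_growth_ode_zero[OF u _ t0 t, where L="2 * R * K"])
    fix s assume "s \<in> {0..T}"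
    have "norm (u s ** A s) \<le> norm (u s) * R * K"
      using K(1) R(2)[OF \<open>s \<in> _\<close>] order_trans[OF K(2)[of "u s" "A s"], of "norm (u s) * R * K"]
      by (simp add: mult_left_mono mult_right_mono)
    then show "norm (- (2 *\<^sub>R (u s ** A s))) \<le> 2 * R * K * norm (u s)" by (simp add: mult_ac)
  qed
qed

text \<open>The two solutions may belong to different \<open>\<epsilon>\<close> and
  \<open>\<gamma>0\<close>. The system is triangular: \<open>q\<close> and \<open>p\<close> form a
  closed system; once \<open>q\<close> agrees, the Hessian terms in the equations for
  \<open>\<alpha>\<close> cancel exactly; \<open>B\<close> then solves a linear equation with common
  coefficients.\<close>

lemma gwpt_unique:
  fixes V :: "real^'n \<Rightarrow> real"
  assumes V: "C2 V" and T: "T > 0"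
    and 1: "gwpt_solution \<epsilon>1 V T q0 p0 \<gamma>1 \<alpha>0 q1 p1 g1 \<alpha>1 B1"
    and 2: "gwpt_solution \<epsilon>2 V T q0 p0 \<gamma>2 \<alpha>0 q2 p2 g2 \<alpha>2 B2"
    and t: "t \<in> {0..T}"
  shows "q1 t = q2 t" "p1 t = p2 t" "\<alpha>1 t = \<alpha>2 t" "B1 t = B2 t"
proof -
  have z: "0 \<in> {0..T}" using T by simp
  obtain R1 where R1: "\<And>t. t \<in> {0..T} \<Longrightarrow> norm (q1 t) \<le> R1"
    using continuous_on_bound_Icc[OF gwpt_continuous(1)[OF 1]] by blast
  obtain R2 where R2: "\<And>t. t \<in> {0..T} \<Longrightarrow> norm (q2 t) \<le> R2"
    using continuous_on_bound_Icc[OF gwpt_continuous(1)[OF 2]] by blast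
  obtain L where L: "0 \<le> L" "\<And>x y. norm x \<le> max R1 R2 \<Longrightarrow> norm y \<le> max R1 R2 \<Longrightarrow>
      norm (grad V x - grad V y) \<le> L * norm (x - y)"
    using C2_grad_lipschitz[OF V] by blast
  have qp: "(q1 t - q2 t, p1 t - p2 t) = 0" if "t \<in> {0..T}" for t
  proof (rule linear_growth_ode_zero[OF _ _ z _ that, where L="1 + L"
        and u'="\<lambda>t. (p1 t - p2 t, - (grad V (q1 t) - grad V (q2 t)))"])
    fix s assume s: "s \<in> {0..T}"
    have d: "((\<lambda>t. q1 t - q2 t) has_vector_derivative p1 s - p2 s) (at s within {0..T})"
      "((\<lambda>t. p1 t - p2 t) has_vector_derivative - grad V (q1 s) - - grad V (q2 s)) (at s within {0..T})"
      using 1 2 s unfolding gwpt_solution_def by (blast intro!: has_vector_derivative_diff)+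
    show "((\<lambda>t. (q1 t - q2 t, p1 t - p2 t)) has_vector_derivative
        (p1 s - p2 s, - (grad V (q1 s) - grad V (q2 s)))) (at s within {0..T})"
      using has_derivative_Pair[OF d[unfolded has_vector_derivative_def]]
      by (simp add: has_vector_derivative_def)
    have "norm (p1 s - p2 s, - (grad V (q1 s) - grad V (q2 s)))
        \<le> norm (p1 s - p2 s) + norm (grad V (q1 s) - grad V (q2 s))"
      using norm_Pair_le[of "p1 s - p2 s" "- (grad V (q1 s) - grad V (q2 s))"]
      by (simp only: norm_minus_cancel)
    also have "\<dots> \<le> norm (p1 s - p2 s) + L * norm (q1 s - q2 s)"
      using L(2)[of "q1 s" "q2 s"] R1[OF s] R2[OF s] by simp
    also have "\<dots> \<le> norm (q1 s - q2 s, p1 s - p2 s) + L * norm (q1 s - q2 s, p1 s - p2 s)"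
      using L(1) norm_fst_le[of "q1 s - q2 s" "p1 s - p2 s"] norm_snd_le[of "p1 s - p2 s" "q1 s - q2 s"]
      by (intro add_mono mult_left_mono) auto
    finally show "norm (p1 s - p2 s, - (grad V (q1 s) - grad V (q2 s))) \<le> (1 + L) * norm (q1 s - q2 s, p1 s - p2 s)"
      by (simp add: algebra_simps)
  qed (use 1 2 in \<open>simp add: gwpt_solution_def zero_prod_def\<close>)
  then have q: "q1 t = q2 t" and p: "p1 t = p2 t" if "t \<in> {0..T}" for t
    using that by (auto simp: zero_prod_def)
  show "q1 t = q2 t" "p1 t = p2 t" using q p t by auto
  obtain K where K: "0 < K" "\<And>(X :: complex^'n^'n) (Y :: complex^'n^'n). norm (X ** Y) \<le> norm X * norm Y * K"
    using bounded_bilinear.pos_bounded[OF bounded_bilinear_matrix_mult] by blast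
  obtain S1 where S1: "\<And>t. t \<in> {0..T} \<Longrightarrow> norm (\<alpha>1 t) \<le> S1"
    using continuous_on_bound_Icc[OF gwpt_continuous(3)[OF 1]] by blast
  obtain S2 where S2: "\<And>t. t \<in> {0..T} \<Longrightarrow> norm (\<alpha>2 t) \<le> S2"
    using continuous_on_bound_Icc[OF gwpt_continuous(3)[OF 2]] by blast
  \<comment> \<open>The Riccati terms are split as X^2 - Y^2 = X (X - Y) + (X - Y) Y, in which order
    the factors need not commute; boundedness of both solutions then gives linear growth.\<close>
  have a: "\<alpha>1 t - \<alpha>2 t = 0" if "t \<in> {0..T}" for t
  proof (rule linear_growth_ode_zero[OF _ _ z _ that, where L="2 * (S1 + S2) * K"
        and u'="\<lambda>t. - (2 *\<^sub>R (\<alpha>1 t ** (\<alpha>1 t - \<alpha>2 t) + (\<alpha>1 t - \<alpha>2 t) ** \<alpha>2 t))"])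
    fix s assume s: "s \<in> {0..T}"
    have "((\<lambda>t. \<alpha>1 t - \<alpha>2 t) has_vector_derivative
        (- (2 *\<^sub>R (\<alpha>1 s ** \<alpha>1 s)) - (1/2) *\<^sub>R cplx_mat (hess V (q1 s)))
        - (- (2 *\<^sub>R (\<alpha>2 s ** \<alpha>2 s)) - (1/2) *\<^sub>R cplx_mat (hess V (q2 s)))) (at s within {0..T})"
      using 1 2 s unfolding gwpt_solution_def by (blast intro!: has_vector_derivative_diff)
    also have "(- (2 *\<^sub>R (\<alpha>1 s ** \<alpha>1 s)) - (1/2) *\<^sub>R cplx_mat (hess V (q1 s)))
        - (- (2 *\<^sub>R (\<alpha>2 s ** \<alpha>2 s)) - (1/2) *\<^sub>R cplx_mat (hess V (q2 s)))
        = - (2 *\<^sub>R (\<alpha>1 s ** (\<alpha>1 s - \<alpha>2 s) + (\<alpha>1 s - \<alpha>2 s) ** \<alpha>2 s))"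
      by (simp add: q[OF s] bounded_bilinear.diff_left[OF bounded_bilinear_matrix_mult]
          bounded_bilinear.diff_right[OF bounded_bilinear_matrix_mult] algebra_simps)
    finally show "((\<lambda>t. \<alpha>1 t - \<alpha>2 t) has_vector_derivative
        - (2 *\<^sub>R (\<alpha>1 s ** (\<alpha>1 s - \<alpha>2 s) + (\<alpha>1 s - \<alpha>2 s) ** \<alpha>2 s))) (at s within {0..T})" .
    let ?D = "\<alpha>1 s - \<alpha>2 s"
    have "norm (\<alpha>1 s ** ?D) \<le> S1 * norm ?D * K"
      using K(1) S1[OF s] by (intro order_trans[OF K(2)] mult_right_mono) auto
    moreover have "norm (?D ** \<alpha>2 s) \<le> norm ?D * S2 * K"
      using K(1) S2[OF s] by (intro order_trans[OF K(2)] mult_right_mono mult_left_mono) auto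
    ultimately have "norm (\<alpha>1 s ** ?D + ?D ** \<alpha>2 s) \<le> S1 * norm ?D * K + norm ?D * S2 * K"
      by (rule norm_triangle_mono)
    then show "norm (- (2 *\<^sub>R (\<alpha>1 s ** ?D + ?D ** \<alpha>2 s))) \<le> 2 * (S1 + S2) * K * norm ?D"
      by (simp only: norm_minus_cancel norm_scaleR abs_numeral) (simp add: algebra_simps)
  qed (use 1 2 in \<open>simp add: gwpt_solution_def\<close>)
  then show "\<alpha>1 t = \<alpha>2 t" using t by simp
  have "B1 0 = B2 0"
    using 1 2 pos_def_sqrt_unique unfolding gwpt_solution_def by metis
  have "B1 t - B2 t = 0"
  proof (rule gwpt_linear_zero[OF gwpt_continuous(5)[OF 1] _ z _ t])
    fix s assume s: "s \<in> {0..T}"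
    have "((\<lambda>t. B1 t - B2 t) has_vector_derivative
        - (2 *\<^sub>R (B1 s ** Re_mat (\<alpha>1 s))) - - (2 *\<^sub>R (B2 s ** Re_mat (\<alpha>2 s)))) (at s within {0..T})"
      using 1 2 s unfolding gwpt_solution_def by (blast intro!: has_vector_derivative_diff)
    then show "((\<lambda>t. B1 t - B2 t) has_vector_derivative
        - (2 *\<^sub>R ((B1 s - B2 s) ** Re_mat (\<alpha>1 s)))) (at s within {0..T})"
      using a[OF s] by (simp add: bounded_bilinear.diff_left[OF bounded_bilinear_matrix_mult] algebra_simps)
  qed (use \<open>B1 0 = B2 0\<close> in simp)
  then show "B1 t = B2 t" by simp
qed

text \<open>The equation for \<open>B\<close> multiplies by its coefficient from the right, so it is
  preserved by constant left factors. A left null vector of \<open>B\<close> at one time is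
  therefore one at time 0, where \<open>B\<close> is positive definite.\<close>

lemma gwpt_det_nonzero:
  fixes V :: "real^'n \<Rightarrow> real"
  assumes T: "T > 0" and g: "gwpt_solution \<epsilon> V T q0 p0 \<gamma>0 \<alpha>0 q p \<gamma> \<alpha> B" and t: "t \<in> {0..T}"
  shows "det (B t) \<noteq> 0"
proof
  assume "det (B t) = 0"
  then have "det (transpose (B t)) = 0" by simp
  then obtain x where x: "x \<noteq> 0" "transpose (B t) *v x = 0"
    using det_zero_kernel by blast
  \<comment> \<open>Every row of \<open>W\<close> is \<open>x\<close>: this makes the row vector
    obtained from \<open>x\<close> and \<open>B\<close> a square matrix, as
    \<open>gwpt_linear_zero\<close> expects.\<close>
  define W :: "real^'n^'n" where "W = (\<chi> i j. x $ j)"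
  have "(W ** B t) $ i $ k = (transpose (B t) *v x) $ k" for i k
    by (simp add: W_def matrix_matrix_mult_def matrix_vector_mult_def transpose_def mult.commute)
  then have Wt: "W ** B t = 0" using x(2) by (simp add: vec_eq_iff)
  have "W ** B 0 = 0"
  proof (rule gwpt_linear_zero[where u="\<lambda>t. W ** B t", OF gwpt_continuous(5)[OF g] _ t Wt])
    fix s assume "s \<in> {0..T}"
    then have "(B has_vector_derivative - (2 *\<^sub>R (B s ** Re_mat (\<alpha> s)))) (at s within {0..T})"
      using g by (simp add: gwpt_solution_def)
    from bounded_linear.has_vector_derivative[OF bounded_bilinear.bounded_linear_right[OF bounded_bilinear_matrix_mult] this, of W]
    show "((\<lambda>t. W ** B t) has_vector_derivative - (2 *\<^sub>R (W ** B s ** Re_mat (\<alpha> s)))) (at s within {0..T})"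
      by (simp add: bounded_bilinear.minus_right[OF bounded_bilinear_matrix_mult]
          bounded_bilinear.scaleR_right[OF bounded_bilinear_matrix_mult] matrix_mul_assoc)
  qed (use T in simp)
  moreover have "det (B 0) \<noteq> 0"
    using g pos_def_det_nonzero by (auto simp: gwpt_solution_def is_pd_sqrt_def)
  then obtain N where "B 0 ** N = mat 1"
    using invertible_det_nz[of "B 0"] by (auto simp: invertible_def)
  ultimately have "W = 0"
    by (metis bounded_bilinear.zero_left[OF bounded_bilinear_matrix_mult] matrix_mul_assoc matrix_mul_rid)
  then have "x = 0" by (simp add: W_def vec_eq_iff)
  with x show False by simp
qed

subsection \<open>Bounds uniform in the semi-classical parameter\<close>

lemma quad_form_scaleR: "quad_form A (r *\<^sub>R y) = of_real (r\<^sup>2) * quad_form A y"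
  by (simp add: quad_form_def sum_distrib_left power2_eq_square mult_ac)

lemma continuous_on_quad_form [continuous_intros]:
  "continuous_on S f \<Longrightarrow> continuous_on S (\<lambda>x. quad_form A (f x))"
  unfolding quad_form_def by (intro continuous_intros)

lemma cmod_exp_i_div:
  assumes "\<epsilon> > 0"
  shows "cmod (exp (\<i> / complex_of_real \<epsilon> * z)) = exp (- Im z / \<epsilon>)"
  by (simp add: Re_divide power2_eq_square)

lemma L2sq_cmult:
  fixes f :: "real^'n \<Rightarrow> 'a::real_normed_vector" and g :: "real^'n \<Rightarrow> 'b::real_normed_vector"
  assumes [measurable]: "f \<in> borel_measurable lebesgue" and "\<And>x. norm (g x) \<le> k * norm (f x)" "0 \<le> k"
  shows "L2sq g \<le> ennreal (k\<^sup>2) * L2sq f"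
proof -
  have "L2sq g \<le> (\<integral>\<^sup>+x. ennreal (k\<^sup>2) * ennreal ((norm (f x))\<^sup>2) \<partial>lebesgue)"
    unfolding L2sq_def using assms(2,3)
    by (intro nn_integral_mono)
       (simp add: ennreal_mult[symmetric] power_mult_distrib[symmetric] ennreal_leI power_mono)
  also have "\<dots> = ennreal (k\<^sup>2) * L2sq f"
    unfolding L2sq_def by (rule nn_integral_cmult) measurable
  finally show ?thesis .
qed

lemma L2sq_scaling:
  fixes f :: "real^'n \<Rightarrow> 'a::real_normed_vector" and B :: "real^'n^'n"
  assumes f: "f \<in> borel_measurable lebesgue" and B: "det B \<noteq> 0" and "\<epsilon> > 0"
  shows "(\<lambda>x. f (eta \<epsilon> B q x)) \<in> borel_measurable lebesgue"
    and "L2sq (\<lambda>x. f (eta \<epsilon> B q x)) = ennreal (\<epsilon> powr (real CARD('n) / 2) / \<bar>det B\<bar>) * L2sq f"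
proof -
  let ?r = "\<epsilon> powr (- 1 / 2)"
  let ?M = "matrix ((*\<^sub>R) ?r) ** B"
  have r: "?r ^ CARD('n) = \<epsilon> powr (- (real CARD('n) / 2))"
    using \<open>\<epsilon> > 0\<close> by (simp add: powr_realpow[symmetric] powr_powr)
  have dM: "det ?M = \<epsilon> powr (- (real CARD('n) / 2)) * det B"
    using r by (simp add: det_mul)
  have ab: "1 / \<bar>det ?M\<bar> = \<epsilon> powr (real CARD('n) / 2) / \<bar>det B\<bar>"
    unfolding dM by (simp add: abs_mult powr_minus divide_simps)
  have eta: "eta \<epsilon> B q = (\<lambda>x. ?M *v x + - (?M *v q))"
    by (simp add: fun_eq_iff eta_def matrix_vector_mul_assoc[symmetric] matrix_scaleR_self
        matrix_vector_mult_diff_distrib scaleR_diff_right)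
  have nz: "det ?M \<noteq> 0" unfolding dM using B \<open>\<epsilon> > 0\<close> by simp
  show "(\<lambda>x. f (eta \<epsilon> B q x)) \<in> borel_measurable lebesgue"
    unfolding eta using measurable_compose[OF measurable_matrix_affine[OF nz] f] .
  show "L2sq (\<lambda>x. f (eta \<epsilon> B q x)) = ennreal (\<epsilon> powr (real CARD('n) / 2) / \<bar>det B\<bar>) * L2sq f"
    unfolding eta ab[symmetric] by (rule L2sq_matrix_affine[OF f nz])
qed

text \<open>Passing from \<eta> to x multiplies the squared norm by \<epsilon>^(d/2) / |det B|. This
  cancels the square of \<epsilon>^(-d/4) and explains that power in the hypotheses on
  \<open>w\<close>.\<close>

lemma L2sq_scaling_le:
  fixes f :: "real^'n \<Rightarrow> 'a::real_normed_vector" and B :: "real^'n^'n"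
  assumes f: "f \<in> borel_measurable lebesgue" and B: "m \<le> \<bar>det B\<bar>" "0 < m" and "\<epsilon> > 0"
    and le: "L2sq f \<le> ennreal (b * (\<epsilon> powr (- real CARD('n) / 4))\<^sup>2)" and b: "0 \<le> b"
  shows "L2sq (\<lambda>x. f (eta \<epsilon> B q x)) \<le> ennreal (b / m)"
proof -
  have nz: "det B \<noteq> 0" using B by auto
  have p: "(\<epsilon> powr (- real CARD('n) / 4))\<^sup>2 = 1 / \<epsilon> powr (real CARD('n) / 2)"
    using \<open>\<epsilon> > 0\<close> by (simp add: power2_eq_square powr_add[symmetric] powr_minus_divide[symmetric])
  have "L2sq (\<lambda>x. f (eta \<epsilon> B q x)) \<le> ennreal (\<epsilon> powr (real CARD('n) / 2) / \<bar>det B\<bar>) * ennreal (b * (\<epsilon> powr (- real CARD('n) / 4))\<^sup>2)"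
    unfolding L2sq_scaling(2)[OF f nz \<open>\<epsilon> > 0\<close>] by (intro mult_left_mono le) simp
  also have "\<dots> = ennreal (b / \<bar>det B\<bar>)"
    unfolding p using b \<open>\<epsilon> > 0\<close> by (simp add: ennreal_mult[symmetric])
  also have "\<dots> \<le> ennreal (b / m)"
    using b B by (intro ennreal_leI divide_left_mono) auto
  finally show ?thesis .
qed

text \<open>The modulus of the initial datum is exp(-Im \<gamma>0 / \<epsilon>) times
  \<epsilon>^(-d/4) times a fixed profile \<open>f\<close> at the rescaled point. Rescaling removes
  the power of \<open>\<epsilon>\<close>, so normalisation reads exp(-Im \<gamma>0 / \<epsilon>)^2
  L2sq f = 1, and the Gaussian integral never has to be evaluated.\<close>

lemma psi_init_phase_bound:
  fixes q0 p0 :: "real^'n"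
  obtains g where "0 < g" "\<And>\<epsilon> \<gamma>0. \<epsilon> > 0 \<Longrightarrow> L2norm (psi_init \<epsilon> q0 p0 \<gamma>0 \<alpha>0) = 1 \<Longrightarrow> exp (- Im \<gamma>0 / \<epsilon>) \<le> g"
proof -
  let ?n = "real CARD('n)"
  define f :: "real^'n \<Rightarrow> real" where "f z = 2 powr (?n / 4) * pi powr (- ?n / 4) * exp (- Im (quad_form \<alpha>0 z))" for z
  have [measurable]: "f \<in> borel_measurable borel"
    unfolding f_def by (intro borel_measurable_continuous_onI continuous_intros)
  \<comment> \<open>The summand 1 keeps \<open>g\<close> positive also when \<open>L2sq f\<close> is
    zero or infinite, where the quotient takes the default value 0.\<close>
  define g where "g = 1 / sqrt (enn2real (L2sq f)) + 1"
  show ?thesis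
  proof
    show "0 < g" by (simp add: g_def add_nonneg_pos)
    fix \<epsilon> :: real and \<gamma>0 :: complex
    assume e: "\<epsilon> > 0" and n1: "L2norm (psi_init \<epsilon> q0 p0 \<gamma>0 \<alpha>0) = 1"
    let ?E = "exp (- Im \<gamma>0 / \<epsilon>)"
    have i1: "(LINT x|lebesgue. (cmod (psi_init \<epsilon> q0 p0 \<gamma>0 \<alpha>0 x))\<^sup>2) = 1"
      using n1 by (simp add: L2norm_def)
    \<comment> \<open>A non-integrable function would have Bochner integral 0, so the value 1 forces
      integrability.\<close>
    then have "integrable lebesgue (\<lambda>x. (cmod (psi_init \<epsilon> q0 p0 \<gamma>0 \<alpha>0 x))\<^sup>2)"
      using not_integrable_integral_eq by fastforce
    then have one: "L2sq (psi_init \<epsilon> q0 p0 \<gamma>0 \<alpha>0) = 1"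
      unfolding L2sq_def using i1 by (subst nn_integral_eq_integral) auto
    have pe: "cmod (psi_init \<epsilon> q0 p0 \<gamma>0 \<alpha>0 x)
        = ?E * \<epsilon> powr (- ?n / 4) * f (eta \<epsilon> (mat 1) q0 x)" for x
    proof -
      have "(\<epsilon> powr (- 1 / 2))\<^sup>2 = 1 / \<epsilon>"
        using e by (simp add: power2_eq_square powr_add[symmetric] powr_minus_divide)
      then have q: "Im (quad_form \<alpha>0 (\<epsilon> powr (- 1 / 2) *\<^sub>R (x - q0))) = Im (quad_form \<alpha>0 (x - q0)) / \<epsilon>"
        by (simp add: quad_form_scaleR del: of_real_power)
      have "cmod (psi_init \<epsilon> q0 p0 \<gamma>0 \<alpha>0 x) = 2 powr (?n / 4) * (pi * \<epsilon>) powr (- ?n / 4)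
          * exp (- Im (quad_form \<alpha>0 (x - q0) + complex_of_real (p0 \<bullet> (x - q0)) + \<gamma>0) / \<epsilon>)"
        unfolding psi_init_def norm_mult cmod_exp_i_div[OF e] norm_of_real by simp
      also have "- Im (quad_form \<alpha>0 (x - q0) + complex_of_real (p0 \<bullet> (x - q0)) + \<gamma>0) / \<epsilon>
          = - Im \<gamma>0 / \<epsilon> + - (Im (quad_form \<alpha>0 (x - q0)) / \<epsilon>)"
        by (simp add: add_divide_distrib diff_divide_distrib)
      finally show ?thesis
        using e q unfolding f_def eta_def by (simp add: powr_mult exp_add[symmetric] mult_ac)
    qed
    let ?k = "?E * \<epsilon> powr (- ?n / 4)"
    have "L2sq (psi_init \<epsilon> q0 p0 \<gamma>0 \<alpha>0) = (\<integral>\<^sup>+x. ennreal (?k\<^sup>2) * ennreal ((norm (f (eta \<epsilon> (mat 1) q0 x)))\<^sup>2) \<partial>lebesgue)"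
      unfolding L2sq_def pe by (simp add: power_mult_distrib ennreal_mult[symmetric])
    also have "\<dots> = ennreal (?k\<^sup>2) * L2sq (\<lambda>x. f (eta \<epsilon> (mat 1) q0 x))"
      unfolding L2sq_def using L2sq_scaling(1)[of f "mat 1" \<epsilon> q0] e
      by (intro nn_integral_cmult) (simp add: measurable_completion)
    also have "\<dots> = ennreal (?k\<^sup>2) * (ennreal (\<epsilon> powr (?n / 2)) * L2sq f)"
      using e by (subst L2sq_scaling(2)) (auto simp: measurable_completion)
    also have "\<dots> = ennreal (?k\<^sup>2 * \<epsilon> powr (?n / 2)) * L2sq f"
      by (simp add: ennreal_mult mult.assoc)
    also have "?k\<^sup>2 * \<epsilon> powr (?n / 2) = ?E\<^sup>2"
      using e by (simp add: power_mult_distrib power2_eq_square[of "\<epsilon> powr _"] powr_add[symmetric])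
    finally have *: "ennreal (?E\<^sup>2) * L2sq f = 1" using one by simp
    then obtain F where F: "L2sq f = ennreal F" "0 \<le> F"
      by (cases "L2sq f") (auto simp: ennreal_mult_top)
    then have "?E\<^sup>2 * F = 1" using * by (simp add: ennreal_mult[symmetric])
    then have "(?E * sqrt F)\<^sup>2 = 1" using F by (simp add: power_mult_distrib)
    then have "?E * sqrt F = 1" using F
      by (metis exp_ge_zero mult_nonneg_nonneg power2_eq_1_iff real_sqrt_ge_zero zero_le_one neg_0_le_iff_le not_one_le_zero)
    moreover from this have "sqrt F \<noteq> 0" by (metis mult_zero_right zero_neq_one)
    ultimately have "?E = 1 / sqrt F" by (metis nonzero_eq_divide_eq)
    then show "?E \<le> g" using F by (simp add: g_def)
  qed
qed

lemma continuous_on_det: "continuous_on UNIV (det :: real^'n^'n \<Rightarrow> real)"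
  unfolding det_def[abs_def] by (intro continuous_intros)

text \<open>Invertible matrices form an open set, so the compact \<open>S\<close> has a closed
  \<rho>-neighbourhood \<open>N\<close> inside it, which is again compact. The constants are the
  minima of |det M| over \<open>N\<close> and of the norm of M v over \<open>N\<close> and the unit
  sphere; homogeneity extends the latter to all \<open>v\<close>.\<close>

lemma uniform_invertibility:
  fixes S :: "(real^'n^'n) set"
  assumes "compact S" and nz: "\<And>M. M \<in> S \<Longrightarrow> det M \<noteq> 0"
  obtains \<rho> m c where "0 < \<rho>" "0 < m" "0 < c"
    "\<And>M B. B \<in> S \<Longrightarrow> norm (M - B) \<le> \<rho> \<Longrightarrow> m \<le> \<bar>det M\<bar>"
    "\<And>M B v. B \<in> S \<Longrightarrow> norm (M - B) \<le> \<rho> \<Longrightarrow> c * norm v \<le> norm (M *v v)"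
proof (cases "S = {}")
  case True
  then show ?thesis using that[of 1 1 1] by auto
next
  case False
  let ?U = "{M :: real^'n^'n. det M \<noteq> 0}"
  have "open ?U"
    using open_vimage[OF open_Compl[OF closed_singleton[of 0]] continuous_on_det] by (simp add: vimage_def)
  moreover have "S \<subseteq> ?U" using nz by blast
  ultimately obtain \<rho> where \<rho>: "\<rho> > 0" "(\<Union>x\<in>S. cball x \<rho>) \<subseteq> ?U"
    using compact_subset_open_imp_cball_epsilon_subset[OF \<open>compact S\<close>] by blast
  define N where "N = {x + y | x y. x \<in> S \<and> y \<in> cball (0::real^'n^'n) \<rho>}"
  have cN: "compact N" unfolding N_def by (rule compact_sums[OF \<open>compact S\<close> compact_cball])
  have inN: "M \<in> N" if "B \<in> S" "norm (M - B) \<le> \<rho>" for M B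
  proof -
    have "B + (M - B) \<in> N" unfolding N_def
      using that by (intro CollectI exI[of _ B] exI[of _ "M - B"] conjI refl) simp_all
    then show ?thesis by simp
  qed
  have Nnz: "det M \<noteq> 0" if M: "M \<in> N" for M
  proof -
    obtain x y where "M = x + y" "x \<in> S" "y \<in> cball 0 \<rho>" using M unfolding N_def by blast
    then have "M \<in> cball x \<rho>" by (simp add: dist_norm)
    then show ?thesis using \<rho>(2) \<open>x \<in> S\<close> by blast
  qed
  have "N \<noteq> {}" using False inN \<rho>(1) by (metis diff_self equals0D ex_in_conv less_imp_le norm_zero)
  have "continuous_on N (\<lambda>M. \<bar>det M\<bar>)"
    by (intro continuous_intros continuous_on_subset[OF continuous_on_det]) simp
  then obtain M0 where M0: "M0 \<in> N" "\<And>M. M \<in> N \<Longrightarrow> \<bar>det M0\<bar> \<le> \<bar>det M\<bar>"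
    using continuous_attains_inf[OF cN \<open>N \<noteq> {}\<close>] by blast
  have cv: "continuous_on (N \<times> sphere (0::real^'n) 1) (\<lambda>(M, v). norm (M *v v))"
    unfolding matrix_vector_mult_def split_beta by (intro continuous_intros)
  have ne: "N \<times> sphere (0::real^'n) 1 \<noteq> {}" using \<open>N \<noteq> {}\<close> by simp
  obtain z where z: "z \<in> N \<times> sphere (0::real^'n) 1"
    and zm: "\<And>y. y \<in> N \<times> sphere (0::real^'n) 1 \<Longrightarrow> (\<lambda>(M, v). norm (M *v v)) z \<le> (\<lambda>(M, v). norm (M *v v)) y"
    using continuous_attains_inf[OF compact_Times[OF cN compact_sphere] ne cv] by blast
  obtain M1 v1 where zz: "z = (M1, v1)" by fastforce
  have inj0: "M *v v \<noteq> 0" if "M \<in> N" "v \<noteq> 0" for M v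
  proof -
    have "\<exists>C. C ** M = mat 1"
      using Nnz[OF that(1)] invertible_det_nz[of M] by (auto simp: invertible_def)
    then show ?thesis using that(2) matrix_left_invertible_ker[of M] by blast
  qed
  show ?thesis
  proof (rule that[of \<rho> "\<bar>det M0\<bar>" "norm (M1 *v v1)"])
    show "0 < \<bar>det M0\<bar>" using Nnz[OF M0(1)] by simp
    have "v1 \<noteq> 0" using z zz by auto
    then show c: "0 < norm (M1 *v v1)" using inj0 z zz by simp
    fix M B :: "real^'n^'n" and v :: "real^'n" assume "B \<in> S" "norm (M - B) \<le> \<rho>"
    then have "M \<in> N" by (rule inN)
    then show "\<bar>det M0\<bar> \<le> \<bar>det M\<bar>" by (rule M0(2))
    show "norm (M1 *v v1) * norm v \<le> norm (M *v v)"
    proof (cases "v = 0")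
      case False
      have "(M, (1 / norm v) *\<^sub>R v) \<in> N \<times> sphere 0 1" using \<open>M \<in> N\<close> False by simp
      from zm[OF this] have "norm (M1 *v v1) \<le> norm (M *v v) / norm v"
        by (simp add: zz matrix_vector_mult_scaleR)
      then show ?thesis using False by (simp add: field_simps)
    qed simp
  qed (rule \<rho>(1))
qed

lemma abs_trace_le: "\<bar>trace A\<bar> \<le> real CARD('n) * norm A" for A :: "real^'n^'n"
proof -
  have "\<bar>trace A\<bar> \<le> (\<Sum>i::'n\<in>UNIV. norm A)"
    unfolding trace_def
    by (intro order_trans[OF sum_abs] sum_mono)
       (metis Finite_Cartesian_Product.norm_nth_le order_trans real_norm_def)
  then show ?thesis by simp
qed

text \<open>The imaginary part of \<open>\<gamma>\<close> has derivative \<epsilon> tr(\<alpha>_R),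
  so after division by \<open>\<epsilon>\<close> its growth over [0, T] no longer depends on
  \<open>\<epsilon>\<close>.\<close>

lemma gwpt_phase_bound:
  assumes g: "gwpt_solution \<epsilon> V T q0 p0 \<gamma>0 \<alpha>0 q p \<gamma> \<alpha> B" and e: "\<epsilon> > 0"
    and R: "\<And>t. t \<in> {0..T} \<Longrightarrow> \<bar>trace (Re_mat (\<alpha> t))\<bar> \<le> R" and t: "t \<in> {0..T}"
  shows "exp (- Im (\<gamma> t) / \<epsilon>) \<le> exp (- Im \<gamma>0 / \<epsilon>) * exp (R * T)"
proof -
  have d: "((\<lambda>t. Im (\<gamma> t)) has_derivative (\<lambda>h. h *\<^sub>R (\<epsilon> * trace (Re_mat (\<alpha> s))))) (at s within {0..T})"
    if "s \<in> {0..T}" for s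
  proof -
    have "(\<gamma> has_vector_derivative
           (complex_of_real ((1/2) * (p s \<bullet> p s) - V (q s))
            + \<i> * complex_of_real (\<epsilon> * trace (Re_mat (\<alpha> s))))) (at s within {0..T})"
      using g that by (simp add: gwpt_solution_def)
    from bounded_linear.has_vector_derivative[OF bounded_linear_Im this]
    show ?thesis by (simp add: has_vector_derivative_def)
  qed
  have "norm (Im (\<gamma> t) - Im (\<gamma> 0)) \<le> (\<epsilon> * R) * norm (t - 0)"
  proof (rule differentiable_bound[OF _ d])
    fix s assume s: "s \<in> {0..T}"
    show "onorm (\<lambda>h. h *\<^sub>R (\<epsilon> * trace (Re_mat (\<alpha> s)))) \<le> \<epsilon> * R"
    proof (rule onorm_le)
      fix h :: real
      have "norm (h *\<^sub>R (\<epsilon> * trace (Re_mat (\<alpha> s)))) = \<epsilon> * \<bar>trace (Re_mat (\<alpha> s))\<bar> * norm h"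
        using e by (simp add: abs_mult)
      also have "\<dots> \<le> \<epsilon> * R * norm h"
        using R[OF s] e by (intro mult_right_mono mult_left_mono) auto
      finally show "norm (h *\<^sub>R (\<epsilon> * trace (Re_mat (\<alpha> s)))) \<le> \<epsilon> * R * norm h" .
    qed
  qed (use t in auto)
  moreover have "0 \<le> R" using R[OF t] by simp
  then have "(\<epsilon> * R) * norm (t - 0) \<le> (\<epsilon> * R) * T"
    using t e by (intro mult_left_mono) auto
  ultimately have "- Im (\<gamma> t) \<le> - Im (\<gamma> 0) + \<epsilon> * R * T" by (simp add: abs_le_iff)
  then have "- Im (\<gamma> t) / \<epsilon> \<le> (- Im (\<gamma> 0) + \<epsilon> * R * T) / \<epsilon>"
    using e by (intro divide_right_mono) auto
  also have "\<dots> = - Im \<gamma>0 / \<epsilon> + R * T"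
    using e g by (simp add: gwpt_solution_def field_simps)
  finally show ?thesis by (simp add: exp_add[symmetric])
qed

text \<open>The equations for \<open>q, p, \<alpha>, B\<close> do not involve \<open>\<epsilon>\<close> or \<open>\<gamma>0\<close>, so by uniqueness all solutions share
  one trajectory and compactness of \<open>{0..T}\<close> yields the constants.\<close>

lemma gwpt_uniform_bounds:
  fixes V :: "real^'n \<Rightarrow> real"
  assumes V: "C2 V" and T: "T > 0"
  obtains R \<rho> m c where "0 < R" "0 < \<rho>" "0 < m" "0 < c"
    "\<And>\<epsilon> \<gamma>0 q p \<gamma> \<alpha> B t. \<epsilon> > 0 \<Longrightarrow> L2norm (psi_init \<epsilon> q0 p0 \<gamma>0 \<alpha>0) = 1 \<Longrightarrow>
       gwpt_solution \<epsilon> V T q0 p0 \<gamma>0 \<alpha>0 q p \<gamma> \<alpha> B \<Longrightarrow> t \<in> {0..T} \<Longrightarrow>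
       norm (p t) \<le> R \<and> norm (Re_mat (\<alpha> t)) \<le> R \<and> norm (B t) \<le> R \<and> exp (- Im (\<gamma> t) / \<epsilon>) \<le> R \<and>
       (\<forall>M. norm (M - B t) \<le> \<rho> \<longrightarrow> m \<le> \<bar>det M\<bar> \<and> (\<forall>v. c * norm v \<le> norm (M *v v)))"
proof (cases "\<exists>\<epsilon> \<gamma>0 q p \<gamma> \<alpha> B. gwpt_solution \<epsilon> V T q0 p0 \<gamma>0 \<alpha>0 q p \<gamma> \<alpha> B")
  \<comment> \<open>Without any solution the claim is vacuous; otherwise one solution, for whatever
    \<open>\<epsilon>\<close>, serves as reference for all.\<close>
  case False
  then show ?thesis using that[of 1 1 1 1] by simp
next
  case True
  then obtain \<epsilon>1 \<gamma>1 q1 p1 g1 \<alpha>1 B1 where s1: "gwpt_solution \<epsilon>1 V T q0 p0 \<gamma>1 \<alpha>0 q1 p1 g1 \<alpha>1 B1" by blast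
  note cont = gwpt_continuous[OF s1]
  obtain Rp where Rp: "0 < Rp" "\<And>t. t \<in> {0..T} \<Longrightarrow> norm (p1 t) \<le> Rp"
    using continuous_on_bound_Icc[OF cont(2)] by blast
  obtain RB where RB: "0 < RB" "\<And>t. t \<in> {0..T} \<Longrightarrow> norm (B1 t) \<le> RB"
    using continuous_on_bound_Icc[OF cont(4)] by blast
  obtain Ra where Ra: "0 < Ra" "\<And>t. t \<in> {0..T} \<Longrightarrow> norm (Re_mat (\<alpha>1 t)) \<le> Ra"
    using continuous_on_bound_Icc[OF cont(5)] by blast
  obtain g where g: "0 < g" "\<And>\<epsilon> \<gamma>0. \<epsilon> > 0 \<Longrightarrow> L2norm (psi_init \<epsilon> q0 p0 \<gamma>0 \<alpha>0) = 1 \<Longrightarrow> exp (- Im \<gamma>0 / \<epsilon>) \<le> g"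
    using psi_init_phase_bound[of q0 p0 \<alpha>0] by metis
  \<comment> \<open>\<open>g\<close> comes from the normalised initial datum and the exponential
    from the growth of Im \<gamma>, with the trace bounded by CARD('n) times
    \<open>Ra\<close>.\<close>
  let ?G = "g * exp (real CARD('n) * Ra * T)"
  define R where "R = max (max Rp RB) (max Ra ?G)"
  have "compact (B1 ` {0..T})" by (rule compact_continuous_image[OF cont(4) compact_Icc])
  moreover have "\<And>M. M \<in> B1 ` {0..T} \<Longrightarrow> det M \<noteq> 0" using gwpt_det_nonzero[OF T s1] by blast
  ultimately obtain \<rho> m c where u: "0 < \<rho>" "0 < m" "0 < c"
    "\<And>M B. B \<in> B1 ` {0..T} \<Longrightarrow> norm (M - B) \<le> \<rho> \<Longrightarrow> m \<le> \<bar>det M\<bar>"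
    "\<And>M B v. B \<in> B1 ` {0..T} \<Longrightarrow> norm (M - B) \<le> \<rho> \<Longrightarrow> c * norm v \<le> norm (M *v v)"
    using uniform_invertibility[of "B1 ` {0..T}"] by blast
  show ?thesis
  proof (rule that[of R \<rho> m c])
    show "0 < R" using Rp by (simp add: R_def)
    fix \<epsilon> \<gamma>0 q p \<gamma> \<alpha> B t
    assume e: "\<epsilon> > 0" and n1: "L2norm (psi_init \<epsilon> q0 p0 \<gamma>0 \<alpha>0) = 1"
      and s: "gwpt_solution \<epsilon> V T q0 p0 \<gamma>0 \<alpha>0 q p \<gamma> \<alpha> B" and t: "t \<in> {0..T}"
    note uq = gwpt_unique[OF V T s s1]
    have tr: "\<bar>trace (Re_mat (\<alpha> r))\<bar> \<le> real CARD('n) * Ra" if "r \<in> {0..T}" for r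
      using abs_trace_le[of "Re_mat (\<alpha> r)"] Ra(2)[OF that] uq(3)[OF that]
      by (metis mult_left_mono of_nat_0_le_iff order_trans)
    have "exp (- Im (\<gamma> t) / \<epsilon>) \<le> exp (- Im \<gamma>0 / \<epsilon>) * exp (real CARD('n) * Ra * T)"
      by (rule gwpt_phase_bound[OF s e tr t])
    also have "\<dots> \<le> ?G" by (intro mult_right_mono g e n1) simp
    finally have "exp (- Im (\<gamma> t) / \<epsilon>) \<le> R" by (simp add: R_def)
    moreover have "norm (p t) \<le> R" "norm (B t) \<le> R" "norm (Re_mat (\<alpha> t)) \<le> R"
      using Rp(2)[OF t] RB(2)[OF t] Ra(2)[OF t] uq[OF t] by (auto simp: R_def)
    moreover have "B t \<in> B1 ` {0..T}" using uq(4)[OF t] t by simp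
    ultimately show "norm (p t) \<le> R \<and> norm (Re_mat (\<alpha> t)) \<le> R \<and> norm (B t) \<le> R \<and> exp (- Im (\<gamma> t) / \<epsilon>) \<le> R \<and>
       (\<forall>M. norm (M - B t) \<le> \<rho> \<longrightarrow> m \<le> \<bar>det M\<bar> \<and> (\<forall>v. c * norm v \<le> norm (M *v v)))"
      using u(4,5) by blast
  qed (use u in auto)
qed

subsection \<open>Wave packets\<close>

text \<open>\<open>reconstruct\<close> at a frozen time, with the profile as an argument in which it
  is linear.\<close>

definition packet ::
  "real \<Rightarrow> real^'n \<Rightarrow> real^'n \<Rightarrow> complex \<Rightarrow> complex^'n^'n \<Rightarrow> real^'n^'n \<Rightarrow> (real^'n \<Rightarrow> complex) \<Rightarrow> real^'n \<Rightarrow> complex"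
where
  "packet \<epsilon> q p \<gamma> \<alpha> B w x = w (eta \<epsilon> B q x) * exp (\<i> / complex_of_real \<epsilon> * theta q p \<gamma> \<alpha> x)"

lemma reconstruct_eq_packet:
  "reconstruct \<epsilon> q p \<gamma> \<alpha> B w x t = packet \<epsilon> (q t) (p t) (\<gamma> t) (\<alpha> t) (B t) (\<lambda>\<eta>. w \<eta> t) x"
  by (simp add: reconstruct_def packet_def)

lemma packet_diff:
  "packet \<epsilon> q p \<gamma> \<alpha> B (\<lambda>\<eta>. w \<eta> - w' \<eta>) x = packet \<epsilon> q p \<gamma> \<alpha> B w x - packet \<epsilon> q p \<gamma> \<alpha> B w' x"
  by (simp add: packet_def algebra_simps)

lemma cmod_packet:
  assumes "\<epsilon> > 0"
  shows "cmod (packet \<epsilon> q p \<gamma> \<alpha> B w x) = exp (- Im \<gamma> / \<epsilon>) * cmod (w (eta \<epsilon> B q x))"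
  unfolding packet_def norm_mult cmod_exp_i_div[OF assms] by (simp add: theta_def)

lemma continuous_on_eta: "continuous_on S (eta \<epsilon> B q)"
  unfolding eta_def[abs_def]
  by (intro continuous_intros linear_continuous_on_compose[OF _ matrix_vector_mul_linear])

lemma continuous_on_packet_phase:
  "continuous_on S (\<lambda>x. exp (\<i> / complex_of_real \<epsilon> * theta q p \<gamma> \<alpha> x))"
  unfolding theta_def
  by (intro continuous_intros linear_continuous_on_compose[OF _ matrix_vector_mul_linear])

lemma borel_measurable_packet:
  assumes "w \<in> borel_measurable lebesgue" "det B \<noteq> 0" "\<epsilon> > 0"
  shows "packet \<epsilon> q p \<gamma> \<alpha> B w \<in> borel_measurable lebesgue"
proof -
  note [measurable] = L2sq_scaling(1)[OF assms]
  have "(\<lambda>x. exp (\<i> / complex_of_real \<epsilon> * theta q p \<gamma> \<alpha> x)) \<in> borel_measurable borel"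
    by (intro borel_measurable_continuous_onI continuous_on_packet_phase)
  then have [measurable]: "(\<lambda>x. exp (\<i> / complex_of_real \<epsilon> * theta q p \<gamma> \<alpha> x)) \<in> borel_measurable lebesgue"
    by (simp add: measurable_completion)
  show ?thesis unfolding packet_def[abs_def] by measurable
qed

lemma continuous_on_packet:
  assumes "continuous_on UNIV w"
  shows "continuous_on S (packet \<epsilon> q p \<gamma> \<alpha> B w)"
  unfolding packet_def[abs_def]
  by (intro continuous_intros continuous_on_packet_phase continuous_on_compose2[OF assms continuous_on_eta]) auto

lemma L2sq_packet_le:
  fixes w :: "real^'n \<Rightarrow> complex"
  assumes w: "w \<in> borel_measurable lebesgue" and m: "m \<le> \<bar>det B\<bar>" "0 < m" and e: "\<epsilon> > 0"
    and G: "exp (- Im \<gamma> / \<epsilon>) \<le> G"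
    and le: "L2sq w \<le> ennreal (b * (\<epsilon> powr (- real CARD('n) / 4))\<^sup>2)" and b: "0 \<le> b"
  shows "L2sq (packet \<epsilon> q p \<gamma> \<alpha> B w) \<le> ennreal (G\<^sup>2 * (b / m))"
proof -
  have nz: "det B \<noteq> 0" using m by auto
  have G0: "0 \<le> G" using G exp_ge_zero order_trans by blast
  have "L2sq (packet \<epsilon> q p \<gamma> \<alpha> B w) \<le> ennreal (G\<^sup>2) * L2sq (\<lambda>x. w (eta \<epsilon> B q x))"
    by (rule L2sq_cmult[OF L2sq_scaling(1)[OF w nz e]])
       (auto simp only: cmod_packet[OF e] intro!: mult_right_mono G G0 norm_ge_zero)
  also have "\<dots> \<le> ennreal (G\<^sup>2) * ennreal (b / m)"
    by (intro mult_left_mono L2sq_scaling_le[OF w m e le b]) simp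
  finally show ?thesis using b m by (simp add: ennreal_mult[symmetric])
qed

text \<open>A triangle inequality at the level of squares, at the cost of a factor 2. It is the
  source of the factors 2 and 4 in the constants of the theorem.\<close>

lemma L2sq_add_sq_le:
  assumes "f \<in> borel_measurable lebesgue" "g \<in> borel_measurable lebesgue"
    and f: "L2sq f \<le> ennreal (a\<^sup>2)" and g: "L2sq g \<le> ennreal (b\<^sup>2)" and "0 \<le> a" "0 \<le> b"
  shows "L2sq (\<lambda>x. f x + g x) \<le> ennreal ((2 * (a + b))\<^sup>2)"
proof -
  have "L2sq (\<lambda>x. f x + g x) \<le> ennreal (1 + 1) * L2sq f + ennreal (1 + 1 / 1) * L2sq g"
    using assms by (intro L2sq_add_le) auto
  also have "\<dots> \<le> ennreal 2 * ennreal (a\<^sup>2) + ennreal 2 * ennreal (b\<^sup>2)"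
    using f g by (intro add_mono mult_mono) auto
  also have "\<dots> = ennreal (2 * a\<^sup>2 + 2 * b\<^sup>2)"
    by (simp add: ennreal_mult[symmetric] ennreal_plus[symmetric] del: ennreal_plus ennreal_numeral)
  also have "\<dots> \<le> ennreal ((2 * (a + b))\<^sup>2)"
    using \<open>0 \<le> a\<close> \<open>0 \<le> b\<close> by (intro ennreal_leI) (simp add: power2_eq_square algebra_simps)
  finally show ?thesis .
qed

text \<open>Away from the unit ball around \<open>q\<close> the weight is at least 1, and on the
  ball the packet is bounded by continuity. The conclusion is only qualitative, as the bound
  \<open>b\<close> is not uniform; it licenses the absorption in
  \<open>L2sq_le_radial_gradient\<close>, which supplies the uniform estimate.\<close>

lemma L2sq_finite_of_moment:
  fixes w :: "real^'n \<Rightarrow> complex"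
  assumes cw: "continuous_on UNIV w" and B: "det B \<noteq> 0" and e: "\<epsilon> > 0"
    and mom: "integrable lebesgue (\<lambda>x. norm (x - q) ^ 4 * (cmod (packet \<epsilon> q p \<gamma> \<alpha> B w x))\<^sup>2)"
  shows "L2sq w < \<infinity>"
proof -
  let ?\<psi> = "packet \<epsilon> q p \<gamma> \<alpha> B w"
  have c\<psi>: "continuous_on S ?\<psi>" for S using continuous_on_packet[OF cw] .
  have wm: "w \<in> borel_measurable lebesgue"
    using cw by (intro measurable_completion) (auto intro: borel_measurable_continuous_onI)
  have [measurable]: "?\<psi> \<in> borel_measurable lebesgue" by (rule borel_measurable_packet[OF wm B e])
  have [measurable]: "cball q 1 \<in> sets lebesgue" by simp
  have "bounded (?\<psi> ` cball q 1)"
    by (intro compact_imp_bounded compact_continuous_image c\<psi> compact_cball)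
  then obtain b where b: "0 < b" "\<And>x. x \<in> cball q 1 \<Longrightarrow> cmod (?\<psi> x) \<le> b"
    unfolding bounded_pos by (metis imageI)
  have "(cmod (?\<psi> x))\<^sup>2 \<le> norm (x - q) ^ 4 * (cmod (?\<psi> x))\<^sup>2 + b\<^sup>2 * indicator (cball q 1) x" for x
  proof (cases "x \<in> cball q 1")
    case True
    have "(cmod (?\<psi> x))\<^sup>2 \<le> b\<^sup>2" using b(2)[OF True] by (rule power_mono) simp
    then show ?thesis using True by (simp add: add_increasing)
  next
    case False
    then have "1 \<le> norm (x - q) ^ 4" by (simp add: dist_norm norm_minus_commute)
    then have "1 * (cmod (?\<psi> x))\<^sup>2 \<le> norm (x - q) ^ 4 * (cmod (?\<psi> x))\<^sup>2"
      by (rule mult_right_mono) simp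
    then show ?thesis using False by simp
  qed
  then have "L2sq ?\<psi> \<le> (\<integral>\<^sup>+x. ennreal (norm (x - q) ^ 4 * (cmod (?\<psi> x))\<^sup>2) + ennreal (b\<^sup>2) * indicator (cball q 1) x \<partial>lebesgue)"
    unfolding L2sq_def
    by (intro nn_integral_mono)
       (simp add: ennreal_indicator[symmetric] ennreal_mult[symmetric] ennreal_plus[symmetric] ennreal_leI
          del: ennreal_plus)
  also have "\<dots> = (\<integral>\<^sup>+x. ennreal (norm (x - q) ^ 4 * (cmod (?\<psi> x))\<^sup>2) \<partial>lebesgue) + ennreal (b\<^sup>2) * emeasure lebesgue (cball q 1)"
    using borel_measurable_integrable[OF mom] by (subst nn_integral_add) (auto simp: nn_integral_cmult_indicator)
  also have "\<dots> < \<infinity>"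
  proof -
    have "emeasure lebesgue (cball q 1) < \<infinity>"
      using lmeasurable_cball fmeasurableD2 by (metis infinity_ennreal_def top.not_eq_extremum)
    moreover have "(\<integral>\<^sup>+x. ennreal (norm (x - q) ^ 4 * (cmod (?\<psi> x))\<^sup>2) \<partial>lebesgue) < \<infinity>"
      using mom unfolding integrable_iff_bounded by simp
    ultimately show ?thesis by (simp add: ennreal_mult_less_top)
  qed
  finally have fin: "L2sq ?\<psi> < \<infinity>" .
  have "L2sq (\<lambda>x. w (eta \<epsilon> B q x)) \<le> ennreal ((exp (Im \<gamma> / \<epsilon>))\<^sup>2) * L2sq ?\<psi>"
    by (rule L2sq_cmult) (auto simp: cmod_packet[OF e] mult.assoc[symmetric] exp_add[symmetric])
  also have "\<dots> < \<infinity>" using fin by (simp add: ennreal_mult_less_top)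
  finally have "ennreal (\<epsilon> powr (real CARD('n) / 2) / \<bar>det B\<bar>) * L2sq w < \<infinity>"
    by (simp only: L2sq_scaling(2)[OF wm B e])
  moreover have "ennreal (\<epsilon> powr (real CARD('n) / 2) / \<bar>det B\<bar>) \<noteq> 0"
    using B e by (simp add: ennreal_eq_0_iff not_le)
  ultimately show ?thesis
    by (metis ennreal_mult_top infinity_ennreal_def less_irrefl mult.commute top.not_eq_extremum ennreal_mult_eq_top_iff)
qed

lemma cmod_exp_i_minus_1_le: "cmod (1 - exp (\<i> * complex_of_real x)) \<le> \<bar>x\<bar>"
proof -
  have "(cmod (1 - exp (\<i> * complex_of_real x)))\<^sup>2 = 4 * (sin (x / 2))\<^sup>2"
  proof -
    have "(cmod (1 - exp (\<i> * complex_of_real x)))\<^sup>2 = (1 - cos x)\<^sup>2 + (sin x)\<^sup>2"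
      by (simp add: cmod_power2 Re_exp Im_exp)
    also have "\<dots> = 2 - 2 * cos x"
      using sin_cos_squared_add[of x] by (simp add: power2_eq_square algebra_simps)
    also have "\<dots> = 4 * (sin (x / 2))\<^sup>2"
      using cos_double_sin[of "x / 2"] by simp
    finally show ?thesis .
  qed
  also have "\<dots> \<le> 4 * (x / 2)\<^sup>2"
    by (intro mult_left_mono abs_le_square_iff[THEN iffD1] abs_sin_x_le_abs_x) simp
  also have "\<dots> = \<bar>x\<bar>\<^sup>2" by (simp add: power2_eq_square)
  finally show ?thesis by (rule power2_le_imp_le) simp
qed

lemma abs_inner_matrix_le: "\<bar>x \<bullet> (A *v y)\<bar> \<le> norm A * norm x * norm y" for A :: "real^'n^'n"
proof -
  have "\<bar>x \<bullet> (A *v y)\<bar> \<le> norm x * norm (A *v y)" by (rule Cauchy_Schwarz_ineq2)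
  also have "\<dots> \<le> norm x * (norm A * norm y)" by (intro mult_left_mono norm_matrix_vector_mult_le) simp
  finally show ?thesis by (simp add: mult_ac)
qed

text \<open>In the variables y = x - q and u = q - q' each term of the difference contains at least
  one small factor, and what remains has degree at most two in y. The weight 1 + |y|^2 is the one
  whose square the fourth moment controls.\<close>

lemma theta_real_diff_bound:
  fixes q q' p p' x :: "real^'n"
  assumes \<delta>: "norm (q - q') \<le> \<delta>" "norm (p - p') \<le> \<delta>" "cmod (\<gamma> - \<gamma>') \<le> \<delta>"
      "norm (Re_mat \<alpha> - Re_mat \<alpha>') \<le> \<delta>"
    and R: "norm p \<le> R" "norm (Re_mat \<alpha>) \<le> R" and r: "\<delta> \<le> r"
  shows "\<bar>Re (theta q' p' \<gamma>' \<alpha>' x) - Re (theta q p \<gamma> \<alpha> x)\<bar>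
    \<le> \<delta> * ((4 + 2 * r\<^sup>2 + r + 3 * R + R * r) * (1 + (norm (x - q))\<^sup>2))"
proof -
  let ?A = "Re_mat \<alpha>" and ?A' = "Re_mat \<alpha>'"
  define y where "y = x - q"
  define u where "u = q - q'"
  let ?n = "norm y"
  have d0: "0 \<le> \<delta>" using \<delta>(1) norm_ge_zero order_trans by blast
  have R0: "0 \<le> R" using R(1) norm_ge_zero order_trans by blast
  have r0: "0 \<le> r" using d0 r by simp
  have xq: "x - q' = y + u" "x - q = y" by (simp_all add: y_def u_def)
  have u: "norm u \<le> \<delta>" using \<delta>(1) by (simp add: u_def)
  have nyu: "norm (y + u) \<le> ?n + r" using norm_triangle_ineq[of y u] u r by simp
  have "Re (theta q' p' \<gamma>' \<alpha>' x) - Re (theta q p \<gamma> \<alpha> x)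
      = (y + u) \<bullet> ((?A' - ?A) *v (y + u)) + u \<bullet> (?A *v (y + u)) + y \<bullet> (?A *v u)
        + (p' - p) \<bullet> (y + u) + p \<bullet> u + Re (\<gamma>' - \<gamma>)"
    unfolding theta_def xq
    by (simp add: matrix_vector_mult_diff_rdistrib matrix_vector_right_distrib inner_add_left inner_add_right
        inner_diff_left inner_diff_right)
  also have "\<bar>\<dots>\<bar> \<le> \<bar>(y + u) \<bullet> ((?A' - ?A) *v (y + u))\<bar> + \<bar>u \<bullet> (?A *v (y + u))\<bar> + \<bar>y \<bullet> (?A *v u)\<bar>
        + \<bar>(p' - p) \<bullet> (y + u)\<bar> + \<bar>p \<bullet> u\<bar> + \<bar>Re (\<gamma>' - \<gamma>)\<bar>"
    by linarith
  also have "\<dots> \<le> \<delta> * (?n + r) * (?n + r) + R * \<delta> * (?n + r) + R * ?n * \<delta> + \<delta> * (?n + r) + R * \<delta> + \<delta>"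
  proof (intro add_mono)
    show "\<bar>(y + u) \<bullet> ((?A' - ?A) *v (y + u))\<bar> \<le> \<delta> * (?n + r) * (?n + r)"
      using nyu \<delta>(4) d0 r0 by (intro order_trans[OF abs_inner_matrix_le] mult_mono) (auto simp: norm_minus_commute)
    show "\<bar>u \<bullet> (?A *v (y + u))\<bar> \<le> R * \<delta> * (?n + r)"
      using nyu u R d0 r0 R0 by (intro order_trans[OF abs_inner_matrix_le] mult_mono) auto
    show "\<bar>y \<bullet> (?A *v u)\<bar> \<le> R * ?n * \<delta>"
      using u R d0 r0 R0 by (intro order_trans[OF abs_inner_matrix_le] mult_mono) auto
    show "\<bar>(p' - p) \<bullet> (y + u)\<bar> \<le> \<delta> * (?n + r)"
      using nyu \<delta>(2) d0 r0 by (intro order_trans[OF Cauchy_Schwarz_ineq2] mult_mono) (auto simp: norm_minus_commute)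
    show "\<bar>p \<bullet> u\<bar> \<le> R * \<delta>"
      using u R R0 by (intro order_trans[OF Cauchy_Schwarz_ineq2] mult_mono) auto
    show "\<bar>Re (\<gamma>' - \<gamma>)\<bar> \<le> \<delta>"
      using abs_Re_le_cmod[of "\<gamma>' - \<gamma>"] \<delta>(3) by (simp add: norm_minus_commute)
  qed
  also have "\<dots> = \<delta> * ((?n + r)\<^sup>2 + (2 * R + 1) * ?n + (R * r + r + R + 1))"
    by (simp add: power2_eq_square algebra_simps)
  \<comment> \<open>The constant is the sum of 2 + 2 r^2, 2 R + 1 and R r + r + R + 1, one for each
    of the three summands, each multiplied by 1 + |y|^2.\<close>
  also have "\<dots> \<le> \<delta> * ((4 + 2 * r\<^sup>2 + r + 3 * R + R * r) * (1 + ?n\<^sup>2))"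
  proof (rule mult_left_mono[OF _ d0])
    have n1: "?n \<le> 1 + ?n\<^sup>2"
      using zero_le_power2[of "?n - 1"] by (simp add: power2_eq_square algebra_simps) (smt (verit) mult_nonneg_nonneg norm_ge_zero)
    have "(?n + r)\<^sup>2 \<le> 2 * ?n\<^sup>2 + 2 * r\<^sup>2"
      using zero_le_power2[of "?n - r"] by (simp add: power2_eq_square algebra_simps)
    also have "\<dots> \<le> (2 + 2 * r\<^sup>2) * (1 + ?n\<^sup>2)" by (simp add: algebra_simps)
    finally have a: "(?n + r)\<^sup>2 \<le> (2 + 2 * r\<^sup>2) * (1 + ?n\<^sup>2)" .
    have b: "(2 * R + 1) * ?n \<le> (2 * R + 1) * (1 + ?n\<^sup>2)" using R0 n1 by (intro mult_left_mono) auto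
    have c: "R * r + r + R + 1 \<le> (R * r + r + R + 1) * (1 + ?n\<^sup>2)"
      using R0 r0 mult_left_mono[of 1 "1 + ?n\<^sup>2" "R * r + r + R + 1"] by simp
    show "(?n + r)\<^sup>2 + (2 * R + 1) * ?n + (R * r + r + R + 1) \<le> (4 + 2 * r\<^sup>2 + r + 3 * R + R * r) * (1 + ?n\<^sup>2)"
      using a b c by (simp add: algebra_simps)
  qed
  finally show ?thesis by (simp add: y_def)
qed

subsection \<open>Transport and phase errors\<close>

text \<open>Both functions carry the perturbed phase, whose modulus is at most \<open>G\<close>, so
  only w(\<eta>') - w(\<eta>) remains. Its displacement is at most P |z| + Q at the interpolated
  point z: \<open>P\<close>, from B' - B, is free of \<open>\<epsilon>\<close>, while
  \<open>Q\<close>, from q - q', carries \<epsilon>^(-1/2).\<close>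

lemma packet_transport_bound:
  fixes w :: "real^'n \<Rightarrow> complex" and B B' :: "real^'n^'n"
  assumes e: "\<epsilon> > 0" and d: "\<And>x. w differentiable (at x)" and cg: "continuous_on UNIV (grad w)"
    and g1: "L2sq (grad w) \<le> ennreal (C1\<^sup>2 * (\<epsilon> powr (- real CARD('n) / 4))\<^sup>2)"
    and g5: "L2sq (\<lambda>\<eta>. norm \<eta> *\<^sub>R grad w \<eta>) \<le> ennreal (C5\<^sup>2 * (\<epsilon> powr (- real CARD('n) / 4))\<^sup>2)"
    and \<delta>: "norm (q - q') \<le> \<delta>" "norm (B - B') \<le> \<delta>" "\<delta> \<le> \<rho>" and R: "norm B \<le> R"
    and inv: "\<And>M. norm (M - B) \<le> \<rho> \<Longrightarrow> m \<le> \<bar>det M\<bar> \<and> (\<forall>v. c * norm v \<le> norm (M *v v))"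
    and m: "0 < m" and c: "0 < c" and G: "exp (- Im \<gamma>' / \<epsilon>) \<le> G"
    and K: "K = sqrt ((2 * C5\<^sup>2 / c\<^sup>2 + 2 * C1\<^sup>2 * ((R + \<rho>) * (\<rho> / c + 1))\<^sup>2) / m)"
  shows "L2sq (\<lambda>x. w (eta \<epsilon> B q x) * exp (\<i> / complex_of_real \<epsilon> * theta q' p' \<gamma>' \<alpha>' x)
      - packet \<epsilon> q' p' \<gamma>' \<alpha>' B' w x) \<le> ennreal ((G * (\<delta> * K * (1 + \<epsilon> powr (- 1 / 2))))\<^sup>2)"
proof -
  let ?r = "\<epsilon> powr (- 1 / 2)"
  let ?B = "\<lambda>s. B + s *\<^sub>R (B' - B)"
  \<comment> \<open>Matrix and offset of the interpolation between the affine maps \<eta> and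
    \<eta>'; convexity keeps \<open>?B s\<close> within \<rho> of \<open>B\<close>.\<close>
  let ?M = "\<lambda>s. matrix ((*\<^sub>R) ?r) ** ?B s"
  let ?c = "\<lambda>s. - (?r *\<^sub>R (B *v q + s *\<^sub>R (B' *v q' - B *v q)))"
  let ?X = "(\<epsilon> powr (- real CARD('n) / 4))\<^sup>2"
  define P where "P = \<delta> / c"
  define Q where "Q = ?r * (\<delta> * ((R + \<rho>) * (\<rho> / c + 1)))"
  have d0: "0 \<le> \<delta>" using \<delta>(1) norm_ge_zero order_trans by blast
  have R0: "0 \<le> R" using R norm_ge_zero order_trans by blast
  have G0: "0 \<le> G" using G exp_ge_zero order_trans by blast
  have r: "0 < ?r" using e by simp
  have rho0: "0 \<le> \<rho>" using d0 \<delta>(3) by simp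
  have NB': "norm B' \<le> R + \<rho>"
    using norm_triangle_ineq2[of B' B] \<delta> R by (simp add: norm_minus_commute)
  have X: "?X = 1 / \<epsilon> powr (real CARD('n) / 2)"
    using e by (simp add: power2_eq_square powr_add[symmetric] powr_minus_divide[symmetric])
  have dr: "?r ^ CARD('n) = ?X"
  proof -
    have "?r ^ CARD('n) = \<epsilon> powr (- (real CARD('n) / 2))"
      using e by (simp add: powr_realpow[symmetric] powr_powr)
    then show ?thesis unfolding X powr_minus_divide .
  qed
  have cw: "continuous_on UNIV w"
    using d by (simp add: continuous_at_imp_continuous_on differentiable_imp_continuous_within)
  have near: "norm (?B s - B) \<le> \<rho>" if "s \<in> {0..1}" for s
  proof -
    have "norm (?B s - B) = s * norm (B - B')" using that by (simp add: norm_minus_commute)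
    also have "\<dots> \<le> 1 * \<delta>" using that \<delta> by (intro mult_mono) auto
    finally show ?thesis using \<delta> by simp
  qed
  have F: "eta \<epsilon> B q x + s *\<^sub>R (eta \<epsilon> B' q' x - eta \<epsilon> B q x) = ?M s *v x + ?c s" for s x
    unfolding eta_def
    by (simp add: matrix_vector_mul_assoc[symmetric] matrix_scaleR_self matrix_vector_mult_add_rdistrib
        matrix_vector_mult_diff_rdistrib matrix_vector_mult_diff_distrib scaleR_matrix_vector_assoc[symmetric]
        scaleR_add_right scaleR_diff_right algebra_simps)
  have "L2sq (\<lambda>x. w (eta \<epsilon> B' q' x) - w (eta \<epsilon> B q x))
      \<le> ennreal (1 / (?X * m)) * (\<integral>\<^sup>+z. ennreal (((P * norm z + Q) * norm (grad w z))\<^sup>2) \<partial>lebesgue)"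
  proof (rule L2sq_affine_path[OF d cg continuous_on_eta continuous_on_eta F])
    show "0 < ?X * m" using e m by simp
    fix s :: real assume s: "s \<in> {0..1}"
    show "?X * m \<le> \<bar>det (?M s)\<bar>"
      using inv[OF near[OF s]] e by (simp add: det_mul abs_mult dr[simplified])
    fix x
    define y where "y = x - q"
    define u where "u = q - q'"
    have xq: "x - q = y" "x - q' = y + u" by (simp_all add: y_def u_def)
    have un: "norm u \<le> \<delta>" using \<delta> by (simp add: u_def)
    have Bu: "norm (B' *v u) \<le> (R + \<rho>) * \<delta>"
      using un NB' R0 rho0 by (intro order_trans[OF norm_matrix_vector_mult_le] mult_mono) auto
    let ?F = "eta \<epsilon> B q x + s *\<^sub>R (eta \<epsilon> B' q' x - eta \<epsilon> B q x)"
    have Fe: "?F = ?r *\<^sub>R (?B s *v y + s *\<^sub>R (B' *v u))"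
      unfolding eta_def xq
      by (simp add: matrix_vector_mult_add_rdistrib matrix_vector_mult_diff_rdistrib matrix_vector_right_distrib
          scaleR_matrix_vector_assoc[symmetric] algebra_simps)
    have ba: "eta \<epsilon> B' q' x - eta \<epsilon> B q x = ?r *\<^sub>R ((B' - B) *v y + B' *v u)"
      unfolding eta_def xq
      by (simp add: matrix_vector_mult_diff_rdistrib matrix_vector_right_distrib algebra_simps)
    \<comment> \<open>The distance |y| from the centre is recovered from the interpolated point
      \<open>?F\<close>, uniformly in \<open>s\<close>, through the lower bound \<open>c\<close> for
      the interpolated matrix.\<close>
    have "c * norm y \<le> norm (?B s *v y)" using inv[OF near[OF s]] by blast
    also have "\<dots> \<le> norm (?B s *v y + s *\<^sub>R (B' *v u)) + norm (s *\<^sub>R (B' *v u))"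
      using norm_triangle_ineq4[of "?B s *v y + s *\<^sub>R (B' *v u)" "s *\<^sub>R (B' *v u)"] by simp
    also have "norm (s *\<^sub>R (B' *v u)) \<le> 1 * ((R + \<rho>) * \<delta>)"
      unfolding norm_scaleR using s Bu by (intro mult_mono) auto
    also have "norm (?B s *v y + s *\<^sub>R (B' *v u)) = norm ?F / ?r"
      unfolding Fe using r by simp
    finally have cy: "c * norm y \<le> norm ?F / ?r + (R + \<rho>) * \<delta>" by simp
    have "norm (eta \<epsilon> B' q' x - eta \<epsilon> B q x) = ?r * norm ((B' - B) *v y + B' *v u)"
      unfolding ba using r by simp
    also have "\<dots> \<le> ?r * (\<delta> * norm y + (R + \<rho>) * \<delta>)"
    proof (rule mult_left_mono)
      have "norm ((B' - B) *v y) \<le> \<delta> * norm y"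
        using \<delta>(2) by (intro order_trans[OF norm_matrix_vector_mult_le] mult_right_mono) (auto simp: norm_minus_commute)
      then show "norm ((B' - B) *v y + B' *v u) \<le> \<delta> * norm y + (R + \<rho>) * \<delta>"
        using Bu norm_triangle_ineq[of "(B' - B) *v y" "B' *v u"] by linarith
    qed (use r in simp)
    also have "\<dots> \<le> ?r * (\<delta> * ((norm ?F / ?r + (R + \<rho>) * \<delta>) / c) + (R + \<rho>) * \<delta>)"
      using cy c d0 r by (intro mult_left_mono add_right_mono) (auto simp: pos_le_divide_eq mult.commute)
    also have "\<dots> = P * norm ?F + ?r * (\<delta> * ((R + \<rho>) * (\<delta> / c + 1)))"
      using r c by (simp add: P_def field_simps)
    also have "\<dots> \<le> P * norm ?F + Q"
      unfolding Q_def using r d0 R0 rho0 c \<delta>(3)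
      by (intro add_left_mono mult_left_mono add_right_mono divide_right_mono) auto
    finally show "norm (eta \<epsilon> B' q' x - eta \<epsilon> B q x) \<le> P * norm ?F + Q" .
  qed
  also have "\<dots> \<le> ennreal (1 / (?X * m)) * (ennreal (2 * P\<^sup>2) * ennreal (C5\<^sup>2 * ?X) + ennreal (2 * Q\<^sup>2) * ennreal (C1\<^sup>2 * ?X))"
    by (intro mult_left_mono order_trans[OF weighted_gradient_le[OF cg]] add_mono g1 g5) auto
  also have "\<dots> = ennreal (1 / (?X * m) * (2 * P\<^sup>2 * (C5\<^sup>2 * ?X) + 2 * Q\<^sup>2 * (C1\<^sup>2 * ?X)))"
    using m by (simp add: ennreal_mult[symmetric] ennreal_plus[symmetric] del: ennreal_plus)
  \<comment> \<open>The \<open>?X\<close> of the Jacobian cancels the \<open>?X\<close> of the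
    gradient bounds \<open>g1\<close> and \<open>g5\<close>.\<close>
  also have "1 / (?X * m) * (2 * P\<^sup>2 * (C5\<^sup>2 * ?X) + 2 * Q\<^sup>2 * (C1\<^sup>2 * ?X)) = (2 * P\<^sup>2 * C5\<^sup>2 + 2 * Q\<^sup>2 * C1\<^sup>2) / m"
    using m e by (simp add: field_simps)
  also have "\<dots> \<le> (\<delta> * K * (1 + ?r))\<^sup>2"
  proof -
    \<comment> \<open>\<open>?a\<close> comes from \<open>P\<close> and \<open>?b\<close> from
      \<open>Q\<close>; both 1 and \<open>?r\<^sup>2\<close> are at most
      \<open>(1 + ?r)\<^sup>2\<close>, which leaves the single constant \<open>K\<close>.\<close>
    let ?a = "2 * C5\<^sup>2 / c\<^sup>2 / m" and ?b = "2 * C1\<^sup>2 * ((R + \<rho>) * (\<rho> / c + 1))\<^sup>2 / m"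
    have K2: "K\<^sup>2 = ?a + ?b" unfolding K using m by (simp add: add_divide_distrib)
    have "2 * P\<^sup>2 * C5\<^sup>2 / m = \<delta>\<^sup>2 * ?a"
      by (simp add: P_def power_divide)
    moreover have "2 * Q\<^sup>2 * C1\<^sup>2 / m = \<delta>\<^sup>2 * (?b * ?r\<^sup>2)"
      unfolding Q_def power_mult_distrib by (simp only: times_divide_eq_left times_divide_eq_right mult_ac)
    ultimately have "(2 * P\<^sup>2 * C5\<^sup>2 + 2 * Q\<^sup>2 * C1\<^sup>2) / m = \<delta>\<^sup>2 * (?a * 1 + ?b * ?r\<^sup>2)"
      by (simp only: add_divide_distrib distrib_left mult_1_right)
    also have "\<dots> \<le> \<delta>\<^sup>2 * (?a * (1 + ?r)\<^sup>2 + ?b * (1 + ?r)\<^sup>2)"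
      using r m by (intro mult_left_mono add_mono power_mono) auto
    also have "\<dots> = (\<delta> * K * (1 + ?r))\<^sup>2" 
      unfolding power_mult_distrib K2 by (simp only: distrib_left distrib_right mult_ac)
    finally show ?thesis .
  qed
  finally have diff: "L2sq (\<lambda>x. w (eta \<epsilon> B' q' x) - w (eta \<epsilon> B q x)) \<le> ennreal ((\<delta> * K * (1 + ?r))\<^sup>2)"
    by (simp add: ennreal_leI)
  have "L2sq (\<lambda>x. w (eta \<epsilon> B q x) * exp (\<i> / complex_of_real \<epsilon> * theta q' p' \<gamma>' \<alpha>' x)
      - packet \<epsilon> q' p' \<gamma>' \<alpha>' B' w x) \<le> ennreal (G\<^sup>2) * L2sq (\<lambda>x. w (eta \<epsilon> B' q' x) - w (eta \<epsilon> B q x))"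
  proof (rule L2sq_cmult[OF _ _ G0])
    show "(\<lambda>x. w (eta \<epsilon> B' q' x) - w (eta \<epsilon> B q x)) \<in> borel_measurable lebesgue"
      by (intro measurable_completion)
         (auto intro!: borel_measurable_continuous_onI continuous_on_diff continuous_on_compose2[OF cw continuous_on_eta])
    fix x
    have "w (eta \<epsilon> B q x) * exp (\<i> / complex_of_real \<epsilon> * theta q' p' \<gamma>' \<alpha>' x) - packet \<epsilon> q' p' \<gamma>' \<alpha>' B' w x
        = - ((w (eta \<epsilon> B' q' x) - w (eta \<epsilon> B q x)) * exp (\<i> / complex_of_real \<epsilon> * theta q' p' \<gamma>' \<alpha>' x))"
      by (simp add: packet_def algebra_simps)
    then have "cmod (w (eta \<epsilon> B q x) * exp (\<i> / complex_of_real \<epsilon> * theta q' p' \<gamma>' \<alpha>' x) - packet \<epsilon> q' p' \<gamma>' \<alpha>' B' w x)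
        = exp (- Im \<gamma>' / \<epsilon>) * cmod (w (eta \<epsilon> B' q' x) - w (eta \<epsilon> B q x))"
      unfolding norm_minus_cancel norm_mult cmod_exp_i_div[OF e] by (simp only: norm_minus_cancel norm_mult cmod_exp_i_div[OF e]) (simp add: theta_def)
    then show "cmod (w (eta \<epsilon> B q x) * exp (\<i> / complex_of_real \<epsilon> * theta q' p' \<gamma>' \<alpha>' x) - packet \<epsilon> q' p' \<gamma>' \<alpha>' B' w x)
        \<le> G * cmod (w (eta \<epsilon> B' q' x) - w (eta \<epsilon> B q x))"
      using G by (simp only:) (intro mult_right_mono, auto)
  qed
  also have "\<dots> \<le> ennreal (G\<^sup>2) * ennreal ((\<delta> * K * (1 + ?r))\<^sup>2)" by (intro mult_left_mono diff) simp
  also have "\<dots> = ennreal ((G * (\<delta> * K * (1 + ?r)))\<^sup>2)"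
    by (simp add: ennreal_mult[symmetric] power_mult_distrib)
  finally show ?thesis .
qed

text \<open>The second function is the packet times s exp(i d / \<epsilon>), where s is the ratio of
  the amplitudes and d the difference of the real phases. Thus the error is the packet times a
  factor bounded by |1 - s| + s |d| / \<epsilon>, and |d| grows at most quadratically in x -
  q.\<close>

lemma packet_phase_bound:
  fixes w :: "real^'n \<Rightarrow> complex" and B :: "real^'n^'n"
  assumes e: "\<epsilon> > 0" and wm: "w \<in> borel_measurable lebesgue" and B: "det B \<noteq> 0"
    and \<delta>: "norm (q - q') \<le> \<delta>" "norm (p - p') \<le> \<delta>" "cmod (\<gamma> - \<gamma>') \<le> \<delta>" "norm (Re_mat \<alpha> - Re_mat \<alpha>') \<le> \<delta>"
    and R: "norm p \<le> R" "norm (Re_mat \<alpha>) \<le> R" and r: "\<delta> \<le> r" and \<delta>k: "\<delta> = k * E" and E: "0 \<le> E" and k: "0 \<le> k"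
    and D1: "\<bar>exp (- (Im \<gamma> - Im \<gamma>') / \<epsilon>) - 1\<bar> \<le> D1 * E / \<epsilon>"
    and D2: "exp (- (Im \<gamma>' - Im \<gamma>) / \<epsilon>) \<le> D2"
    and H: "L2sq (packet \<epsilon> q p \<gamma> \<alpha> B w) \<le> ennreal H" "0 \<le> H"
    and mom: "integrable lebesgue (\<lambda>x. norm (x - q) ^ 4 * (cmod (packet \<epsilon> q p \<gamma> \<alpha> B w x))\<^sup>2)"
    and M4: "(LINT x|lebesgue. norm (x - q) ^ 4 * (cmod (packet \<epsilon> q p \<gamma> \<alpha> B w x))\<^sup>2) \<le> M4"
    and Y: "Y = D2 * (\<bar>D1\<bar> + k * (4 + 2 * r\<^sup>2 + r + 3 * R + R * r))"
  shows "L2sq (\<lambda>x. packet \<epsilon> q p \<gamma> \<alpha> B w x - w (eta \<epsilon> B q x) * exp (\<i> / complex_of_real \<epsilon> * theta q' p' \<gamma>' \<alpha>' x))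
    \<le> ennreal ((Y * sqrt (2 * H + 2) * (E / \<epsilon>) * (sqrt M4 + 1))\<^sup>2)"
proof -
  let ?\<psi> = "packet \<epsilon> q p \<gamma> \<alpha> B w"
  let ?S = "4 + 2 * r\<^sup>2 + r + 3 * R + R * r"
  have d0: "0 \<le> \<delta>" using \<delta>(1) norm_ge_zero order_trans by blast
  have R0: "0 \<le> R" using R norm_ge_zero order_trans by blast
  have D20: "0 \<le> D2" using D2 exp_ge_zero order_trans by blast
  have S0: "0 \<le> ?S" using R0 d0 r by (intro add_nonneg_nonneg) auto
  have Y0: "0 \<le> Y" unfolding Y using D20 k S0 by (intro mult_nonneg_nonneg[OF D20] add_nonneg_nonneg mult_nonneg_nonneg[OF k S0]) auto
  have [measurable]: "?\<psi> \<in> borel_measurable lebesgue" by (rule borel_measurable_packet[OF wm B e])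
  have M40: "0 \<le> M4" using M4 by (rule order_trans[rotated]) simp
  have pt: "cmod (?\<psi> x - w (eta \<epsilon> B q x) * exp (\<i> / complex_of_real \<epsilon> * theta q' p' \<gamma>' \<alpha>' x))
      \<le> Y * (E / \<epsilon>) * ((1 + (norm (x - q))\<^sup>2) * cmod (?\<psi> x))" for x
  proof -
    define \<theta> where "\<theta> = theta q p \<gamma> \<alpha> x"
    define \<theta>' where "\<theta>' = theta q' p' \<gamma>' \<alpha>' x"
    define d where "d = Re \<theta>' - Re \<theta>"
    define s where "s = exp (- (Im \<gamma>' - Im \<gamma>) / \<epsilon>)"
    let ?u = "exp (\<i> * complex_of_real (d / \<epsilon>))"
    have s: "0 \<le> s" "s \<le> D2" using D2 by (simp_all add: s_def)
    have "\<theta>' - \<theta> = complex_of_real d + \<i> * complex_of_real (Im \<gamma>' - Im \<gamma>)"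
      by (simp add: complex_eq_iff d_def \<theta>_def \<theta>'_def theta_def)
    then have "\<i> / complex_of_real \<epsilon> * \<theta>' - \<i> / complex_of_real \<epsilon> * \<theta>
        = complex_of_real (- (Im \<gamma>' - Im \<gamma>) / \<epsilon>) + \<i> * complex_of_real (d / \<epsilon>)"
      unfolding right_diff_distrib[symmetric] by (simp add: distrib_left diff_divide_distrib)
    then have "exp (\<i> / complex_of_real \<epsilon> * \<theta>') = exp (\<i> / complex_of_real \<epsilon> * \<theta>) * (complex_of_real s * ?u)"
      by (metis add.commute diff_add_cancel exp_add exp_of_real s_def)
    then have "?\<psi> x - w (eta \<epsilon> B q x) * exp (\<i> / complex_of_real \<epsilon> * \<theta>') = ?\<psi> x * (1 - complex_of_real s * ?u)"
      by (simp add: packet_def \<theta>_def algebra_simps)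
    moreover have "cmod (1 - complex_of_real s * ?u) \<le> Y * (E / \<epsilon>) * (1 + (norm (x - q))\<^sup>2)"
    proof -
      have "1 - complex_of_real s * ?u = complex_of_real (1 - s) + complex_of_real s * (1 - ?u)"
        by (simp add: algebra_simps)
      then have "cmod (1 - complex_of_real s * ?u) \<le> \<bar>1 - s\<bar> + s * cmod (1 - ?u)"
        using norm_triangle_ineq[of "complex_of_real (1 - s)" "complex_of_real s * (1 - ?u)"] s(1)
        by (simp only: norm_mult norm_of_real abs_of_nonneg)
      \<comment> \<open>\<open>D1\<close> speaks of the reciprocal ratio 1/s. From 1 - s = s (1/s -
        1) the two hypotheses combine to the product of \<open>D2\<close> and the \<open>D1\<close>
        bound.\<close>
      also have "\<bar>1 - s\<bar> \<le> D2 * (\<bar>D1\<bar> * (E / \<epsilon>) * (1 + (norm (x - q))\<^sup>2))"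
      proof -
        let ?s' = "exp (- (Im \<gamma> - Im \<gamma>') / \<epsilon>)"
        have "s * ?s' = 1" by (simp add: s_def exp_add[symmetric] add_divide_distrib[symmetric])
        then have "\<bar>1 - s\<bar> = s * \<bar>?s' - 1\<bar>"
          using s(1) by (metis abs_mult abs_of_nonneg mult.right_neutral right_diff_distrib)
        also have "\<dots> \<le> D2 * (\<bar>D1\<bar> * (E / \<epsilon>))"
        proof (rule mult_mono)
          have "D1 * E / \<epsilon> \<le> \<bar>D1\<bar> * (E / \<epsilon>)" using E e by (simp add: divide_right_mono mult_right_mono)
          then show "\<bar>?s' - 1\<bar> \<le> \<bar>D1\<bar> * (E / \<epsilon>)" using D1 by simp
        qed (use s D20 in auto)
        also have "\<dots> \<le> D2 * (\<bar>D1\<bar> * (E / \<epsilon>) * (1 + (norm (x - q))\<^sup>2))"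
          using D20 E e mult_left_mono[of 1 "1 + (norm (x - q))\<^sup>2" "\<bar>D1\<bar> * (E / \<epsilon>)"]
          by (intro mult_left_mono) auto
        finally show ?thesis .
      qed
      also have "s * cmod (1 - ?u) \<le> D2 * (k * (E / \<epsilon>) * (?S * (1 + (norm (x - q))\<^sup>2)))"
      proof (rule mult_mono)
        have "\<bar>d\<bar> \<le> \<delta> * (?S * (1 + (norm (x - q))\<^sup>2))"
          unfolding d_def \<theta>_def \<theta>'_def by (rule theta_real_diff_bound[OF \<delta> R r])
        then have "\<bar>d / \<epsilon>\<bar> \<le> \<delta> * (?S * (1 + (norm (x - q))\<^sup>2)) / \<epsilon>"
          using e by (simp add: divide_right_mono)
        then show "cmod (1 - ?u) \<le> k * (E / \<epsilon>) * (?S * (1 + (norm (x - q))\<^sup>2))"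
          using cmod_exp_i_minus_1_le[of "d / \<epsilon>"] by (simp add: \<delta>k)
      qed (use s D20 in auto)
      also have "D2 * (\<bar>D1\<bar> * (E / \<epsilon>) * (1 + (norm (x - q))\<^sup>2)) + D2 * (k * (E / \<epsilon>) * (?S * (1 + (norm (x - q))\<^sup>2)))
          = Y * (E / \<epsilon>) * (1 + (norm (x - q))\<^sup>2)"
      proof -
        have "D2 * (a * b * N) + D2 * (k * b * (S * N)) = D2 * (a + k * S) * b * N" for a b N S
          by (simp add: algebra_simps)
        then show ?thesis unfolding Y .
      qed
      finally show ?thesis by simp
    qed
    ultimately show ?thesis
      unfolding \<theta>'_def by (simp only: norm_mult) (metis mult.assoc mult.commute mult_left_mono norm_ge_zero)
  qed
  have E4: "(\<integral>\<^sup>+x. ennreal (norm (x - q) ^ 4 * (cmod (?\<psi> x))\<^sup>2) \<partial>lebesgue) \<le> ennreal M4"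
    using M4 by (subst nn_integral_eq_integral[OF mom]) (auto intro: ennreal_leI)
  have YE: "0 \<le> Y * (E / \<epsilon>)" using Y0 E e by simp
  have "L2sq (\<lambda>x. (1 + (norm (x - q))\<^sup>2) *\<^sub>R ?\<psi> x)
      \<le> (\<integral>\<^sup>+x. ennreal 2 * ennreal ((cmod (?\<psi> x))\<^sup>2) + ennreal 2 * ennreal (norm (x - q) ^ 4 * (cmod (?\<psi> x))\<^sup>2) \<partial>lebesgue)"
    unfolding L2sq_def
  proof (rule nn_integral_mono)
    fix x
    let ?n = "norm (x - q)"
    have "(1 + ?n\<^sup>2)\<^sup>2 \<le> 2 + 2 * ?n ^ 4"
      using zero_le_power2[of "1 - ?n\<^sup>2"] by (simp add: power2_eq_square power4_eq_xxxx algebra_simps)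
    then have "(1 + ?n\<^sup>2)\<^sup>2 * (cmod (?\<psi> x))\<^sup>2 \<le> (2 + 2 * ?n ^ 4) * (cmod (?\<psi> x))\<^sup>2"
      by (rule mult_right_mono) simp
    moreover have "(cmod ((1 + ?n\<^sup>2) *\<^sub>R ?\<psi> x))\<^sup>2 = (1 + ?n\<^sup>2)\<^sup>2 * (cmod (?\<psi> x))\<^sup>2"
      by (simp only: norm_scaleR power_mult_distrib power2_abs)
    ultimately have "(cmod ((1 + ?n\<^sup>2) *\<^sub>R ?\<psi> x))\<^sup>2 \<le> 2 * (cmod (?\<psi> x))\<^sup>2 + 2 * (?n ^ 4 * (cmod (?\<psi> x))\<^sup>2)"
      by (simp only: distrib_right[of 2] mult.assoc)
    then show "ennreal ((cmod ((1 + ?n\<^sup>2) *\<^sub>R ?\<psi> x))\<^sup>2)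
        \<le> ennreal 2 * ennreal ((cmod (?\<psi> x))\<^sup>2) + ennreal 2 * ennreal (?n ^ 4 * (cmod (?\<psi> x))\<^sup>2)"
      by (simp only: ennreal_mult[symmetric] ennreal_plus[symmetric] ennreal_leI
          mult_nonneg_nonneg zero_le_power2 zero_le_power norm_ge_zero zero_le_numeral)
  qed
  also have "\<dots> = ennreal 2 * L2sq ?\<psi> + ennreal 2 * (\<integral>\<^sup>+x. ennreal (norm (x - q) ^ 4 * (cmod (?\<psi> x))\<^sup>2) \<partial>lebesgue)"
    unfolding L2sq_def using borel_measurable_integrable[OF mom]
    by (subst nn_integral_add) (auto simp: nn_integral_cmult)
  also have "\<dots> \<le> ennreal 2 * ennreal H + ennreal 2 * ennreal M4"
    by (intro add_mono mult_left_mono H(1) E4) auto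
  also have "\<dots> = ennreal (2 * H + 2 * M4)"
    using H(2) M40 by (simp add: ennreal_mult[symmetric] ennreal_plus[symmetric] del: ennreal_plus ennreal_numeral)
  finally have w1: "L2sq (\<lambda>x. (1 + (norm (x - q))\<^sup>2) *\<^sub>R ?\<psi> x) \<le> ennreal (2 * H + 2 * M4)" .
  have "L2sq (\<lambda>x. ?\<psi> x - w (eta \<epsilon> B q x) * exp (\<i> / complex_of_real \<epsilon> * theta q' p' \<gamma>' \<alpha>' x))
      \<le> ennreal ((Y * (E / \<epsilon>))\<^sup>2) * L2sq (\<lambda>x. (1 + (norm (x - q))\<^sup>2) *\<^sub>R ?\<psi> x)"
  proof (rule L2sq_cmult[OF _ _ YE])
    have [measurable]: "(\<lambda>x. 1 + (norm (x - q))\<^sup>2) \<in> borel_measurable lebesgue"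
      by (intro measurable_completion) (auto intro!: borel_measurable_continuous_onI continuous_intros)
    show "(\<lambda>x. (1 + (norm (x - q))\<^sup>2) *\<^sub>R ?\<psi> x) \<in> borel_measurable lebesgue" by measurable
    show "cmod (?\<psi> x - w (eta \<epsilon> B q x) * exp (\<i> / complex_of_real \<epsilon> * theta q' p' \<gamma>' \<alpha>' x))
        \<le> Y * (E / \<epsilon>) * cmod ((1 + (norm (x - q))\<^sup>2) *\<^sub>R ?\<psi> x)" for x
      using pt[of x] by (simp only: norm_scaleR abs_of_nonneg add_nonneg_nonneg zero_le_one zero_le_power2)
  qed
  also have "\<dots> \<le> ennreal ((Y * (E / \<epsilon>))\<^sup>2) * ennreal (2 * H + 2 * M4)"
    by (intro mult_left_mono w1) simp
  also have "\<dots> = ennreal ((Y * (E / \<epsilon>))\<^sup>2 * (2 * H + 2 * M4))"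
    using H(2) M40 by (subst ennreal_mult[symmetric]) auto
  also have "\<dots> \<le> ennreal ((Y * (E / \<epsilon>))\<^sup>2 * ((2 * H + 2) * (sqrt M4 + 1)\<^sup>2))"
  proof (intro ennreal_leI mult_left_mono)
    have "2 * H + 2 * M4 \<le> (2 * H + 2) * (1 + M4)" using H(2) M40 by (simp add: algebra_simps)
    also have "1 + M4 \<le> (sqrt M4 + 1)\<^sup>2" using M40 by (simp add: power2_eq_square algebra_simps)
    finally show "2 * H + 2 * M4 \<le> (2 * H + 2) * (sqrt M4 + 1)\<^sup>2"
      using H(2) by (simp add: mult_left_mono)
  qed simp
  also have "(Y * (E / \<epsilon>))\<^sup>2 * ((2 * H + 2) * (sqrt M4 + 1)\<^sup>2) = (Y * sqrt (2 * H + 2) * (E / \<epsilon>) * (sqrt M4 + 1))\<^sup>2"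
  proof -
    have "(sqrt (2 * H + 2))\<^sup>2 = 2 * H + 2" using H(2) by simp
    then show ?thesis unfolding power_mult_distrib by (simp only: mult_ac)
  qed
  finally show ?thesis .
qed

section \<open>From the maximum norms of the hypotheses to Euclidean norms\<close>

lemma cmod_nth_le_mat_infnorm: "cmod (A $ i $ j) \<le> mat_infnorm A" for A :: "complex^'n^'n"
proof -
  have le: "cmod (v $ i) \<le> cvec_infnorm v" for v :: "complex^'n" and i
    unfolding cvec_infnorm_def by (rule Max_ge) auto
  \<comment> \<open>This crude bound by the sum of all entries shows that the supremum is over a
    bounded set; only then does its value at axis j bound column j.\<close>
  have "cvec_infnorm (A *v v) \<le> (\<Sum>i\<in>UNIV. \<Sum>j\<in>UNIV. cmod (A $ i $ j))" if "norm v = 1" for v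
  proof -
    have "cmod ((A *v v) $ i) \<le> (\<Sum>i\<in>UNIV. \<Sum>j\<in>UNIV. cmod (A $ i $ j))" for i
    proof -
      have "cmod ((A *v v) $ i) \<le> (\<Sum>j\<in>UNIV. cmod (A $ i $ j * v $ j))"
        by (simp add: matrix_vector_mult_def norm_sum)
      also have "\<dots> \<le> (\<Sum>j\<in>UNIV. cmod (A $ i $ j))"
        using Finite_Cartesian_Product.norm_nth_le[of v] that
        by (intro sum_mono) (simp add: norm_mult mult_left_le)
      also have "\<dots> \<le> (\<Sum>i\<in>UNIV. \<Sum>j\<in>UNIV. cmod (A $ i $ j))"
        by (rule member_le_sum) (auto intro: sum_nonneg)
      finally show ?thesis .
    qed
    then show ?thesis unfolding cvec_infnorm_def by (subst Max_le_iff) auto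
  qed
  then have "bdd_above ((\<lambda>v. cvec_infnorm (A *v v)) ` {v. norm v = 1})"
    by (intro bdd_aboveI) auto
  then have "cvec_infnorm (A *v axis j 1) \<le> mat_infnorm A"
    unfolding mat_infnorm_def by (intro cSUP_upper) (auto simp: norm_eq_1 inner_axis')
  moreover have "(A *v axis j 1) $ i = A $ i $ j"
    by (simp add: matrix_vector_mult_def axis_def if_distrib cong: if_cong)
  ultimately show ?thesis using le[of "A *v axis j 1" i] by simp
qed

lemma norm_matrix_le_card:
  fixes M :: "real^'n^'n"
  assumes "\<And>i j. \<bar>M $ i $ j\<bar> \<le> E"
  shows "norm M \<le> (real CARD('n))\<^sup>2 * E"
proof -
  have "norm M \<le> (\<Sum>i\<in>UNIV. norm (M $ i))"
    unfolding norm_vec_def[of M] by (rule L2_set_le_sum) simp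
  also have "\<dots> \<le> (\<Sum>i::'n\<in>UNIV. \<Sum>j::'n\<in>UNIV. E)"
    by (intro sum_mono order_trans[OF norm_le_l1_cart] assms)
  finally show ?thesis by (simp add: power2_eq_square)
qed

text \<open>The squared cardinality matches \<open>norm_matrix_le_card\<close>, so that vectors and
  matrices share one conversion constant.\<close>

lemma norm_le_card_infnorm: "norm x \<le> (real CARD('n))\<^sup>2 * infnorm x" for x :: "real^'n"
proof -
  have "norm x \<le> (\<Sum>i::'n\<in>UNIV. infnorm x)"
    by (intro order_trans[OF norm_le_l1_cart] sum_mono component_le_infnorm_cart)
  also have "\<dots> = real CARD('n) * infnorm x" by simp
  also have "\<dots> \<le> (real CARD('n))\<^sup>2 * infnorm x"
    by (intro mult_right_mono infnorm_pos_le) (simp add: power2_eq_square)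
  finally show ?thesis .
qed

text \<open>The disjunction with \<open>\<rho>\<close> and \<open>\<kappa>\<close> keeps the
  perturbed coordinates nondegenerate: reconstructing w - w' multiplies its squared norm by a factor
  proportional to 1 / |det B'|. Parameter errors below \<open>\<rho>\<close> force a lower bound on
  this determinant, since B' then stays close to the exact \<open>B\<close>; for larger errors the
  bound is \<open>\<kappa>\<close>.\<close>

theorem theorem3p1:
  fixes V :: "real^'n \<Rightarrow> real" and q0 p0 :: "real^'n" and \<alpha>0 :: "complex^'n^'n"
    and T C1 C5 D1 D2 K \<kappa> :: real
  assumes "C2 V" and "pos_def (Im_mat \<alpha>0)" and "T > 0" and "\<kappa> > 0"
  shows "\<exists>A1>0. \<exists>A2>0. \<exists>A3 :: real^'n^'n \<Rightarrow> real^'n \<Rightarrow> real^'n \<Rightarrow> real. \<exists>\<rho>>0.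
    \<forall>(\<epsilon>::real) (E1::real) (E2::real) (\<gamma>0::complex)
      (q :: real \<Rightarrow> real^'n) (p :: real \<Rightarrow> real^'n) (\<gamma> :: real \<Rightarrow> complex)
      (\<alpha> :: real \<Rightarrow> complex^'n^'n) (B :: real \<Rightarrow> real^'n^'n)
      (w :: real^'n \<Rightarrow> real \<Rightarrow> complex) (\<psi> :: real^'n \<Rightarrow> real \<Rightarrow> complex)
      (q' :: real \<Rightarrow> real^'n) (p' :: real \<Rightarrow> real^'n) (\<gamma>' :: real \<Rightarrow> complex)
      (\<alpha>' :: real \<Rightarrow> complex^'n^'n) (B' :: real \<Rightarrow> real^'n^'n)
      (w' :: real^'n \<Rightarrow> real \<Rightarrow> complex).
      \<epsilon> > 0 \<longrightarrow>
      L2norm (psi_init \<epsilon> q0 p0 \<gamma>0 \<alpha>0) = 1 \<longrightarrow>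
      gwpt_solution \<epsilon> V T q0 p0 \<gamma>0 \<alpha>0 q p \<gamma> \<alpha> B \<longrightarrow>
      w_solution \<epsilon> V T q B w \<longrightarrow>
      schrodinger_solution \<epsilon> V T (psi_init \<epsilon> q0 p0 \<gamma>0 \<alpha>0) \<psi> \<longrightarrow>
      (\<forall>t\<in>{0..T}. \<forall>x. \<psi> x t = reconstruct \<epsilon> q p \<gamma> \<alpha> B w x t) \<longrightarrow>
      (\<forall>t\<in>{0..T}. in_L2 (\<lambda>\<eta>. w \<eta> t - w' \<eta> t) \<and>
         L2norm (\<lambda>\<eta>. w \<eta> t - w' \<eta> t) \<le> E1 * \<epsilon> powr (- real CARD('n) / 4)) \<longrightarrow>
      (\<forall>t\<in>{0..T}. Max {infnorm (q t - q' t), infnorm (p t - p' t), cmod (\<gamma> t - \<gamma>' t),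
         mat_infnorm (\<alpha> t - \<alpha>' t), mat_infnorm (cplx_mat (B t - B' t))} \<le> E2) \<longrightarrow>
      fourth_moment_finite T q \<psi> \<longrightarrow>
      (\<forall>t\<in>{0..T}. in_L2 (grad (\<lambda>\<eta>. w \<eta> t)) \<and>
         L2norm (grad (\<lambda>\<eta>. w \<eta> t)) \<le> C1 * \<epsilon> powr (- real CARD('n) / 4)) \<longrightarrow>
      (\<forall>t\<in>{0..T}. in_L2 (\<lambda>\<eta>. norm \<eta> *\<^sub>R grad (\<lambda>\<xi>. w \<xi> t) \<eta>) \<and>
         L2norm (\<lambda>\<eta>. norm \<eta> *\<^sub>R grad (\<lambda>\<xi>. w \<xi> t) \<eta>) \<le> C5 * \<epsilon> powr (- real CARD('n) / 4)) \<longrightarrow>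
      (\<forall>t\<in>{0..T}. \<bar>exp (- (Im (\<gamma> t) - Im (\<gamma>' t)) / \<epsilon>) - 1\<bar> \<le> D1 * E2 / \<epsilon>) \<longrightarrow>
      (\<forall>t\<in>{0..T}. exp (- (Im (\<gamma>' t) - Im (\<gamma> t)) / \<epsilon>) \<le> D2) \<longrightarrow>
      E2 \<le> K * \<epsilon> \<longrightarrow>
      E2 < \<rho> \<or> (\<forall>t\<in>{0..T}. \<kappa> \<le> \<bar>det (B' t)\<bar>) \<longrightarrow>
      (\<forall>t\<in>{0..T}. in_L2 (\<lambda>x. \<psi> x t - reconstruct \<epsilon> q' p' \<gamma>' \<alpha>' B' w' x t) \<and>
         L2norm (\<lambda>x. \<psi> x t - reconstruct \<epsilon> q' p' \<gamma>' \<alpha>' B' w' x t)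
           \<le> A1 * E1 + A2 * E2 * (1 + \<epsilon> powr (- 1 / 2))
             + A3 (Re_mat (\<alpha> t)) (q t) (p t) * (E2 / \<epsilon>) * (sqrt (fourth_moment T q \<psi>) + 1))"
proof -
  let ?n = "real CARD('n)"
  obtain R \<rho> m c where pos: "0 < R" "0 < \<rho>" "0 < m" "0 < c"
    and unif: "\<And>\<epsilon> \<gamma>0 q p \<gamma> \<alpha> B t. \<epsilon> > 0 \<Longrightarrow> L2norm (psi_init \<epsilon> q0 p0 \<gamma>0 \<alpha>0) = 1 \<Longrightarrow>
       gwpt_solution \<epsilon> V T q0 p0 \<gamma>0 \<alpha>0 q p \<gamma> \<alpha> B \<Longrightarrow> t \<in> {0..T} \<Longrightarrow>
       norm (p t) \<le> R \<and> norm (Re_mat (\<alpha> t)) \<le> R \<and> norm (B t) \<le> R \<and> exp (- Im (\<gamma> t) / \<epsilon>) \<le> R \<and>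
       (\<forall>M. norm (M - B t) \<le> \<rho> \<longrightarrow> m \<le> \<bar>det M\<bar> \<and> (\<forall>v. c * norm v \<le> norm (M *v v)))"
    using gwpt_uniform_bounds[OF assms(1,3), of q0 p0 \<alpha>0] by metis
  \<comment> \<open>\<open>k\<close> converts the hypothesised norms into Euclidean ones, so E2 <
    \<rho>1 gives parameter errors of at most \<rho>.\<close>
  define k where "k = ?n\<^sup>2"
  define \<rho>1 where "\<rho>1 = \<rho> / k"
  define m2 where "m2 = min m \<kappa>"
  \<comment> \<open>The perturbed amplitude is the exact one, at most \<open>R\<close>, times a
    ratio bounded by \<open>D2\<close>. The absolute value makes \<open>G\<close> nonnegative before
    (iv) is available to show that \<open>D2\<close> is positive.\<close>
  define G where "G = \<bar>D2\<bar> * R"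
  define L where "L = sqrt ((2 * C5\<^sup>2 / c\<^sup>2 + 2 * C1\<^sup>2 * ((R + \<rho>) * (\<rho> / c + 1))\<^sup>2) / m)"
  \<comment> \<open>\<open>H\<close> and \<open>H'\<close> bound the squared norms of
    \<open>w\<close> reconstructed with exact and with perturbed parameters; 24 is the Hardy
    constant.\<close>
  define H where "H = R\<^sup>2 * (24 * C5\<^sup>2 / m)"
  define H' where "H' = G\<^sup>2 * (24 * C5\<^sup>2 / m2)"
  define Y where "Y = \<bar>D2\<bar> * (\<bar>D1\<bar> + k * (4 + 2 * \<rho>\<^sup>2 + \<rho> + 3 * R + R * \<rho>))"
  \<comment> \<open>Each use of \<open>L2sq_add_sq_le\<close> costs a factor 2: the profile error
    passes through one splitting, the phase and transport errors through two. The middle summand of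
    \<open>A2\<close> serves the regime E2 \<ge> \<rho>1, and the summands 1 secure strict
    positivity.\<close>
  define A1 where "A1 = 2 * (G / sqrt m2) + 1"
  define A2 where "A2 = 4 * (G * k * L) + 4 * ((sqrt H + sqrt H') / \<rho>1) + 1"
  define A3 where "A3 = 4 * (Y * sqrt (2 * H + 2))"
  have k: "1 \<le> k" by (simp add: k_def Suc_leI)
  have m2: "0 < m2" "m2 \<le> m" "m2 \<le> \<kappa>" using pos assms(4) by (auto simp: m2_def)
  have \<rho>1: "0 < \<rho>1" using pos k by (simp add: \<rho>1_def)
  have nonneg: "0 \<le> G" "0 \<le> L" "0 \<le> H" "0 \<le> H'" "0 \<le> Y"
    using pos m2 k by (auto simp: G_def L_def H_def H'_def Y_def)
  have A: "0 < A1" "0 < A2" "0 \<le> A3"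
    using nonneg m2 k \<rho>1 by (auto simp: A1_def A2_def A3_def intro!: add_nonneg_pos add_nonneg_nonneg)
  show ?thesis
  proof (rule exI[of _ A1], rule conjI[OF A(1)], rule exI[of _ A2], rule conjI[OF A(2)],
      rule exI[of _ "\<lambda>_ _ _. A3"], rule exI[of _ \<rho>1], rule conjI[OF \<rho>1], intro allI impI ballI)
    fix \<epsilon> E1 E2 \<gamma>0 q p \<gamma> \<alpha> B w \<psi> q' p' \<gamma>' \<alpha>' B' w' t
    assume e: "(0::real) < \<epsilon>"
      and n1: "L2norm (psi_init \<epsilon> q0 p0 \<gamma>0 \<alpha>0) = 1"
      and sol: "gwpt_solution \<epsilon> V T q0 p0 \<gamma>0 \<alpha>0 q p \<gamma> \<alpha> B"
      and wsol: "w_solution \<epsilon> V T q B w"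
      and "schrodinger_solution \<epsilon> V T (psi_init \<epsilon> q0 p0 \<gamma>0 \<alpha>0) \<psi>"
      and \<psi>: "\<forall>t\<in>{0..T}. \<forall>x. \<psi> x t = reconstruct \<epsilon> q p \<gamma> \<alpha> B w x t"
      and werr: "\<forall>t\<in>{0..T}. in_L2 (\<lambda>\<eta>. w \<eta> t - w' \<eta> t) \<and>
         L2norm (\<lambda>\<eta>. w \<eta> t - w' \<eta> t) \<le> E1 * \<epsilon> powr (- ?n / 4)"
      and perr: "\<forall>t\<in>{0..T}. Max {infnorm (q t - q' t), infnorm (p t - p' t), cmod (\<gamma> t - \<gamma>' t),
         mat_infnorm (\<alpha> t - \<alpha>' t), mat_infnorm (cplx_mat (B t - B' t))} \<le> E2"
      and mom: "fourth_moment_finite T q \<psi>"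
      and g1: "\<forall>t\<in>{0..T}. in_L2 (grad (\<lambda>\<eta>. w \<eta> t)) \<and>
         L2norm (grad (\<lambda>\<eta>. w \<eta> t)) \<le> C1 * \<epsilon> powr (- ?n / 4)"
      and g5: "\<forall>t\<in>{0..T}. in_L2 (\<lambda>\<eta>. norm \<eta> *\<^sub>R grad (\<lambda>\<xi>. w \<xi> t) \<eta>) \<and>
         L2norm (\<lambda>\<eta>. norm \<eta> *\<^sub>R grad (\<lambda>\<xi>. w \<xi> t) \<eta>) \<le> C5 * \<epsilon> powr (- ?n / 4)"
      and d1: "\<forall>t\<in>{0..T}. \<bar>exp (- (Im (\<gamma> t) - Im (\<gamma>' t)) / \<epsilon>) - 1\<bar> \<le> D1 * E2 / \<epsilon>"
      and d2: "\<forall>t\<in>{0..T}. exp (- (Im (\<gamma>' t) - Im (\<gamma> t)) / \<epsilon>) \<le> D2"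
      and "E2 \<le> K * \<epsilon>"
      and alt: "E2 < \<rho>1 \<or> (\<forall>t\<in>{0..T}. \<kappa> \<le> \<bar>det (B' t)\<bar>)"
      and t: "t \<in> {0..T}"
    let ?X = "\<epsilon> powr (- ?n / 4)" and ?r = "\<epsilon> powr (- 1 / 2)"
    let ?w = "\<lambda>\<eta>. w \<eta> t" and ?v = "\<lambda>\<eta>. w \<eta> t - w' \<eta> t"
    let ?\<psi> = "packet \<epsilon> (q t) (p t) (\<gamma> t) (\<alpha> t) (B t) ?w"
    let ?P = "packet \<epsilon> (q' t) (p' t) (\<gamma>' t) (\<alpha>' t) (B' t)"
    let ?N = "\<lambda>x. w (eta \<epsilon> (B t) (q t) x) t * exp (\<i> / complex_of_real \<epsilon> * theta (q' t) (p' t) (\<gamma>' t) (\<alpha>' t) x)"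
    let ?M4 = "fourth_moment T q \<psi>"
    define \<delta> where "\<delta> = k * E2"
    have bd: "norm (p t) \<le> R" "norm (Re_mat (\<alpha> t)) \<le> R" "norm (B t) \<le> R" "exp (- Im (\<gamma> t) / \<epsilon>) \<le> R"
      and inv: "\<And>M. norm (M - B t) \<le> \<rho> \<Longrightarrow> m \<le> \<bar>det M\<bar> \<and> (\<forall>v. c * norm v \<le> norm (M *v v))"
      using unif[OF e n1 sol t] by blast+
    have errs: "infnorm (q t - q' t) \<le> E2" "infnorm (p t - p' t) \<le> E2" "cmod (\<gamma> t - \<gamma>' t) \<le> E2"
      "mat_infnorm (\<alpha> t - \<alpha>' t) \<le> E2" "mat_infnorm (cplx_mat (B t - B' t)) \<le> E2"
      using bspec[OF perr t] by auto
    have E2: "0 \<le> E2" using errs(3) norm_ge_zero order_trans by blast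
    have k0: "0 \<le> k" using k by simp
    have \<delta>: "norm (q t - q' t) \<le> \<delta>" "norm (p t - p' t) \<le> \<delta>" "cmod (\<gamma> t - \<gamma>' t) \<le> \<delta>"
      "norm (Re_mat (\<alpha> t) - Re_mat (\<alpha>' t)) \<le> \<delta>" "norm (B t - B' t) \<le> \<delta>"
    proof -
      show "norm (q t - q' t) \<le> \<delta>" "norm (p t - p' t) \<le> \<delta>"
        unfolding \<delta>_def k_def using errs(1,2)
        by (auto intro!: order_trans[OF norm_le_card_infnorm] mult_left_mono)
      show "cmod (\<gamma> t - \<gamma>' t) \<le> \<delta>"
        using errs(3) mult_right_mono[OF k E2] by (simp add: \<delta>_def)
      show "norm (Re_mat (\<alpha> t) - Re_mat (\<alpha>' t)) \<le> \<delta>" unfolding \<delta>_def k_def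
      proof (rule norm_matrix_le_card)
        fix i j
        show "\<bar>(Re_mat (\<alpha> t) - Re_mat (\<alpha>' t)) $ i $ j\<bar> \<le> E2"
          using abs_Re_le_cmod[of "(\<alpha> t - \<alpha>' t) $ i $ j"] cmod_nth_le_mat_infnorm[of "\<alpha> t - \<alpha>' t" i j] errs(4)
          by (simp add: Re_mat_def)
      qed
      show "norm (B t - B' t) \<le> \<delta>" unfolding \<delta>_def k_def
      proof (rule norm_matrix_le_card)
        fix i j
        show "\<bar>(B t - B' t) $ i $ j\<bar> \<le> E2"
          using cmod_nth_le_mat_infnorm[of "cplx_mat (B t - B' t)" i j] errs(5)
          by (simp add: cplx_mat_def flip: of_real_diff)
      qed
    qed
    have detB: "m \<le> \<bar>det (B t)\<bar>" using inv[of "B t"] pos by simp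
    then have nzB: "det (B t) \<noteq> 0" using pos by auto
    have small: "\<delta> \<le> \<rho>" if "E2 < \<rho>1"
      using that k by (simp add: \<delta>_def \<rho>1_def field_simps)
    have detB': "m2 \<le> \<bar>det (B' t)\<bar>"
      using alt
    proof
      assume "E2 < \<rho>1"
      then have "norm (B' t - B t) \<le> \<rho>" using \<delta>(5) small by (simp add: norm_minus_commute)
      then show ?thesis using inv m2 by fastforce
    qed (use t m2 in fastforce)
    then have nzB': "det (B' t) \<noteq> 0" using m2 by auto
    have D2: "0 < D2" "exp (- (Im (\<gamma>' t) - Im (\<gamma> t)) / \<epsilon>) \<le> D2"
      using bspec[OF d2 t] exp_gt_zero less_le_trans by blast+
    have G': "exp (- Im (\<gamma>' t) / \<epsilon>) \<le> G"
    proof -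
      have "exp (- Im (\<gamma>' t) / \<epsilon>) = exp (- (Im (\<gamma>' t) - Im (\<gamma> t)) / \<epsilon>) * exp (- Im (\<gamma> t) / \<epsilon>)"
        by (simp add: exp_add[symmetric] diff_divide_distrib)
      also have "\<dots> \<le> D2 * R" using D2 bd(4) by (intro mult_mono) auto
      finally show ?thesis using D2 by (simp add: G_def)
    qed
    have dw: "\<And>x. ?w differentiable (at x)" and cgw: "continuous_on UNIV (grad ?w)"
    proof -
      have "C2 ?w" using wsol t by (simp add: w_solution_def)
      then show "\<And>x. ?w differentiable (at x)" "continuous_on UNIV (grad ?w)"
        by (auto simp: C2_def continuous_at_imp_continuous_on differentiable_imp_continuous_within)
    qed
    have cw: "continuous_on UNIV ?w"
      using dw by (simp add: continuous_at_imp_continuous_on differentiable_imp_continuous_within)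
    have wm: "?w \<in> borel_measurable lebesgue"
      using cw by (intro measurable_completion) (auto intro: borel_measurable_continuous_onI)
    have vm: "?v \<in> borel_measurable lebesgue" using bspec[OF werr t] by (simp add: in_L2_def)
    have E1: "0 \<le> E1"
    proof -
      have "0 \<le> E1 * ?X"
        using bspec[OF werr t] by (rule order_trans[rotated, OF conjunct2]) (simp add: L2norm_def)
      then show ?thesis using e by (simp add: zero_le_mult_iff)
    qed
    have L2v: "L2sq ?v \<le> ennreal (E1\<^sup>2 * ?X\<^sup>2)"
      and L2g1: "L2sq (grad ?w) \<le> ennreal (C1\<^sup>2 * ?X\<^sup>2)"
      and L2g5: "L2sq (\<lambda>\<eta>. norm \<eta> *\<^sub>R grad ?w \<eta>) \<le> ennreal (C5\<^sup>2 * ?X\<^sup>2)"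
      using bspec[OF werr t] bspec[OF g1 t] bspec[OF g5 t]
      by (auto simp only: power_mult_distrib[symmetric] intro!: L2sq_le)
    have \<psi>e: "\<psi> x s = packet \<epsilon> (q s) (p s) (\<gamma> s) (\<alpha> s) (B s) (\<lambda>\<eta>. w \<eta> s) x" if "s \<in> {0..T}" for x s
      using \<psi> that by (simp add: reconstruct_eq_packet)
    have momt: "integrable lebesgue (\<lambda>x. norm (x - q t) ^ 4 * (cmod (?\<psi> x))\<^sup>2)"
      using mom t unfolding fourth_moment_finite_def by (simp add: \<psi>e)
    have M4: "(LINT x|lebesgue. norm (x - q t) ^ 4 * (cmod (?\<psi> x))\<^sup>2) \<le> ?M4"
      unfolding fourth_moment_def \<psi>e[OF t, symmetric]
      using mom t by (intro cSUP_upper) (auto simp: fourth_moment_finite_def)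
    have M40: "0 \<le> ?M4" using M4 by (rule order_trans[rotated]) simp
    have L2w: "L2sq ?w \<le> ennreal (24 * C5\<^sup>2 * ?X\<^sup>2)"
    proof -
      have "L2sq ?w \<le> 24 * L2sq (\<lambda>\<eta>. norm \<eta> *\<^sub>R grad ?w \<eta>)"
        by (rule L2sq_le_radial_gradient[OF dw cgw L2sq_finite_of_moment[OF cw nzB e momt]])
      also have "\<dots> \<le> ennreal 24 * ennreal (C5\<^sup>2 * ?X\<^sup>2)"
        using L2g5 by (intro mult_mono) auto
      finally show ?thesis by (simp add: ennreal_mult[symmetric] mult.assoc del: ennreal_numeral)
    qed
    have \<psi>L2: "L2sq ?\<psi> \<le> ennreal H"
      unfolding H_def by (rule L2sq_packet_le[OF wm detB pos(3) e bd(4) L2w]) simp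
    have PvL2: "L2sq (?P ?v) \<le> ennreal ((G * E1 / sqrt m2)\<^sup>2)"
      using L2sq_packet_le[OF vm detB' m2(1) e G' L2v] m2 by (simp add: power_mult_distrib power_divide)
    have \<psi>m: "?\<psi> \<in> borel_measurable lebesgue" by (rule borel_measurable_packet[OF wm nzB e])
    have Pwm: "?P ?w \<in> borel_measurable lebesgue" by (rule borel_measurable_packet[OF wm nzB' e])
    have Pvm: "?P ?v \<in> borel_measurable lebesgue" by (rule borel_measurable_packet[OF vm nzB' e])
    have eq: "\<psi> x t - reconstruct \<epsilon> q' p' \<gamma>' \<alpha>' B' w' x t = (?\<psi> x - ?P ?w x) + ?P ?v x" for x
      by (simp add: \<psi>e[OF t] reconstruct_eq_packet packet_diff)
    have r0: "0 \<le> ?r" by simp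
    \<comment> \<open>\<open>a\<close> bounds the effect of the parameter errors on the exact
      profile \<open>w\<close>, in whichever regime of \<open>E2\<close>; the profile error is added
      afterwards in the same way for both.\<close>
    obtain a where a: "0 \<le> a" "L2sq (\<lambda>x. ?\<psi> x - ?P ?w x) \<le> ennreal (a\<^sup>2)"
      "2 * a \<le> A2 * E2 * (1 + ?r) + A3 * (E2 / \<epsilon>) * (sqrt ?M4 + 1)"
    proof (cases "E2 < \<rho>1")
      case True
      define a1 where "a1 = G * (\<delta> * L * (1 + ?r))"
      define a3 where "a3 = Y * sqrt (2 * H + 2) * (E2 / \<epsilon>) * (sqrt ?M4 + 1)"
      have d0: "0 \<le> \<delta>" using E2 k0 by (simp add: \<delta>_def)
      have a0: "0 \<le> a1" "0 \<le> a3"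
        using nonneg d0 E2 e M40 by (auto simp: a1_def a3_def)
      have T1: "L2sq (\<lambda>x. ?N x - ?P ?w x) \<le> ennreal (a1\<^sup>2)"
        unfolding a1_def
        by (rule packet_transport_bound[OF e dw cgw L2g1 L2g5 \<delta>(1,5) small[OF True] bd(3) inv pos(3,4) G' L_def])
      have T3: "L2sq (\<lambda>x. ?\<psi> x - ?N x) \<le> ennreal (a3\<^sup>2)"
        unfolding a3_def
        using packet_phase_bound[OF e wm nzB \<delta>(1-4) bd(1,2) small[OF True] \<delta>_def E2 k0 bspec[OF d1 t]
            D2(2) \<psi>L2 nonneg(3) momt M4] D2(1) by (simp add: Y_def)
      have Nm: "?N \<in> borel_measurable lebesgue"
      proof -
        have "continuous_on UNIV ?N"
          by (intro continuous_on_mult continuous_on_packet_phase continuous_on_compose2[OF cw continuous_on_eta])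
             simp
        then show ?thesis by (intro measurable_completion) (auto intro: borel_measurable_continuous_onI)
      qed
      have "L2sq (\<lambda>x. (?\<psi> x - ?N x) + (?N x - ?P ?w x)) \<le> ennreal ((2 * (a3 + a1))\<^sup>2)"
        using \<psi>m Nm Pwm a0 by (intro L2sq_add_sq_le T1 T3) auto
      moreover have "2 * (2 * (a3 + a1)) \<le> A2 * E2 * (1 + ?r) + A3 * (E2 / \<epsilon>) * (sqrt ?M4 + 1)"
      proof -
        have "4 * (G * k * L) \<le> A2" using nonneg \<rho>1 by (simp add: A2_def)
        then have "4 * (G * k * L) * (E2 * (1 + ?r)) \<le> A2 * (E2 * (1 + ?r))"
          using E2 r0 by (intro mult_right_mono) auto
        then have a1': "4 * a1 \<le> A2 * E2 * (1 + ?r)"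
          unfolding a1_def \<delta>_def by (simp only: mult_ac)
        have "4 * a3 = A3 * (E2 / \<epsilon>) * (sqrt ?M4 + 1)"
          by (simp add: a3_def A3_def)
        from add_mono[OF a1' eq_refl[OF this]] show ?thesis by simp
      qed
      ultimately show ?thesis using that[of "2 * (a3 + a1)"] a0 by simp
    next
      case False
      have "L2sq (?P ?w) \<le> ennreal H'"
        unfolding H'_def by (rule L2sq_packet_le[OF wm detB' m2(1) e G' L2w]) simp
      then have "L2sq (\<lambda>x. - ?P ?w x) \<le> ennreal ((sqrt H')\<^sup>2)"
        using nonneg by (simp add: L2sq_def)
      then have "L2sq (\<lambda>x. ?\<psi> x + - ?P ?w x) \<le> ennreal ((2 * (sqrt H + sqrt H'))\<^sup>2)"
        using \<psi>L2 nonneg \<psi>m Pwm by (intro L2sq_add_sq_le) auto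
      moreover have "2 * (2 * (sqrt H + sqrt H')) \<le> A2 * E2 * (1 + ?r) + A3 * (E2 / \<epsilon>) * (sqrt ?M4 + 1)"
      proof -
        have h0: "0 \<le> 4 * ((sqrt H + sqrt H') / \<rho>1)" using nonneg \<rho>1 by simp
        \<comment> \<open>A bound of order one is written as a multiple of \<open>\<rho>1\<close>,
          which here is at most \<open>E2\<close>.\<close>
        have "2 * (2 * (sqrt H + sqrt H')) = 4 * ((sqrt H + sqrt H') / \<rho>1) * \<rho>1" using \<rho>1 by simp
        also have "\<dots> \<le> A2 * E2"
          using False h0 nonneg k0 \<rho>1 by (intro mult_mono) (auto simp: A2_def)
        also have "\<dots> \<le> A2 * E2 * (1 + ?r)"
          using A(2) E2 r0 mult_left_mono[of 1 "1 + ?r" "A2 * E2"] by simp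
        finally show ?thesis using A(3) E2 e M40 by (simp add: add_increasing2)
      qed
      ultimately show ?thesis using that[of "2 * (sqrt H + sqrt H')"] nonneg by simp
    qed
    define b where "b = G * E1 / sqrt m2"
    have b0: "0 \<le> b" using nonneg E1 m2 by (simp add: b_def)
    have "L2sq (\<lambda>x. (?\<psi> x - ?P ?w x) + ?P ?v x) \<le> ennreal ((2 * (a + b))\<^sup>2)"
      using \<psi>m Pwm Pvm a b0 PvL2 by (intro L2sq_add_sq_le) (auto simp: b_def)
    then have fin: "in_L2 (\<lambda>x. \<psi> x t - reconstruct \<epsilon> q' p' \<gamma>' \<alpha>' B' w' x t) \<and>
        L2norm (\<lambda>x. \<psi> x t - reconstruct \<epsilon> q' p' \<gamma>' \<alpha>' B' w' x t) \<le> 2 * (a + b)"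
      unfolding eq using \<psi>m Pwm Pvm a(1) b0 by (intro in_L2_L2norm_le) auto
    have "2 * b \<le> A1 * E1" using E1 by (simp add: b_def A1_def algebra_simps)
    from add_mono[OF this a(3)]
    have "2 * (a + b) \<le> A1 * E1 + A2 * E2 * (1 + ?r) + A3 * (E2 / \<epsilon>) * (sqrt ?M4 + 1)"
      by (simp add: add.assoc)
    with fin show "in_L2 (\<lambda>x. \<psi> x t - reconstruct \<epsilon> q' p' \<gamma>' \<alpha>' B' w' x t) \<and>
        L2norm (\<lambda>x. \<psi> x t - reconstruct \<epsilon> q' p' \<gamma>' \<alpha>' B' w' x t)
          \<le> A1 * E1 + A2 * E2 * (1 + \<epsilon> powr (- 1 / 2)) + A3 * (E2 / \<epsilon>) * (sqrt (fourth_moment T q \<psi>) + 1)"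
      by (blast intro: order_trans)
  qed
qed

end
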